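(* Let $\mu$ be the distribution of a standard Brownian bridge $B$ on $L_2=L_2([0,1])$. Then $$\operatorname{rbit}(\mu,p)\asymp\operatorname{quant}(\mu,p)\asymp p^{-1/2}$$ uniformly in $p\in\mathbb{N}$. For $\ell\in\mathbb{N}$ define $\boldsymbol{p}(\ell)\in\mathbb{N}^{2^\ell-1}$ by $$p_i(\ell)=2\cdot(\ell-\lfloor\log_2 i\rfloor),\qquad i=1,\dots,2^\ell-1.$$ Then $$\left(\operatorname{E}\bigl\|B-B^{(\ell,\boldsymbol{p}(\ell))}\bigr\|_{L_2}^2\right)^{1/2}\asymp\operatorname{rbit}(\mu,|\boldsymbol{p}(\ell)|)$$ uniformly in $\ell\in\mathbb{N}$, and $$|\boldsymbol{p}(\ell)|=2^{\ell+2}-2\ell-4\asymp 2^\ell .$$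
   Context: $\mathbb{N}=\{1,2,\dots\}$, $\mathbb{N}_0=\mathbb{N}\cup\{0\}$. For functions $f,g\colon M\to[0,\infty]$ on a set $M$, $f(m)\preceq g(m)$ means that there is a constant $c>0$ with $f(m)\le c\,g(m)$ for every $m\in M$; $f\asymp g$ means $f\preceq g$ and $g\preceq f$. For a separable Banach space $(V,\|\cdot\|_V)$, $\mathfrak{M}(V)$ is the set of all Borel probability measures on $V$ with finite second moment, equipped with the Wasserstein distance of order two, $d(\mu_1,\mu_2)=\inf\{(\operatorname{E}\|X_1-X_2\|_V^2)^{1/2}\colon P_{X_1}=\mu_1,\ P_{X_2}=\mu_2\}$ ($X_1,X_2$ jointly defined on any probability space). For $p\in\mathbb{N}$, $\mathfrak{R}(V,p)\subseteq\mathfrak{M}(V)$ is the set of all image measures of the uniform distribution on $\{0,1\}^p$ under maps $f\colon\{0,1\}^p\to V$, and $\mathfrak{F}(V,p)=\{\nu\in\mathfrak{M}(V)\colon|\operatorname{supp}(\nu)|\le 2^p\}$. Put $\operatorname{rbit}(\mu,p)=\inf\{d(\mu,\nu)\colon\nu\in\mathfrak{R}(V,p)\}$ and $\operatorname{quant}(\mu,p)=\inf\{d(\mu,\nu)\colon\nu\in\mathfrak{F}(V,p)\}$. Here $V=L_2([0,1])$. Approximation of a standard normal variable: $\Phi$ is the standard normal distribution function; for $p\in\mathbb{N}$ and $x\in[0,1[$, $T^{(p)}(x)=\lfloor 2^p x\rfloor/2^p+2^{-(p+1)}$; for a standard normal random variable $Y$, $Y^{(p)}=\Phi^{-1}\circ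 T^{(p)}\circ\Phi(Y)$. Schauder functions: for $r\in\mathbb{N}_0$ and $k=1,\dots,2^r$ let $h_{2^r+k-1}=2^{r/2}(1_{I}-1_{J})$ with $I=[(k-1)/2^r,(k-1/2)/2^r[$ and $J=[(k-1/2)/2^r,k/2^r[$, and let $s_i(t)=\int_0^t h_i(u)\,\mathrm{d}u$, $t\in[0,1]$, $i\in\mathbb{N}$. The standard Brownian bridge $B$ on $[0,1]$, a centered Gaussian random element of $L_2$, has the L\'evy-Ciesielski representation $B=\sum_{i=1}^\infty Y_i\cdot s_i$ (convergence in mean-square with respect to the $L_2$-norm), where $Y_1,Y_2,\dots$ are independent standard normal random variables. For $\ell\in\mathbb{N}$ and a vector $\boldsymbol{p}=(p_1,\dots,p_{2^\ell-1})\in\mathbb{N}^{2^\ell-1}$ of bit numbers, $B^{(\ell,\boldsymbol{p})}=\sum_{i=1}^{2^\ell-1}Y_i^{(p_i)}\cdot s_i$ and $|\boldsymbol{p}|=\sum_{i=1}^{2^\ell-1}p_i$. *)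

theory Defs
  imports "HOL-Probability.Probability"
begin

subsection \<open>The space of square-integrable functions on the unit interval\<close>

abbreviation lborel01 :: "real measure" where
  "lborel01 \<equiv> restrict_space lborel {0..1}"

lemma sets_lborel01 [measurable_cong]: "sets lborel01 = sets (restrict_space borel {0..1})"
  by (simp add: sets_restrict_space)

lemma space_lborel01 [simp]: "space lborel01 = {0..1}"
  by (simp add: space_restrict_space)

lemma borel_measurable_lborel01I [measurable (raw)]:
  "f \<in> borel_measurable borel \<Longrightarrow> f \<in> borel_measurable lborel01"
  by (intro measurable_restrict_space1) simp

lemma prob_space_lborel01: "prob_space lborel01"
  by standard (simp add: emeasure_restrict_space)

definition square_integrable :: "(real \<Rightarrow> real) \<Rightarrow> bool" where
  "square_integrable f \<longleftrightarrow>
     f \<in> borel_measurable lborel01 \<and> integrable lborel01 (\<lambda>t. (f t)\<^sup>2)"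

definition L2_rel :: "(real \<Rightarrow> real) \<Rightarrow> (real \<Rightarrow> real) \<Rightarrow> bool" where
  "L2_rel f g \<longleftrightarrow>
     square_integrable f \<and> square_integrable g \<and> (AE t in lborel01. f t = g t)"

lemma square_integrable_mult:
  assumes "square_integrable f" "square_integrable g"
  shows "integrable lborel01 (\<lambda>t. f t * g t)"
proof (rule Bochner_Integration.integrable_bound)
  show "integrable lborel01 (\<lambda>t. (f t)\<^sup>2 + (g t)\<^sup>2)"
    using assms by (auto simp: square_integrable_def)
  show "(\<lambda>t. f t * g t) \<in> borel_measurable lborel01"
    using assms by (auto simp: square_integrable_def)
  show "AE t in lborel01. norm (f t * g t) \<le> norm ((f t)\<^sup>2 + (g t)\<^sup>2)"
  proof (rule AE_I2)
    fix t
    have "0 \<le> (\<bar>f t\<bar> - \<bar>g t\<bar>)\<^sup>2" "0 \<le> \<bar>f t\<bar> * \<bar>g t\<bar>" by simp_all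
    then have "\<bar>f t\<bar> * \<bar>g t\<bar> \<le> (f t)\<^sup>2 + (g t)\<^sup>2"
      unfolding power2_diff power2_abs by linarith
    then show "norm (f t * g t) \<le> norm ((f t)\<^sup>2 + (g t)\<^sup>2)"
      by (simp add: abs_mult)
  qed
qed

lemma square_integrable_add:
  assumes "square_integrable f" "square_integrable g"
  shows "square_integrable (\<lambda>t. f t + g t)"
proof -
  have "integrable lborel01 (\<lambda>t. (f t)\<^sup>2 + 2 * (f t * g t) + (g t)\<^sup>2)"
    using assms square_integrable_mult[OF assms] by (auto simp: square_integrable_def)
  moreover have "(\<lambda>t. (f t)\<^sup>2 + 2 * (f t * g t) + (g t)\<^sup>2) = (\<lambda>t. (f t + g t)\<^sup>2)"
    by (auto simp: power2_sum fun_eq_iff)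
  ultimately show ?thesis
    using assms by (auto simp: square_integrable_def)
qed

lemma square_integrable_scale:
  "square_integrable f \<Longrightarrow> square_integrable (\<lambda>t. c * f t)"
  by (auto simp: square_integrable_def power_mult_distrib)

lemma square_integrable_zero: "square_integrable (\<lambda>_. 0)"
  by (simp add: square_integrable_def)

lemma square_integrable_mono:
  assumes g: "square_integrable g" and f: "f \<in> borel_measurable lborel01"
    and le: "\<And>t. t \<in> {0..1} \<Longrightarrow> \<bar>f t\<bar> \<le> \<bar>g t\<bar>"
  shows "square_integrable f"
proof -
  have "integrable lborel01 (\<lambda>t. (f t)\<^sup>2)"
  proof (rule Bochner_Integration.integrable_bound)
    show "integrable lborel01 (\<lambda>t. (g t)\<^sup>2)"
      using g by (simp add: square_integrable_def)
    show "AE t in lborel01. norm ((f t)\<^sup>2) \<le> norm ((g t)\<^sup>2)"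
      using le by (intro AE_I2) (simp add: abs_le_square_iff)
  qed (use f in simp)
  with f show ?thesis by (simp add: square_integrable_def)
qed

lemma square_integrable_bounded:
  assumes "f \<in> borel_measurable lborel01" "\<And>t. t \<in> {0..1} \<Longrightarrow> \<bar>f t\<bar> \<le> C"
  shows "square_integrable f"
proof -
  interpret lborel01: prob_space lborel01 by (rule prob_space_lborel01)
  have "integrable lborel01 (\<lambda>t. (f t)\<^sup>2)"
  proof (rule lborel01.integrable_const_bound[where B = "C\<^sup>2"])
    show "AE t in lborel01. norm ((f t)\<^sup>2) \<le> C\<^sup>2"
      using assms(2) by (intro AE_I2) (auto simp: abs_le_square_iff[symmetric] intro: order_trans[OF _ abs_ge_self])
  qed (use assms(1) in auto)
  with assms(1) show ?thesis by (simp add: square_integrable_def)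
qed

text \<open>The elements of the space are classes modulo almost everywhere equality on the unit interval.\<close>

quotient_type L2 = "real \<Rightarrow> real" / partial: L2_rel
  morphisms rep_L2 abs_L2
proof (rule part_equivpI)
  show "\<exists>f. L2_rel f f"
    using square_integrable_zero by (auto simp: L2_rel_def)
  show "symp L2_rel"
    by (auto simp: symp_def L2_rel_def)
  show "transp L2_rel"
    by (auto simp: transp_def L2_rel_def elim!: AE_mp)
qed

instantiation L2 :: real_vector
begin

lift_definition zero_L2 :: L2 is "\<lambda>_. 0"
  by (simp add: L2_rel_def square_integrable_zero)

lift_definition plus_L2 :: "L2 \<Rightarrow> L2 \<Rightarrow> L2" is "\<lambda>f g t. f t + g t"
  unfolding L2_rel_def by (auto intro: square_integrable_add)

lift_definition scaleR_L2 :: "real \<Rightarrow> L2 \<Rightarrow> L2" is "\<lambda>c f t. c * f t"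
  unfolding L2_rel_def by (auto intro: square_integrable_scale)

definition uminus_L2 :: "L2 \<Rightarrow> L2" where "uminus_L2 x = (- 1) *\<^sub>R x"

definition minus_L2 :: "L2 \<Rightarrow> L2 \<Rightarrow> L2" where "minus_L2 x y = x + - y"

instance
proof
  fix a b :: real and x y z :: L2
  show "x + y + z = x + (y + z)"
    by transfer (auto simp: L2_rel_def add.assoc intro!: square_integrable_add)
  show "x + y = y + x"
    by transfer (auto simp: L2_rel_def add.commute intro!: square_integrable_add)
  show "0 + x = x"
    by transfer (auto simp: L2_rel_def)
  show "- x + x = 0"
    unfolding uminus_L2_def
    by transfer (auto simp: L2_rel_def square_integrable_zero)
  show "x - y = x + - y"
    by (simp add: minus_L2_def)
  show "a *\<^sub>R (x + y) = a *\<^sub>R x + a *\<^sub>R y"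
    by transfer (auto simp: L2_rel_def algebra_simps intro!: square_integrable_add square_integrable_scale)
  show "(a + b) *\<^sub>R x = a *\<^sub>R x + b *\<^sub>R x"
    by transfer (auto simp: L2_rel_def algebra_simps intro!: square_integrable_add square_integrable_scale)
  show "a *\<^sub>R b *\<^sub>R x = (a * b) *\<^sub>R x"
    by transfer (auto simp: L2_rel_def algebra_simps intro!: square_integrable_scale)
  show "1 *\<^sub>R x = x"
    by transfer (auto simp: L2_rel_def)
qed

end

instantiation L2 :: real_inner
begin

lift_definition inner_L2 :: "L2 \<Rightarrow> L2 \<Rightarrow> real" is "\<lambda>f g. LINT t|lborel01. f t * g t"
proof -
  fix f f' g g' assume "L2_rel f f'" "L2_rel g g'"
  then show "(LINT t|lborel01. f t * g t) = (LINT t|lborel01. f' t * g' t)"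
    by (intro integral_cong_AE) (auto simp: L2_rel_def square_integrable_def elim!: AE_mp)
qed

definition norm_L2 :: "L2 \<Rightarrow> real" where "norm_L2 x = sqrt (inner x x)"

definition dist_L2 :: "L2 \<Rightarrow> L2 \<Rightarrow> real" where "dist_L2 x y = norm (x - y)"

definition sgn_L2 :: "L2 \<Rightarrow> L2" where "sgn_L2 x = inverse (norm x) *\<^sub>R x"

definition uniformity_L2 :: "(L2 \<times> L2) filter" where
  "uniformity_L2 = (INF e\<in>{0<..}. principal {(x, y). dist x y < e})"

definition open_L2 :: "L2 set \<Rightarrow> bool" where
  "open_L2 U \<longleftrightarrow> (\<forall>x\<in>U. eventually (\<lambda>(x', y). x' = x \<longrightarrow> y \<in> U) uniformity)"

instance
proof
  fix r :: real and x y z :: L2 and U :: "L2 set"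
  show "dist x y = norm (x - y)" by (rule dist_L2_def)
  show "sgn x = inverse (norm x) *\<^sub>R x" by (rule sgn_L2_def)
  show "(uniformity :: (L2 \<times> L2) filter) = (INF e\<in>{0<..}. principal {(x, y). dist x y < e})"
    by (rule uniformity_L2_def)
  show "open U \<longleftrightarrow> (\<forall>x\<in>U. eventually (\<lambda>(x', y). x' = x \<longrightarrow> y \<in> U) uniformity)"
    by (rule open_L2_def)
  show "norm x = sqrt (inner x x)" by (rule norm_L2_def)
  show "inner x y = inner y x"
    by transfer (simp add: mult.commute)
  show "inner (x + y) z = inner x z + inner y z"
    by transfer (simp add: L2_rel_def algebra_simps square_integrable_mult)
  show "inner (r *\<^sub>R x) y = r * inner x y"
    by transfer (simp add: L2_rel_def mult.assoc)
  show "0 \<le> inner x x"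
    by transfer simp
  show "inner x x = 0 \<longleftrightarrow> x = 0"
  proof transfer
    fix f assume f: "L2_rel f f"
    then have "(LINT t|lborel01. f t * f t) = 0 \<longleftrightarrow> (AE t in lborel01. f t * f t = 0)"
      by (intro integral_nonneg_eq_0_iff_AE) (auto simp: L2_rel_def square_integrable_mult)
    with f show "(LINT t|lborel01. f t * f t) = 0 \<longleftrightarrow> L2_rel f (\<lambda>_. 0)"
      by (simp add: L2_rel_def square_integrable_zero)
  qed
qed

end


lemma square_integrable_rep_L2: "square_integrable (rep_L2 x)"
  using Quotient_rep_reflp[OF Quotient_L2, of x] by (simp add: L2_rel_def)

lemma abs_rep_L2 [simp]: "abs_L2 (rep_L2 x) = x"
  by (rule Quotient_abs_rep[OF Quotient_L2])

lemma rep_abs_L2: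
  assumes "square_integrable f"
  shows "AE t in lborel01. rep_L2 (abs_L2 f) t = f t"
  using Quotient_rep_abs[OF Quotient_L2, of f] assms by (simp add: L2_rel_def)

lemma abs_L2_eq:
  assumes "square_integrable f" "square_integrable g" "AE t in lborel01. f t = g t"
  shows "abs_L2 f = abs_L2 g"
  using Quotient_rel_abs[OF Quotient_L2, of f g] assms by (simp add: L2_rel_def)

lemma abs_L2_zero: "abs_L2 (\<lambda>_. 0) = 0"
  by (simp add: zero_L2_def)

lemma abs_L2_add:
  assumes "square_integrable f" "square_integrable g"
  shows "abs_L2 (\<lambda>t. f t + g t) = abs_L2 f + abs_L2 g"
  using assms by (simp add: plus_L2.abs_eq L2_rel_def)

lemma abs_L2_scaleR:
  assumes "square_integrable f"
  shows "abs_L2 (\<lambda>t. c * f t) = c *\<^sub>R abs_L2 f"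
  using assms by (simp add: scaleR_L2.abs_eq L2_rel_def)

lemma square_integrable_diff:
  assumes "square_integrable f" "square_integrable g"
  shows "square_integrable (\<lambda>t. f t - g t)"
  using square_integrable_add[OF assms(1) square_integrable_scale[OF assms(2), of "-1"]] by simp

lemma abs_L2_diff:
  assumes "square_integrable f" "square_integrable g"
  shows "abs_L2 (\<lambda>t. f t - g t) = abs_L2 f - abs_L2 g"
  using abs_L2_add[OF assms(1) square_integrable_scale[OF assms(2), of "-1"]]
    abs_L2_scaleR[OF assms(2), of "-1"] by simp

lemma inner_abs_L2:
  assumes "square_integrable f" "square_integrable g"
  shows "inner (abs_L2 f) (abs_L2 g) = (LINT t|lborel01. f t * g t)"
  using assms by (simp add: inner_L2.abs_eq L2_rel_def)

lemma norm_abs_L2: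
  assumes "square_integrable f"
  shows "(norm (abs_L2 f))\<^sup>2 = (LINT t|lborel01. (f t)\<^sup>2)"
  unfolding power2_norm_eq_inner inner_abs_L2[OF assms assms] by (simp add: power2_eq_square)

lemma nn_norm_abs_L2:
  assumes "square_integrable f"
  shows "ennreal ((norm (abs_L2 f))\<^sup>2) = (\<integral>\<^sup>+t. ennreal ((f t)\<^sup>2) \<partial>lborel01)"
  unfolding norm_abs_L2[OF assms]
  using assms by (intro nn_integral_eq_integral[symmetric]) (auto simp: square_integrable_def)

lemma square_integrableI_nn:
  assumes "f \<in> borel_measurable lborel01" "(\<integral>\<^sup>+t. ennreal ((f t)\<^sup>2) \<partial>lborel01) < \<infinity>"
  shows "square_integrable f"
  using assms by (auto simp: square_integrable_def intro!: integrableI_bounded)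

lemma L2_cases:
  obtains f where "square_integrable f" "x = abs_L2 f"
  using square_integrable_rep_L2[of x] abs_rep_L2[of x] by metis

instance L2 :: banach
proof
  fix X :: "nat \<Rightarrow> L2" assume X: "Cauchy X"
  define F where "F n = rep_L2 (X n)" for n
  have F: "square_integrable (F n)" "abs_L2 (F n) = X n" for n
    by (simp_all add: F_def square_integrable_rep_L2)
  have [measurable]: "F n \<in> borel_measurable lborel01" for n
    using F by (simp add: square_integrable_def)
  have nn_F: "(\<integral>\<^sup>+t. ennreal ((F n t - F m t)\<^sup>2) \<partial>lborel01) = ennreal ((dist (X n) (X m))\<^sup>2)" for n m
    using nn_norm_abs_L2[OF square_integrable_diff[OF F(1) F(1), of n m]]
    by (simp add: abs_L2_diff F dist_norm)
  have "\<forall>k. \<exists>N. \<forall>m\<ge>N. \<forall>n\<ge>N. dist (X m) (X n) < (1 / 2) ^ k"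
    using X by (auto simp: Cauchy_def)
  then obtain N where N: "\<And>k m n. m \<ge> N k \<Longrightarrow> n \<ge> N k \<Longrightarrow> dist (X m) (X n) < (1 / 2) ^ k"
    by metis
  define r where "r k = (\<Sum>i\<le>k. N i) + k" for k
  have r_ge: "N k \<le> r k" "N k \<le> r (Suc k)" "k \<le> r k" for k
    using member_le_sum[of k "{..k}" N] by (auto simp: r_def)
  define G where "G k t = F (r (Suc k)) t - F (r k) t" for k t
  have [measurable]: "G k \<in> borel_measurable lborel01" for k
    unfolding G_def by measurable
  have int_G: "(\<integral>\<^sup>+t. ennreal (2 ^ k * (G k t)\<^sup>2) \<partial>lborel01) \<le> ennreal ((1 / 2) ^ k)" for k
  proof -
    have "(\<integral>\<^sup>+t. ennreal (2 ^ k * (G k t)\<^sup>2) \<partial>lborel01)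
        = ennreal (2 ^ k) * (\<integral>\<^sup>+t. ennreal ((G k t)\<^sup>2) \<partial>lborel01)"
      by (simp add: ennreal_mult nn_integral_cmult)
    also have "\<dots> = ennreal (2 ^ k * (dist (X (r (Suc k))) (X (r k)))\<^sup>2)"
      by (simp add: G_def nn_F ennreal_mult)
    also have "\<dots> \<le> ennreal (2 ^ k * ((1 / 2) ^ k)\<^sup>2)"
      using N[of k "r (Suc k)" "r k"] r_ge[of k]
      by (intro ennreal_leI mult_left_mono power_mono) auto
    also have "2 ^ k * ((1 / 2) ^ k)\<^sup>2 = ((1 / 2) ^ k :: real)"
      by (simp add: power2_eq_square power_divide)
    finally show ?thesis .
  qed
  have "(\<integral>\<^sup>+t. (\<Sum>k. ennreal (2 ^ k * (G k t)\<^sup>2)) \<partial>lborel01)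
      = (\<Sum>k. (\<integral>\<^sup>+t. ennreal (2 ^ k * (G k t)\<^sup>2) \<partial>lborel01))"
    by (intro nn_integral_suminf) measurable
  also have "\<dots> \<le> (\<Sum>k. ennreal ((1 / 2) ^ k))"
    by (intro suminf_le int_G) auto
  also have "\<dots> < \<infinity>"
    by (subst suminf_ennreal2) (auto intro: summable_geometric)
  finally have "AE t in lborel01. (\<Sum>k. ennreal (2 ^ k * (G k t)\<^sup>2)) \<noteq> \<infinity>"
    by (intro nn_integral_PInf_AE) auto
  then have conv: "AE t in lborel01. (\<lambda>k. F (r k) t) \<longlonglongrightarrow> lim (\<lambda>k. F (r k) t)"
  proof eventually_elim
    case (elim t)
    have "summable (\<lambda>k. 2 ^ k * (G k t)\<^sup>2)"
      using elim by (intro summable_suminf_not_top) auto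
    then have "summable (\<lambda>k. 2 ^ k * (G k t)\<^sup>2 + (1 / 2) ^ k)"
      by (intro summable_add summable_geometric) auto
    then have "summable (\<lambda>k. G k t)"
    proof (rule summable_comparison_test'[where N = 0])
      fix k :: nat
      define c :: real where "c = 2 ^ k"
      have c: "c > 0" by (simp add: c_def)
      have "0 \<le> (c * \<bar>G k t\<bar> - 1)\<^sup>2" "0 \<le> c * \<bar>G k t\<bar>" using c by simp_all
      then have "c * \<bar>G k t\<bar> \<le> c\<^sup>2 * (G k t)\<^sup>2 + 1"
        unfolding power2_diff power_mult_distrib power2_abs by simp
      then have "\<bar>G k t\<bar> \<le> c * (G k t)\<^sup>2 + 1 / c"
        using c by (simp add: field_simps power2_eq_square)
      then show "norm (G k t) \<le> 2 ^ k * (G k t)\<^sup>2 + (1 / 2) ^ k"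
        by (simp add: c_def power_divide)
    qed
    then have "(\<lambda>n. F (r 0) t + (\<Sum>k<n. G k t)) \<longlonglongrightarrow> F (r 0) t + (\<Sum>k. G k t)"
      by (intro tendsto_add tendsto_const summable_LIMSEQ)
    moreover have "F (r 0) t + (\<Sum>k<n. G k t) = F (r n) t" for n
      using sum_lessThan_telescope[of "\<lambda>k. F (r k) t" n] by (simp add: G_def)
    ultimately have "convergent (\<lambda>k. F (r k) t)"
      by (auto simp: convergent_def)
    then show ?case
      by (simp add: convergent_LIMSEQ_iff)
  qed
  define f where "f t = lim (\<lambda>k. F (r k) t)" for t
  have [measurable]: "f \<in> borel_measurable lborel01"
    unfolding f_def by measurable
  have Fatou: "(\<integral>\<^sup>+t. ennreal ((F n t - f t)\<^sup>2) \<partial>lborel01) \<le> ennreal (e\<^sup>2)"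
    if e: "0 < e" "\<And>m. m \<ge> n0 \<Longrightarrow> dist (X n) (X m) < e" for e n n0
  proof -
    have "(\<integral>\<^sup>+t. ennreal ((F n t - f t)\<^sup>2) \<partial>lborel01)
        = (\<integral>\<^sup>+t. liminf (\<lambda>k. ennreal ((F n t - F (r k) t)\<^sup>2)) \<partial>lborel01)"
    proof (intro nn_integral_cong_AE)
      show "AE t in lborel01. ennreal ((F n t - f t)\<^sup>2)
          = liminf (\<lambda>k. ennreal ((F n t - F (r k) t)\<^sup>2))"
        using conv
      proof eventually_elim
        case (elim t)
        then have "(\<lambda>k. ennreal ((F n t - F (r k) t)\<^sup>2)) \<longlonglongrightarrow> ennreal ((F n t - f t)\<^sup>2)"
          unfolding f_def by (intro tendsto_ennrealI tendsto_power tendsto_diff tendsto_const)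
        then show ?case
          by (intro lim_imp_Liminf[OF trivial_limit_sequentially, symmetric])
      qed
    qed
    also have "\<dots> \<le> liminf (\<lambda>k. (\<integral>\<^sup>+t. ennreal ((F n t - F (r k) t)\<^sup>2) \<partial>lborel01))"
      by (intro nn_integral_liminf) measurable
    also have "\<dots> \<le> ennreal (e\<^sup>2)"
    proof (rule order_trans[OF Liminf_mono Liminf_const[THEN eq_refl]])
      show "\<forall>\<^sub>F k in sequentially.
          (\<integral>\<^sup>+t. ennreal ((F n t - F (r k) t)\<^sup>2) \<partial>lborel01) \<le> ennreal (e\<^sup>2)"
        using eventually_ge_at_top[of n0]
      proof eventually_elim
        case (elim k)
        then have "dist (X n) (X (r k)) < e"
          using r_ge(3)[of k] by (intro e(2)) simp
        then show ?case
          unfolding nn_F by (intro ennreal_leI power_mono) auto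
      qed
    qed simp
    finally show ?thesis .
  qed
  have X': "\<exists>n0. \<forall>n\<ge>n0. \<forall>m\<ge>n0. dist (X n) (X m) < e" if "0 < e" for e
    using X that by (auto simp: Cauchy_def)
  have f: "square_integrable f"
  proof -
    obtain n0 where "\<forall>n\<ge>n0. \<forall>m\<ge>n0. dist (X n) (X m) < 1"
      using X'[of 1] by auto
    then have "(\<integral>\<^sup>+t. ennreal ((F n0 t - f t)\<^sup>2) \<partial>lborel01) \<le> ennreal (1\<^sup>2)"
      by (intro Fatou[of 1 n0]) auto
    also have "\<dots> < \<infinity>" by simp
    finally have "square_integrable (\<lambda>t. F n0 t - f t)"
      by (intro square_integrableI_nn) auto
    from square_integrable_diff[OF F(1)[of n0] this] show ?thesis by simp
  qed
  have "X \<longlonglongrightarrow> abs_L2 f"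
  proof (rule metric_LIMSEQ_I)
    fix e :: real assume "0 < e"
    then obtain n0 where n0: "\<forall>n\<ge>n0. \<forall>m\<ge>n0. dist (X n) (X m) < e / 2"
      using X'[of "e / 2"] by auto
    have "dist (X n) (abs_L2 f) < e" if "n \<ge> n0" for n
    proof -
      have "ennreal ((dist (X n) (abs_L2 f))\<^sup>2) = (\<integral>\<^sup>+t. ennreal ((F n t - f t)\<^sup>2) \<partial>lborel01)"
        using nn_norm_abs_L2[OF square_integrable_diff[OF F(1) f, of n]]
        by (simp add: abs_L2_diff F f dist_norm)
      also have "\<dots> \<le> ennreal ((e / 2)\<^sup>2)"
        using n0 that \<open>0 < e\<close> by (intro Fatou[of "e / 2" n0]) auto
      finally have "(dist (X n) (abs_L2 f))\<^sup>2 \<le> (e / 2)\<^sup>2"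
        by (simp add: ennreal_le_iff)
      then have "dist (X n) (abs_L2 f) \<le> e / 2"
        by (rule power2_le_imp_le) (use \<open>0 < e\<close> in simp)
      with \<open>0 < e\<close> show ?thesis by simp
    qed
    then show "\<exists>n0. \<forall>n\<ge>n0. dist (X n) (abs_L2 f) < e" by blast
  qed
  then show "convergent X" by (auto simp: convergent_def)
qed

lemma abs_L2_tendsto:
  assumes F: "\<And>n. F n \<in> borel_measurable lborel01"
    and w: "square_integrable w" "\<And>n t. t \<in> {0..1} \<Longrightarrow> \<bar>F n t\<bar> \<le> w t"
    and f: "square_integrable f" "\<And>t. t \<in> {0..1} \<Longrightarrow> (\<lambda>n. F n t) \<longlonglongrightarrow> f t"
  shows "(\<lambda>n. abs_L2 (F n)) \<longlonglongrightarrow> abs_L2 f"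
proof -
  note [measurable] = F
  have [measurable]: "f \<in> borel_measurable lborel01" "w \<in> borel_measurable lborel01"
    using f w by (simp_all add: square_integrable_def)
  have SF: "square_integrable (F n)" for n
    using w(1) F by (rule square_integrable_mono) (use w(2)[of _ n] in force)
  have f_le: "\<bar>f t\<bar> \<le> w t" if "t \<in> {0..1}" for t
    using tendsto_rabs[OF f(2)[OF that]] w(2)[OF that] by (intro LIMSEQ_le_const2) auto
  have "(\<lambda>n. LINT t|lborel01. (F n t - f t)\<^sup>2) \<longlonglongrightarrow> (LINT t|lborel01. 0)"
  proof (rule integral_dominated_convergence[where w = "\<lambda>t. 4 * (w t)\<^sup>2"])
    show "integrable lborel01 (\<lambda>t. 4 * (w t)\<^sup>2)" using w by (simp add: square_integrable_def)
    show "AE t in lborel01. (\<lambda>n. (F n t - f t)\<^sup>2) \<longlonglongrightarrow> 0"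
    proof (rule AE_I2)
      fix t assume "t \<in> space lborel01"
      then have "(\<lambda>n. (F n t - f t)\<^sup>2) \<longlonglongrightarrow> (f t - f t)\<^sup>2"
        by (intro tendsto_intros f(2)) simp
      then show "(\<lambda>n. (F n t - f t)\<^sup>2) \<longlonglongrightarrow> 0" by simp
    qed
    show "AE t in lborel01. norm ((F n t - f t)\<^sup>2) \<le> 4 * (w t)\<^sup>2" for n
    proof (rule AE_I2)
      fix t assume "t \<in> space lborel01"
      then have "\<bar>F n t - f t\<bar> \<le> \<bar>2 * w t\<bar>" using w(2)[of t n] f_le[of t] by simp
      then have "(F n t - f t)\<^sup>2 \<le> (2 * w t)\<^sup>2" by (simp only: abs_le_square_iff)
      then show "norm ((F n t - f t)\<^sup>2) \<le> 4 * (w t)\<^sup>2" by simp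
    qed
  qed measurable
  moreover have "(LINT t|lborel01. (F n t - f t)\<^sup>2) = (norm (abs_L2 (F n) - abs_L2 f))\<^sup>2" for n
    using norm_abs_L2[OF square_integrable_diff[OF SF f(1), of n]] by (simp add: abs_L2_diff SF f)
  ultimately have "(\<lambda>n. (norm (abs_L2 (F n) - abs_L2 f))\<^sup>2) \<longlonglongrightarrow> 0" by simp
  from tendsto_real_sqrt[OF this] have "(\<lambda>n. norm (abs_L2 (F n) - abs_L2 f)) \<longlonglongrightarrow> 0" by simp
  then have "(\<lambda>n. abs_L2 (F n) - abs_L2 f) \<longlonglongrightarrow> 0"
    by (simp only: tendsto_norm_zero_iff)
  then show ?thesis by (simp only: LIM_zero_iff)
qed

lemma square_integrable_indicator:
  "A \<in> sets borel \<Longrightarrow> square_integrable (indicator A)"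
  by (rule square_integrable_bounded[where C = 1]) (auto split: split_indicator)

lemma L2_separable: "\<exists>D :: L2 set. countable D \<and> closure D = UNIV"
proof -
  define u where "u a = abs_L2 (indicator {..a})" for a :: real
  define comb where
    "comb xs = (\<Sum>(c, q)\<leftarrow>xs. of_rat c *\<^sub>R u (of_rat q))" for xs :: "(rat \<times> rat) list"
  define C where "C = closure (range comb)"
  have comb_add: "comb xs + comb ys = comb (xs @ ys)" for xs ys
    by (simp add: comb_def)
  have comb_scale: "of_rat c *\<^sub>R comb xs = comb (map (\<lambda>(d, q). (c * d, q)) xs)" for c xs
    by (induction xs) (auto simp: comb_def of_rat_mult scaleR_add_right)
  have rat_lim: "\<exists>q :: nat \<Rightarrow> rat. (\<forall>n. a < of_rat (q n)) \<and> (\<lambda>n. of_rat (q n) :: real) \<longlonglongrightarrow> a" for a :: real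
  proof -
    have "\<forall>n. \<exists>q. a < of_rat q \<and> of_rat q < a + inverse (real (Suc n))"
      by (intro allI of_rat_dense) simp
    then obtain q where q: "\<And>n. a < of_rat (q n) \<and> of_rat (q n) < a + inverse (real (Suc n))"
      by metis
    have "(\<lambda>n. of_rat (q n) :: real) \<longlonglongrightarrow> a"
    proof (rule tendsto_sandwich[OF _ _ tendsto_const LIMSEQ_inverse_real_of_nat_add])
      show "\<forall>\<^sub>F n in sequentially. a \<le> of_rat (q n)"
        using q by (intro always_eventually allI less_imp_le) blast
      show "\<forall>\<^sub>F n in sequentially. of_rat (q n) \<le> a + inverse (real (Suc n))"
        using q by (intro always_eventually allI less_imp_le) blast
    qed
    with q show ?thesis by blast
  qed
  have C_lim: "x \<in> C" if "\<And>n. X n \<in> C" "X \<longlonglongrightarrow> x" for X x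
    using closed_sequentially[OF closed_closure, of X "range comb" x] that by (auto simp: C_def)
  have C_lim': "x \<in> C" if "\<And>n. X n \<in> range comb" "X \<longlonglongrightarrow> x" for X x
  proof (rule C_lim[of X])
    show "X n \<in> C" for n using that(1)[of n] closure_subset[of "range comb"] by (auto simp: C_def)
  qed (rule that(2))
  have C_add: "x + y \<in> C" if "x \<in> C" "y \<in> C" for x y
  proof -
    have "\<exists>X. (\<forall>n. X n \<in> range comb) \<and> X \<longlonglongrightarrow> x" "\<exists>Y. (\<forall>n. Y n \<in> range comb) \<and> Y \<longlonglongrightarrow> y"
      using that unfolding C_def closure_sequential by blast+
    then obtain X Y where XY: "\<And>n. X n \<in> range comb" "X \<longlonglongrightarrow> x" "\<And>n. Y n \<in> range comb" "Y \<longlonglongrightarrow> y"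
      by blast
    then have "X n + Y n \<in> range comb" for n
      using comb_add by (metis imageE rangeI)
    then show ?thesis
      using tendsto_add[OF XY(2,4)] by (rule C_lim')
  qed
  have C_scale: "a *\<^sub>R x \<in> C" if x: "x \<in> C" for a x
  proof -
    obtain q where q: "(\<lambda>n. of_rat (q n) :: real) \<longlonglongrightarrow> a" using rat_lim by blast
    obtain X where X: "\<And>n. X n \<in> range comb" "X \<longlonglongrightarrow> x"
      using x unfolding C_def closure_sequential by blast
    then have "of_rat (q n) *\<^sub>R X n \<in> range comb" for n
      using comb_scale by (metis imageE rangeI)
    then show ?thesis
      using tendsto_scaleR[OF q X(2)] by (rule C_lim')
  qed
  have C_comb: "comb xs \<in> C" for xs
    using closure_subset[of "range comb"] by (auto simp: C_def)
  have C_zero: "0 \<in> C"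
    using C_comb[of "[]"] by (simp add: comb_def)
  have C_diff: "x - y \<in> C" if "x \<in> C" "y \<in> C" for x y
    using C_add[OF that(1) C_scale[OF that(2), of "-1"]] by simp
  have C_u: "u a \<in> C" for a
  proof -
    obtain q where q: "\<And>n. a < of_rat (q n)" "(\<lambda>n. of_rat (q n) :: real) \<longlonglongrightarrow> a"
      using rat_lim by blast
    have "(\<lambda>n. u (of_rat (q n))) \<longlonglongrightarrow> u a"
      unfolding u_def
    proof (rule abs_L2_tendsto[where w = "\<lambda>_. 1"])
      fix t :: real
      show "(\<lambda>n. indicat_real {..of_rat (q n)} t) \<longlonglongrightarrow> indicator {..a} t"
      proof (cases "t \<le> a")
        case True
        then have "t \<le> of_rat (q n)" for n using q(1)[of n] by linarith
        with True show ?thesis by simp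
      next
        case False
        then have "eventually (\<lambda>n. of_rat (q n) < t) sequentially"
          by (intro order_tendstoD(2)[OF q(2)]) simp
        then have "eventually (\<lambda>n. indicat_real {..of_rat (q n)} t = indicator {..a} t) sequentially"
          by eventually_elim (use False in simp)
        then show ?thesis by (rule tendsto_eventually)
      qed
    qed (auto intro!: square_integrable_indicator square_integrable_bounded[where C = 1] split: split_indicator)
    then show ?thesis
    proof (rule C_lim[rotated])
      show "u (of_rat (q n)) \<in> C" for n
        using C_comb[of "[(1, q n)]"] by (simp add: comb_def)
    qed
  qed
  have C_UNIV: "abs_L2 (indicator UNIV) \<in> C"
  proof -
    have "abs_L2 (indicator UNIV) = u 1"
      unfolding u_def by (intro abs_L2_eq square_integrable_indicator AE_I2) auto
    with C_u show ?thesis by simp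
  qed
  have C_ind: "abs_L2 (indicator A) \<in> C" if "A \<in> sets borel" for A
  proof -
    have "Int_stable (range (\<lambda>a :: real. {..a}))"
      by (auto simp: Int_stable_def)
    moreover have "range (\<lambda>a :: real. {..a}) \<subseteq> Pow UNIV" by simp
    moreover have "A \<in> sigma_sets UNIV (range (\<lambda>a. {..a}))"
      using that by (simp add: borel_eq_atMost)
    ultimately show ?thesis
    proof (induction rule: sigma_sets_induct_disjoint)
      case (basic A)
      then show ?case using C_u by (auto simp: u_def)
    next
      case empty
      have "indicat_real {} = (\<lambda>_. 0)" by (simp add: fun_eq_iff)
      then show ?case using C_zero by (simp add: abs_L2_zero)
    next
      case (compl A)
      then have A: "A \<in> sets borel" by (simp add: borel_eq_atMost)
      have "indicat_real (UNIV - A) = (\<lambda>t. indicator UNIV t - indicator A t)"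
        by (auto simp: fun_eq_iff split: split_indicator)
      then have "abs_L2 (indicator (UNIV - A)) = abs_L2 (indicator UNIV) - abs_L2 (indicator A)"
        using abs_L2_diff[OF square_integrable_indicator square_integrable_indicator[OF A], of UNIV]
        by simp
      with compl C_UNIV show ?case by (simp add: C_diff)
    next
      case (union A)
      then have A: "A i \<in> sets borel" for i by (auto simp: borel_eq_atMost)
      have sum_ind: "abs_L2 (\<lambda>t. \<Sum>i<n. indicator (A i) t) \<in> C
          \<and> square_integrable (\<lambda>t. \<Sum>i<n. indicator (A i) t)" for n
        using A union by (induction n)
          (auto simp: abs_L2_add square_integrable_indicator abs_L2_zero C_zero square_integrable_zero
            intro!: C_add square_integrable_add)
      have le1: "(\<Sum>i<n. indicat_real (A i) t) = indicator (\<Union>i<n. A i) t" for n t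
        using union(1)
        by (intro indicator_UN_disjoint[symmetric]) (auto simp: disjoint_family_on_def)
      have "(\<lambda>n. abs_L2 (\<lambda>t. \<Sum>i<n. indicator (A i) t)) \<longlonglongrightarrow> abs_L2 (indicator (\<Union>i. A i))"
      proof (rule abs_L2_tendsto[where w = "\<lambda>_. 1"])
        show "(\<lambda>n. \<Sum>i<n. indicat_real (A i) t) \<longlonglongrightarrow> indicator (\<Union>i. A i) t" for t
          unfolding le1 by (rule LIMSEQ_indicator_UN)
        show "\<bar>\<Sum>i<n. indicat_real (A i) t\<bar> \<le> 1" for n t
          unfolding le1 by (auto split: split_indicator)
        show "(\<lambda>t. \<Sum>i<n. indicat_real (A i) t) \<in> borel_measurable lborel01" for n
          using sum_ind by (simp add: square_integrable_def)
      qed (use A in \<open>auto intro!: square_integrable_indicator square_integrable_bounded[where C = 1]\<close>)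
      then show ?case by (rule C_lim[rotated]) (use sum_ind in blast)
    qed
  qed
  have C_nonneg: "square_integrable f \<longrightarrow> abs_L2 f \<in> C"
    if "f \<in> borel_measurable lborel01" "\<And>t. 0 \<le> f t" for f
    using that
  proof (induction f rule: borel_measurable_induct_real)
    case (set A)
    then obtain A' where A': "A' \<in> sets borel" "A = {0..1} \<inter> A'"
      by (auto simp: sets_restrict_space)
    show ?case using C_ind[of A] A' by auto
  next
    case (mult f c)
    show ?case
    proof (cases "c = 0")
      case True
      then show ?thesis by (simp add: abs_L2_zero C_zero)
    next
      case False
      show ?thesis
      proof
        assume "square_integrable (\<lambda>t. c * f t)"
        from square_integrable_scale[OF this, of "1 / c"] False have "square_integrable f" by simp
        with mult show "abs_L2 (\<lambda>t. c * f t) \<in> C" by (simp add: abs_L2_scaleR C_scale)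
      qed
    qed
  next
    case (add f g)
    show ?case
    proof
      assume fg: "square_integrable (\<lambda>t. g t + f t)"
      have "square_integrable f" "square_integrable g"
        using add by (auto intro!: square_integrable_mono[OF fg])
      with add show "abs_L2 (\<lambda>t. g t + f t) \<in> C" by (simp add: abs_L2_add C_add)
    qed
  next
    case (seq U)
    show ?case
    proof
      assume f: "square_integrable f"
      have U_le: "U n t \<le> f t" if "t \<in> {0..1}" for n t
        using seq that by (intro incseq_le) (auto simp: incseq_def le_fun_def)
      have U: "square_integrable (U n)" for n
        using f seq(1)[of n] by (rule square_integrable_mono) (use seq(2)[of n] U_le[of _ n] in force)
      have "(\<lambda>n. abs_L2 (U n)) \<longlonglongrightarrow> abs_L2 f"
        using seq U_le f by (intro abs_L2_tendsto[where w = f]) (auto simp: abs_of_nonneg)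
      then show "abs_L2 f \<in> C" by (rule C_lim[rotated]) (use U seq in blast)
    qed
  qed
  have "x \<in> C" for x
  proof -
    obtain f where f: "square_integrable f" "x = abs_L2 f" by (rule L2_cases)
    have [measurable]: "f \<in> borel_measurable lborel01"
      using f(1) by (simp add: square_integrable_def)
    have f': "square_integrable (\<lambda>t. max (f t) 0)" "square_integrable (\<lambda>t. max (- f t) 0)"
      by (auto intro!: square_integrable_mono[OF f(1)])
    have "(\<lambda>t. max (f t) 0 - max (- f t) 0) = f" by (auto simp: fun_eq_iff)
    then have "x = abs_L2 (\<lambda>t. max (f t) 0) - abs_L2 (\<lambda>t. max (- f t) 0)"
      using abs_L2_diff[OF f'] f(2) by simp
    moreover have "abs_L2 (\<lambda>t. max (f t) 0) \<in> C" "abs_L2 (\<lambda>t. max (- f t) 0) \<in> C"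
      using C_nonneg[of "\<lambda>t. max (f t) 0"] C_nonneg[of "\<lambda>t. max (- f t) 0"] f'
      by (auto simp: square_integrable_def)
    ultimately show ?thesis by (simp add: C_diff)
  qed
  then have "closure (range comb) = UNIV" by (auto simp: C_def)
  then show ?thesis by (intro exI[of _ "range comb"]) simp
qed

instance L2 :: second_countable_topology
proof
  obtain D :: "L2 set" where D: "countable D" "closure D = UNIV"
    using L2_separable by blast
  define B where "B = (\<lambda>(x, n). ball x (inverse (real (Suc n)))) ` (D \<times> UNIV)"
  have "topological_basis B"
  proof (rule topological_basisI)
    show "open b" if "b \<in> B" for b using that by (auto simp: B_def)
    fix U :: "L2 set" and x assume U: "open U" "x \<in> U"
    then obtain e where e: "e > 0" "ball x e \<subseteq> U" by (auto simp: open_contains_ball)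
    obtain n where n: "inverse (real (Suc n)) < e / 2"
      using reals_Archimedean[of "e / 2"] e by auto
    have "x \<in> closure D" using D by simp
    then obtain y where y: "y \<in> D" "dist y x < inverse (real (Suc n))"
      unfolding closure_approachable by (metis inverse_positive_iff_positive of_nat_0_less_iff zero_less_Suc)
    have "ball y (inverse (real (Suc n))) \<subseteq> ball x e"
    proof
      fix z assume "z \<in> ball y (inverse (real (Suc n)))"
      then have "dist y z < e / 2" using n by simp
      moreover have "dist x z \<le> dist y x + dist y z"
        by (metis dist_commute dist_triangle)
      ultimately show "z \<in> ball x e" using y n by simp
    qed
    moreover have "ball y (inverse (real (Suc n))) \<in> B" "x \<in> ball y (inverse (real (Suc n)))"
      using y by (auto simp: B_def)
    ultimately show "\<exists>b\<in>B. x \<in> b \<and> b \<subseteq> U" using e(2) by blast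
  qed
  moreover have "countable B" using D by (auto simp: B_def)
  ultimately show "\<exists>B :: L2 set set. countable B \<and> open = generate_topology B"
    using topological_basis_imp_subbasis by blast
qed


subsection \<open>Wasserstein distance, random bit approximation and quantization\<close>

definition weakly_dominated_on :: "'m set \<Rightarrow> ('m \<Rightarrow> ennreal) \<Rightarrow> ('m \<Rightarrow> ennreal) \<Rightarrow> bool" where
  "weakly_dominated_on A f g \<longleftrightarrow> (\<exists>c::real. c > 0 \<and> (\<forall>m\<in>A. f m \<le> ennreal c * g m))"

definition weakly_equiv_on :: "'m set \<Rightarrow> ('m \<Rightarrow> ennreal) \<Rightarrow> ('m \<Rightarrow> ennreal) \<Rightarrow> bool" where
  "weakly_equiv_on A f g \<longleftrightarrow> weakly_dominated_on A f g \<and> weakly_dominated_on A g f"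

definition ennreal_sqrt :: "ennreal \<Rightarrow> ennreal" where
  "ennreal_sqrt x = (if x = \<infinity> then \<infinity> else ennreal (sqrt (enn2real x)))"

definition second_moment_measures :: "'v::{banach, second_countable_topology} measure set" where
  "second_moment_measures = {\<mu>. sets \<mu> = sets borel \<and> prob_space \<mu> \<and>
     (\<integral>\<^sup>+x. ennreal ((norm x)\<^sup>2) \<partial>\<mu>) < \<infinity>}"

text \<open>
  A pair of random elements with prescribed marginals, jointly defined on some probability space,
  enters the Wasserstein distance only through its joint law. Quantifying over joint laws avoids
  quantification over the type of the underlying probability space.
\<close>

definition couplings ::
  "'v::{banach, second_countable_topology} measure \<Rightarrow> 'v measure \<Rightarrow> ('v \<times> 'v) measure set" where
  "couplings \<mu>\<^sub>1 \<mu>\<^sub>2 = {\<pi>. sets \<pi> = sets (borel \<Otimes>\<^sub>M borel) \<and> prob_space \<pi> \<and>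
     distr \<pi> borel fst = \<mu>\<^sub>1 \<and> distr \<pi> borel snd = \<mu>\<^sub>2}"

definition wasserstein2 ::
  "'v::{banach, second_countable_topology} measure \<Rightarrow> 'v measure \<Rightarrow> ennreal" where
  "wasserstein2 \<mu>\<^sub>1 \<mu>\<^sub>2 =
     (INF \<pi>\<in>couplings \<mu>\<^sub>1 \<mu>\<^sub>2. ennreal_sqrt (\<integral>\<^sup>+z. ennreal ((norm (fst z - snd z))\<^sup>2) \<partial>\<pi>))"

definition random_bit_measures ::
  "nat \<Rightarrow> 'v::{banach, second_countable_topology} measure set" where
  "random_bit_measures p =
     range (\<lambda>f. distr (uniform_count_measure {bs :: bool list. length bs = p}) borel f)"

definition measure_support :: "'v::topological_space measure \<Rightarrow> 'v set" where
  "measure_support \<nu> = {x. \<forall>U. open U \<and> x \<in> U \<longrightarrow> emeasure \<nu> U > 0}"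

definition finite_support_measures ::
  "nat \<Rightarrow> 'v::{banach, second_countable_topology} measure set" where
  "finite_support_measures p = {\<nu>\<in>second_moment_measures.
     finite (measure_support \<nu>) \<and> card (measure_support \<nu>) \<le> 2 ^ p}"

definition rbit :: "'v::{banach, second_countable_topology} measure \<Rightarrow> nat \<Rightarrow> ennreal" where
  "rbit \<mu> p = (INF \<nu>\<in>random_bit_measures p. wasserstein2 \<mu> \<nu>)"

definition quant :: "'v::{banach, second_countable_topology} measure \<Rightarrow> nat \<Rightarrow> ennreal" where
  "quant \<mu> p = (INF \<nu>\<in>finite_support_measures p. wasserstein2 \<mu> \<nu>)"

lemma random_bit_measures_subset:
  "random_bit_measures p \<subseteq> (second_moment_measures :: 'v::{banach, second_countable_topology} measure set)"
proof
  fix \<nu> :: "'v measure" assume "\<nu> \<in> random_bit_measures p"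
  then obtain f where \<nu>: "\<nu> = distr (uniform_count_measure {bs :: bool list. length bs = p}) borel f"
    by (auto simp: random_bit_measures_def)
  let ?S = "{bs :: bool list. length bs = p}"
  have S: "finite ?S" "?S \<noteq> {}"
    using finite_lists_length_eq[of "UNIV :: bool set" p] by (auto intro: exI[of _ "replicate p True"])
  interpret U: prob_space "uniform_count_measure ?S"
    using S by (rule prob_space_uniform_count_measure)
  have [measurable]: "f \<in> measurable (uniform_count_measure ?S) borel"
    by (auto simp: measurable_def space_uniform_count_measure sets_uniform_count_measure)
  have "(\<integral>\<^sup>+x. ennreal ((norm x)\<^sup>2) \<partial>\<nu>)
      = (\<integral>\<^sup>+x. ennreal ((norm (f x))\<^sup>2) \<partial>uniform_count_measure ?S)"
    unfolding \<nu> by (intro nn_integral_distr) auto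
  also have "\<dots> \<le> (\<integral>\<^sup>+x. (\<Sum>y\<in>?S. ennreal ((norm (f y))\<^sup>2)) \<partial>uniform_count_measure ?S)"
    using S by (intro nn_integral_mono member_le_sum) (auto simp: space_uniform_count_measure)
  also have "\<dots> < \<infinity>"
    using S by (simp add: U.emeasure_space_1)
  finally show "\<nu> \<in> second_moment_measures"
    unfolding second_moment_measures_def by (auto simp: \<nu> intro: U.prob_space_distr)
qed

subsection \<open>Approximation of standard normal variables\<close>

definition std_normal_cdf :: "real \<Rightarrow> real" where
  "std_normal_cdf = cdf std_normal_distribution"

definition dyadic_midpoint :: "nat \<Rightarrow> real \<Rightarrow> real" where
  "dyadic_midpoint p x = of_int \<lfloor>2 ^ p * x\<rfloor> / 2 ^ p + 1 / 2 ^ (p + 1)"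

text \<open>
  The distribution function is a bijection onto the open unit interval, which contains
  all values of the midpoint map on that interval.
\<close>

definition round_normal :: "nat \<Rightarrow> real \<Rightarrow> real" where
  "round_normal p y = inv std_normal_cdf (dyadic_midpoint p (std_normal_cdf y))"

subsection \<open>Schauder functions and the Brownian bridge\<close>

definition haar :: "nat \<Rightarrow> nat \<Rightarrow> real \<Rightarrow> real" where
  "haar r k t = 2 powr (real r / 2) *
     (indicator {(real k - 1) / 2 ^ r ..< (real k - 1 / 2) / 2 ^ r} t
      - indicator {(real k - 1 / 2) / 2 ^ r ..< real k / 2 ^ r} t)"

definition dyadic_level :: "nat \<Rightarrow> nat" where
  "dyadic_level i = nat \<lfloor>log 2 (real i)\<rfloor>"

definition haar_idx :: "nat \<Rightarrow> real \<Rightarrow> real" where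
  "haar_idx i = haar (dyadic_level i) (i - 2 ^ dyadic_level i + 1)"

lemma dyadic_level_eq:
  assumes "k \<in> {1..2 ^ r}"
  shows "dyadic_level (2 ^ r + k - 1) = r"
proof -
  have "\<lfloor>log 2 (real (2 ^ r + k - 1))\<rfloor> = int r"
  proof -
    have "2 ^ r \<le> 2 ^ r + k - 1" "2 ^ r + k - 1 < 2 ^ (r + 1)"
      using assms by auto
    then show ?thesis
      using floor_log_nat_eq_if[of 2 r "2 ^ r + k - 1"] by simp
  qed
  then show ?thesis by (simp add: dyadic_level_def)
qed

lemma haar_idx_eq:
  assumes "k \<in> {1..2 ^ r}"
  shows "haar_idx (2 ^ r + k - 1) = haar r k"
  using assms by (simp add: haar_idx_def dyadic_level_eq[OF assms, simplified])

definition schauder :: "nat \<Rightarrow> real \<Rightarrow> real" where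
  "schauder i t = (LINT u:{0..t}|lborel. haar_idx i u)"

lemma square_integrable_schauder: "square_integrable (schauder i)"
proof -
  define C :: real where "C = 2 powr (real (dyadic_level i) / 2)"
  have h [measurable]: "haar_idx i \<in> borel_measurable borel"
    unfolding haar_idx_def haar_def by measurable
  have bound: "\<bar>haar_idx i u\<bar> \<le> C" for u
    unfolding haar_idx_def haar_def C_def by (auto simp: abs_mult split: split_indicator)
  show ?thesis
  proof (rule square_integrable_bounded)
    have "(\<lambda>t. LINT u|lborel. (if 0 \<le> u \<and> u \<le> t then haar_idx i u else 0)) \<in> borel_measurable borel"
      by measurable
    moreover have "(\<lambda>t. LINT u|lborel. (if 0 \<le> u \<and> u \<le> t then haar_idx i u else 0)) = schauder i"
      by (auto simp: schauder_def set_lebesgue_integral_def fun_eq_iff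
          intro!: Bochner_Integration.integral_cong split: split_indicator)
    ultimately show "schauder i \<in> borel_measurable lborel01"
      by (simp add: borel_measurable_lborel01I)
    fix t :: real assume t: "t \<in> {0..1}"
    have "\<bar>schauder i t\<bar> \<le> (LINT u|lborel. C * indicator {0..t} u)"
      unfolding schauder_def set_lebesgue_integral_def real_norm_def[symmetric]
    proof (rule Bochner_Integration.integral_norm_bound_integral)
      show *: "integrable lborel (\<lambda>u. C * indicator {0..t} u)"
        by (intro integrable_mult_right) (auto intro!: integrable_real_indicator simp: emeasure_lborel_Icc_eq)
      show "integrable lborel (\<lambda>u. indicat_real {0..t} u *\<^sub>R haar_idx i u)"
        by (rule Bochner_Integration.integrable_bound[OF *])
          (use bound in \<open>auto intro!: AE_I2 order_trans[OF bound abs_ge_self] split: split_indicator\<close>)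
      show "norm (indicat_real {0..t} u *\<^sub>R haar_idx i u) \<le> C * indicator {0..t} u" for u
        using bound by (auto split: split_indicator)
    qed
    also have "\<dots> \<le> C"
      using t by (simp add: C_def mult_left_le)
    finally show "\<bar>schauder i t\<bar> \<le> C" .
  qed
qed

text \<open>The class of a Schauder function, which is square-integrable by the preceding lemma.\<close>

definition schauder_L2 :: "nat \<Rightarrow> L2" where
  "schauder_L2 i = abs_L2 (schauder i)"

text \<open>The case \<open>\<sigma> = 0\<close> (a point mass at zero) is included.\<close>

definition centered_gaussian_element :: "'a measure \<Rightarrow> ('a \<Rightarrow> 'v::real_inner) \<Rightarrow> bool" where
  "centered_gaussian_element M X \<longleftrightarrow> X \<in> borel_measurable M \<and>
     (\<forall>f. \<exists>\<sigma>\<ge>0. distr M borel (\<lambda>\<omega>. inner f (X \<omega>))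
                  = distr std_normal_distribution borel (\<lambda>z. \<sigma> * z))"

definition brownian_bridge :: "'a measure \<Rightarrow> ('a \<Rightarrow> L2) \<Rightarrow> bool" where
  "brownian_bridge M B \<longleftrightarrow> centered_gaussian_element M B \<and>
     (\<forall>f g. (LINT \<omega>|M. inner f (B \<omega>) * inner g (B \<omega>)) =
        (LINT s|lborel01. LINT t|lborel01. (min s t - s * t) * rep_L2 f s * rep_L2 g t))"

text \<open>The sequences start at index 1; the value at index 0 plays no role.\<close>

definition iid_std_normal :: "'a measure \<Rightarrow> (nat \<Rightarrow> 'a \<Rightarrow> real) \<Rightarrow> bool" where
  "iid_std_normal M Y \<longleftrightarrow> prob_space.indep_vars M (\<lambda>_. borel) Y {1..} \<and>
     (\<forall>i\<ge>1. distr M borel (Y i) = std_normal_distribution)"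

definition levy_ciesielski ::
  "'a measure \<Rightarrow> (nat \<Rightarrow> 'a \<Rightarrow> real) \<Rightarrow> ('a \<Rightarrow> L2) \<Rightarrow> bool" where
  "levy_ciesielski M Y B \<longleftrightarrow>
     (\<lambda>n. \<integral>\<^sup>+\<omega>. ennreal ((norm (B \<omega> - (\<Sum>i=1..n. Y i \<omega> *\<^sub>R schauder_L2 i)))\<^sup>2) \<partial>M) \<longlonglongrightarrow> 0"

definition bridge_approx ::
  "(nat \<Rightarrow> 'a \<Rightarrow> real) \<Rightarrow> nat \<Rightarrow> (nat \<Rightarrow> nat) \<Rightarrow> 'a \<Rightarrow> L2" where
  "bridge_approx Y l p \<omega> = (\<Sum>i=1..2 ^ l - 1. round_normal (p i) (Y i \<omega>) *\<^sub>R schauder_L2 i)"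

definition total_bits :: "nat \<Rightarrow> (nat \<Rightarrow> nat) \<Rightarrow> nat" where
  "total_bits l p = (\<Sum>i=1..2 ^ l - 1. p i)"

text \<open>On the relevant indices \<open>1 \<le> i < 2 ^ l\<close> the subtraction does not truncate.\<close>

definition bit_numbers :: "nat \<Rightarrow> nat \<Rightarrow> nat" where
  "bit_numbers l i = 2 * (l - dyadic_level i)"

end

theory Submission
  imports Defs
begin

text \<open>
  With \<open>p\<close> bits available, all errors in the theorem are squeezed between two bounds of order
  \<open>p powr (- 1 / 2)\<close>. Trivially
  \<open>quant \<mu> p \<le> rbit \<mu> p\<close>, because the image of \<open>2 ^ p\<close> bit strings has at most \<open>2 ^ p\<close> points
  (\<open>quant_le_rbit\<close>). It remains to bound \<open>rbit\<close> from above and \<open>quant\<close> from below.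

  Upper bound. The law of the approximation with bit numbers \<open>p\<close>, whose sum is \<open>|p|\<close>, is an image of \<open>|p|\<close>
  uniform bits, since the dyadic cells that contain \<open>\<Phi> (Y i)\<close> are independent and uniform
  (\<open>bridge_approx_in_random_bit_measures\<close>). Coupling it with the bridge through the variables \<open>Y i\<close> bounds
  \<open>rbit\<close> by its mean square error. To estimate this error, group the Schauder functions into levels: level \<open>r\<close>
  consists of \<open>2 ^ r\<close> functions with disjoint supports and squared norm of order \<open>4 ^ (- r)\<close>.
  Rounding a normal variable with \<open>p\<close> bits costs at most a constant times \<open>2 powr (- 3 * p / 4)\<close>
  (\<open>round_normal_error\<close>), since on the lower half line the logarithm of \<open>\<Phi>\<close> expands distances up to a constant
  and \<open>\<Phi> (Y i)\<close> is uniform. The bit numbers \<open>p(l)\<close> assign \<open>2 * (l - r)\<close> bits to level \<open>r < l\<close> and none to the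
  levels \<open>r \<ge> l\<close>, so the mean square error of level \<open>r\<close> is of order \<open>2 ^ (- l) * 2 powr (- |l - r| / 2)\<close>. The
  triangle inequality over the levels yields \<open>2 ^ (- l)\<close> in total (\<open>bridge_approx_error\<close>). As \<open>|p(l)|\<close>
  is of order \<open>2 ^ l\<close> and \<open>rbit\<close> is decreasing in the number of bits, this gives the upper bound for every bit number.

  Lower bound. A ball of radius \<open>\<epsilon>\<close> around any centre has probability at most \<open>2 ^ (- n)\<close> if \<open>n = 2 ^ r\<close> and
  \<open>\<epsilon>\<^sup>2\<close> is a small multiple of \<open>1 / n\<close> (\<open>bridge_small_ball\<close>): project on the \<open>n\<close> orthogonal Schauder
  functions of level \<open>r\<close>, fix all other coefficients, and estimate the Laplace transform of the squared length
  of the projection, a sum of \<open>n\<close> independent squares of shifted normal variables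
  (\<open>gaussian_sum_small_ball\<close>). For \<open>n > p\<close>, balls of radius \<open>\<epsilon>\<close> around \<open>2 ^ p\<close> points cover at most half of
  the mass, so any measure with that many atoms has distance at least \<open>\<epsilon> / 2\<close> (\<open>quant_lower_bound\<close>).

  Finally the error of the approximation with bit numbers \<open>p(l)\<close> lies above \<open>rbit \<mu> |p(l)|\<close> by the coupling
  argument and below a multiple of it by the two bounds.
\<close>

section \<open>The standard normal distribution function\<close>

interpretation std_normal: real_distribution std_normal_distribution
  by (rule real_dist_normal_dist)

text \<open>Near \<open>x\<close> the distribution function is a constant plus the integral of the density from
  \<open>x - 1\<close>, so the fundamental theorem of calculus applies.\<close>

lemma std_normal_cdf_has_derivative:
  "(std_normal_cdf has_real_derivative std_normal_density x) (at x)"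
proof -
  let ?I = "\<lambda>t. integral {x - 1..t} std_normal_density"
  have cont: "continuous_on A std_normal_density" for A
    unfolding normal_density_def by (intro continuous_intros) auto
  have eq: "std_normal_cdf t = std_normal_cdf (x - 1) + ?I t" if "t \<in> {x - 1<..<x + 1}" for t
  proof -
    have "std_normal_cdf t - std_normal_cdf (x - 1) = measure std_normal_distribution {x - 1<..t}"
      unfolding std_normal_cdf_def using that by (intro std_normal.cdf_diff_eq) auto
    also have "\<dots> = (LINT u|std_normal_distribution. indicator {x - 1<..t} u)"
      by simp
    also have "\<dots> = (LINT u|lborel. std_normal_density u *\<^sub>R indicator {x - 1<..t} u)"
      by (intro integral_density) auto
    also have "\<dots> = (LINT u|lborel. indicator {x - 1..t} u *\<^sub>R std_normal_density u)"
    proof (rule integral_cong_AE)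
      show "AE u in lborel. std_normal_density u *\<^sub>R indicator {x - 1<..t} u
          = indicator {x - 1..t} u *\<^sub>R std_normal_density u"
        using AE_lborel_singleton[of "x - 1"] by eventually_elim (auto split: split_indicator)
    qed auto
    also have "\<dots> = ?I t"
      unfolding set_lebesgue_integral_def[symmetric]
      by (intro set_borel_integral_eq_integral(2) borel_integrable_atLeastAtMost')
        (use cont in auto)
    finally show ?thesis by simp
  qed
  have "(?I has_real_derivative std_normal_density x) (at x within {x - 1..x + 1})"
    by (rule integral_has_real_derivative) (use cont in auto)
  then have "(?I has_real_derivative std_normal_density x) (at x)"
    by (subst (asm) at_within_interior) (auto simp: interior_atLeastAtMost_real)
  then have "((\<lambda>t. std_normal_cdf (x - 1) + ?I t) has_real_derivative std_normal_density x) (at x)"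
    by (auto intro!: derivative_eq_intros)
  then show ?thesis
    by (rule has_field_derivative_transform_within_open[where S = "{x - 1<..<x + 1}"])
      (use eq in auto)
qed

lemma std_normal_cdf_strict_mono: "strict_mono std_normal_cdf"
  by (rule strict_monoI, rule DERIV_pos_imp_increasing)
    (use std_normal_cdf_has_derivative normal_density_pos[of 1 0] in \<open>auto intro!: exI\<close>)

lemma std_normal_cdf_less_iff [simp]: "std_normal_cdf x < std_normal_cdf y \<longleftrightarrow> x < y"
  and std_normal_cdf_le_iff [simp]: "std_normal_cdf x \<le> std_normal_cdf y \<longleftrightarrow> x \<le> y"
  using std_normal_cdf_strict_mono by (auto simp: strict_mono_less strict_mono_less_eq)

lemma std_normal_cdf_gt_0: "0 < std_normal_cdf x"
proof -
  have "0 \<le> std_normal_cdf (x - 1)"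
    unfolding std_normal_cdf_def by (rule std_normal.cdf_nonneg)
  also have "\<dots> < std_normal_cdf x" by simp
  finally show ?thesis .
qed

lemma std_normal_cdf_less_1: "std_normal_cdf x < 1"
proof -
  have "std_normal_cdf x < std_normal_cdf (x + 1)" by simp
  also have "\<dots> \<le> 1"
    unfolding std_normal_cdf_def by (rule std_normal.cdf_bounded_prob)
  finally show ?thesis .
qed

lemma continuous_on_std_normal_cdf: "continuous_on A std_normal_cdf"
  by (intro continuous_at_imp_continuous_on ballI DERIV_isCont[OF std_normal_cdf_has_derivative])

lemma borel_measurable_std_normal_cdf [measurable]: "std_normal_cdf \<in> borel_measurable borel"
  by (intro borel_measurable_continuous_onI continuous_on_std_normal_cdf)

lemma std_normal_cdf_surj:
  assumes "0 < u" "u < 1"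
  obtains y where "std_normal_cdf y = u"
proof -
  have "\<forall>\<^sub>F y in at_bot. std_normal_cdf y < u"
    using order_tendstoD(2)[OF std_normal.cdf_lim_at_bot assms(1)]
    by (simp add: std_normal_cdf_def)
  then obtain a where a: "std_normal_cdf a < u"
    using eventually_happens'[OF trivial_limit_at_bot_linorder] by blast
  have "\<forall>\<^sub>F y in at_top. u < std_normal_cdf y"
    using order_tendstoD(1)[OF std_normal.cdf_lim_at_top_prob assms(2)]
    by (simp add: std_normal_cdf_def)
  then obtain b where b: "u < std_normal_cdf b"
    using eventually_happens'[OF trivial_limit_at_top_linorder] by blast
  have "a \<le> b" using a b std_normal_cdf_le_iff[of a b] by linarith
  then obtain y where "std_normal_cdf y = u"
    using IVT'[of std_normal_cdf a u b] a b continuous_on_std_normal_cdf by force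
  then show ?thesis by (rule that)
qed

lemma std_normal_cdf_inv:
  assumes "0 < u" "u < 1"
  shows "std_normal_cdf (inv std_normal_cdf u) = u"
  using std_normal_cdf_surj[OF assms] by (metis f_inv_into_f rangeI)

text \<open>Since the density is even, \<open>\<Phi> y + \<Phi> (- y)\<close> has derivative zero; its constant value is read off
  in the limit \<open>y \<rightarrow> \<infinity>\<close>.\<close>

lemma std_normal_cdf_minus: "std_normal_cdf (- y) = 1 - std_normal_cdf y"
proof -
  have "((\<lambda>y. std_normal_cdf y + std_normal_cdf (- y)) has_real_derivative 0) (at y)" for y
  proof -
    have "((\<lambda>y. std_normal_cdf (- y)) has_real_derivative std_normal_density (- y) * (- 1)) (at y)"
      by (rule DERIV_chain2[OF std_normal_cdf_has_derivative]) (auto intro!: derivative_eq_intros)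
    from DERIV_add[OF std_normal_cdf_has_derivative this] show ?thesis
      by (simp add: normal_density_def)
  qed
  then have const: "std_normal_cdf y + std_normal_cdf (- y) = std_normal_cdf z + std_normal_cdf (- z)" for y z
    using DERIV_isconst_all by blast
  have "((\<lambda>y. std_normal_cdf y + std_normal_cdf (- y)) \<longlongrightarrow> 1 + 0) at_top"
    unfolding std_normal_cdf_def
    by (intro tendsto_add std_normal.cdf_lim_at_top_prob
        filterlim_compose[OF std_normal.cdf_lim_at_bot filterlim_uminus_at_bot_at_top])
  moreover have "(\<lambda>z. std_normal_cdf z + std_normal_cdf (- z)) = (\<lambda>_. std_normal_cdf y + std_normal_cdf (- y))"
    using const by blast
  ultimately have "std_normal_cdf y + std_normal_cdf (- y) = 1"
    by (simp add: tendsto_const_iff)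
  then show ?thesis by simp
qed

lemma std_normal_cdf_0: "std_normal_cdf 0 = 1 / 2"
  using std_normal_cdf_minus[of 0] by simp

text \<open>
  The tail below \<open>y\<close> is the tail below \<open>0\<close> of the density translated by \<open>y\<close>, and for nonpositive
  \<open>x\<close> and \<open>y\<close> the mixed term in the exponent of the density at \<open>y + x\<close> only helps, so that this density is
  at most \<open>sqrt (2 * pi)\<close> times the product of the densities at \<open>y\<close> and at \<open>x\<close>.
\<close>

lemma std_normal_cdf_le_density:
  assumes "y \<le> 0"
  shows "std_normal_cdf y \<le> sqrt (2 * pi) * std_normal_density y"
proof -
  let ?d = std_normal_density
  have "ennreal (std_normal_cdf y) = emeasure std_normal_distribution {..y}"
    by (simp add: std_normal_cdf_def cdf_def std_normal.emeasure_eq_measure)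
  also have "\<dots> = (\<integral>\<^sup>+x. ennreal (?d x) * indicator {..y} x \<partial>lborel)"
    by (intro emeasure_density) auto
  also have "\<dots> = (\<integral>\<^sup>+x. ennreal (?d (y + 1 * x)) * indicator {..y} (y + 1 * x) \<partial>lborel)"
    by (subst nn_integral_real_affine[where c = 1 and t = y]) auto
  also have "\<dots> \<le> (\<integral>\<^sup>+x. ennreal (sqrt (2 * pi) * ?d y) * ennreal (?d x) \<partial>lborel)"
  proof (intro nn_integral_mono)
    fix x :: real
    show "ennreal (?d (y + 1 * x)) * indicator {..y} (y + 1 * x)
      \<le> ennreal (sqrt (2 * pi) * ?d y) * ennreal (?d x)"
    proof (cases "x \<le> 0")
      case True
      have "?d (y + x) = sqrt (2 * pi) * ?d y * ?d x * exp (- (y * x))"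
        by (simp add: normal_density_def field_simps exp_add[symmetric] power2_sum)
      also have "\<dots> \<le> sqrt (2 * pi) * ?d y * ?d x * 1"
        using assms True by (intro mult_left_mono) (auto simp: zero_le_mult_iff)
      finally show ?thesis using True
        by (auto simp: ennreal_mult[symmetric] split: split_indicator)
    qed simp
  qed
  also have "\<dots> = ennreal (sqrt (2 * pi) * ?d y) * (\<integral>\<^sup>+x. ennreal (?d x) \<partial>lborel)"
    by (intro nn_integral_cmult) auto
  also have "\<dots> = ennreal (sqrt (2 * pi) * ?d y)"
    by (subst nn_integral_eq_integral) auto
  finally show ?thesis by (simp add: ennreal_le_iff)
qed

text \<open>
  By the previous bound the logarithm of the distribution function has derivative at least
  \<open>1 / sqrt (2 * pi)\<close> on the lower half line. Distances between normal quantiles are thereby reduced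
  to ratios of probabilities.
\<close>

lemma dist_le_ln_std_normal_cdf:
  assumes "y \<le> 0" "z \<le> 0"
  shows "\<bar>y - z\<bar> \<le> sqrt (2 * pi) * \<bar>ln (std_normal_cdf y) - ln (std_normal_cdf z)\<bar>"
  using assms
proof (induction y z rule: linorder_wlog)
  case (le y z)
  let ?C = "sqrt (2 * pi)"
  have "?C * ln (std_normal_cdf y) - y \<le> ?C * ln (std_normal_cdf z) - z"
  proof (rule DERIV_nonneg_imp_nondecreasing[OF le(1)])
    fix x assume x: "y \<le> x" "x \<le> z"
    let ?D = "?C * (std_normal_density x / std_normal_cdf x) - 1"
    have "((\<lambda>x. ?C * ln (std_normal_cdf x) - x) has_real_derivative ?D) (at x)"
      using std_normal_cdf_gt_0[of x]
      by (auto intro!: derivative_eq_intros std_normal_cdf_has_derivative)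
    moreover have "0 \<le> ?D"
      using std_normal_cdf_le_density[of x] std_normal_cdf_gt_0[of x] x le by (simp add: field_simps)
    ultimately show "\<exists>D. ((\<lambda>x. ?C * ln (std_normal_cdf x) - x) has_real_derivative D) (at x) \<and> 0 \<le> D"
      by blast
  qed
  moreover have "ln (std_normal_cdf y) \<le> ln (std_normal_cdf z)"
    using le std_normal_cdf_gt_0 by simp
  ultimately show ?case using le by (simp add: abs_of_nonpos algebra_simps)
next
  case (sym y z)
  then show ?case by (simp add: abs_minus_commute)
qed

lemma std_normal_cdf_uniform:
  "distr std_normal_distribution borel std_normal_cdf = uniform_measure lborel {0..1}"
proof (rule cdf_unique)
  show "real_distribution (distr std_normal_distribution borel std_normal_cdf)"
    by (rule std_normal.real_distribution_distr) auto
  interpret U: prob_space "uniform_measure lborel {0..1::real}"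
    by (rule prob_space_uniform_measure) auto
  show "real_distribution (uniform_measure lborel {0..1})"
    by unfold_locales auto
  show "cdf (distr std_normal_distribution borel std_normal_cdf) = cdf (uniform_measure lborel {0..1})"
  proof
    fix u :: real
    have "cdf (distr std_normal_distribution borel std_normal_cdf) u
        = measure std_normal_distribution {y. std_normal_cdf y \<le> u}"
      unfolding cdf_def by (subst measure_distr) (auto simp: vimage_def)
    also have "\<dots> = max 0 (min u 1)"
    proof -
      consider "u \<le> 0" | "0 < u" "u < 1" | "1 \<le> u" by linarith
      then show ?thesis
      proof cases
        case 1
        then have "\<not> std_normal_cdf y \<le> u" for y using std_normal_cdf_gt_0[of y] by linarith
        then have "{y. std_normal_cdf y \<le> u} = {}" by blast
        with 1 show ?thesis by simp
      next
        case 2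
        then obtain z where z: "std_normal_cdf z = u" by (rule std_normal_cdf_surj)
        then have "{y. std_normal_cdf y \<le> u} = {..z}" by auto
        with 2 z show ?thesis by (simp add: std_normal_cdf_def cdf_def)
      next
        case 3
        then have "std_normal_cdf y \<le> u" for y using std_normal_cdf_less_1[of y] by linarith
        then have "{y. std_normal_cdf y \<le> u} = space std_normal_distribution" by auto
        with 3 std_normal.prob_space show ?thesis by simp
      qed
    qed
    also have "\<dots> = measure lborel ({0..1} \<inter> {..u})"
    proof -
      have "{0..1} \<inter> {..u} = {0..min u 1}" by auto
      then show ?thesis by (cases "0 \<le> u") (auto simp: measure_def min.commute)
    qed
    also have "\<dots> = cdf (uniform_measure lborel {0..1}) u"
      unfolding cdf_def by (subst measure_uniform_measure) auto
    finally show "cdf (distr std_normal_distribution borel std_normal_cdf) u = cdf (uniform_measure lborel {0..1}) u" .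
  qed
qed

lemma nn_integral_std_normal_cdf:
  assumes [measurable]: "g \<in> borel_measurable borel"
  shows "(\<integral>\<^sup>+y. g (std_normal_cdf y) \<partial>std_normal_distribution) = (\<integral>\<^sup>+u. g u * indicator {0..1} u \<partial>lborel)"
proof -
  have "(\<integral>\<^sup>+y. g (std_normal_cdf y) \<partial>std_normal_distribution)
      = (\<integral>\<^sup>+u. g u \<partial>distr std_normal_distribution borel std_normal_cdf)"
    by (subst nn_integral_distr) auto
  also have "\<dots> = (\<integral>\<^sup>+u. g u * indicator {0..1} u \<partial>lborel)"
    unfolding std_normal_cdf_uniform by (subst nn_integral_uniform_measure) (auto simp: divide_ennreal_def)
  finally show ?thesis .
qed

section \<open>The error of rounding a normal variable\<close>

text \<open>The exponent is a compromise. After squaring it becomes \<open>3 / 4\<close>: this has to be below \<open>1\<close>, for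
  the resulting power of the uniform variable to be integrable, and above \<open>1 / 2\<close>, for the rounding
  errors to be summable over the dyadic levels.\<close>

lemma ln_one_plus_le_powr:
  fixes x :: real
  assumes "0 \<le> x"
  shows "ln (1 + x) \<le> 6 * x powr (3 / 8)"
proof (cases "x \<le> 1")
  case True
  have "ln (1 + x) \<le> x" using assms by (rule ln_add_one_self_le_self)
  also have "x \<le> x powr (3 / 8)"
  proof (cases "x = 0")
    case False
    then show ?thesis using powr_mono'[of "3 / 8" 1 x] assms True by simp
  qed simp
  also have "\<dots> \<le> 6 * x powr (3 / 8)" by simp
  finally show ?thesis .
next
  case False
  have "ln (1 + x) \<le> (1 + x) powr (3 / 8) / (3 / 8)"
    using assms by (intro ln_powr_bound) auto
  also have "\<dots> \<le> (2 * x) powr (3 / 8) / (3 / 8)"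
    using False by (intro divide_right_mono powr_mono2) auto
  also have "\<dots> = 2 powr (3 / 8) * x powr (3 / 8) / (3 / 8)"
    using False by (simp add: powr_mult)
  also have "\<dots> \<le> 2 powr 1 * x powr (3 / 8) / (3 / 8)"
    by (intro divide_right_mono mult_right_mono powr_mono) auto
  also have "\<dots> \<le> 6 * x powr (3 / 8)" by simp
  finally show ?thesis .
qed

text \<open>This covers all dyadic cells at once: in the cells away from zero the relative error of the
  midpoint is of order \<open>h / u\<close>, and in the cell at zero \<open>h / u\<close> is large and the logarithm grows more
  slowly than any power. In both cases the logarithmic distance is at most \<open>ln (1 + 2 * h / u)\<close>.\<close>

lemma ln_diff_squared_le_powr:
  fixes u m h :: real
  assumes "0 < u" "\<bar>u - m\<bar> \<le> h" "h \<le> m" "0 < h"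
  shows "(ln u - ln m)\<^sup>2 \<le> 72 * (h / u) powr (3 / 4)"
proof -
  have "\<bar>ln u - ln m\<bar> \<le> ln (1 + 2 * h / u)"
  proof (cases "u \<le> m")
    case True
    have "ln m - ln u = ln (m / u)" using assms by (simp add: ln_div)
    also have "\<dots> \<le> ln (1 + 2 * h / u)"
      using assms by (subst ln_le_cancel_iff) (auto simp: field_simps add_pos_pos)
    finally show ?thesis using assms True by simp
  next
    case False
    have "u\<^sup>2 \<le> u * m + h * m + h * m"
    proof -
      have "u * u \<le> u * (m + h)" using assms by (intro mult_left_mono) auto
      moreover have "h * u \<le> h * (m + m)" using assms by (intro mult_left_mono) auto
      ultimately show ?thesis by (simp add: power2_eq_square algebra_simps)
    qed
    then have "u / m \<le> 1 + 2 * h / u"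
      using assms by (simp add: field_simps power2_eq_square)
    moreover have "ln u - ln m = ln (u / m)" using assms by (simp add: ln_div)
    ultimately have "ln u - ln m \<le> ln (1 + 2 * h / u)"
      using assms by (simp add: add_pos_pos)
    moreover have "ln m \<le> ln u" using False assms by simp
    ultimately show ?thesis by simp
  qed
  also have "\<dots> \<le> 6 * (2 * h / u) powr (3 / 8)"
    using assms by (intro ln_one_plus_le_powr) auto
  finally have "(ln u - ln m)\<^sup>2 \<le> (6 * (2 * h / u) powr (3 / 8))\<^sup>2"
    by (subst abs_le_square_iff[symmetric]) simp
  also have "\<dots> = 36 * (2 powr (3 / 4) * (h / u) powr (3 / 4))"
  proof -
    have "((2 * h / u) powr (3 / 8))\<^sup>2 = (2 * (h / u)) powr (3 / 4)"
      by (simp add: power2_eq_square powr_add[symmetric])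
    also have "\<dots> = 2 powr (3 / 4) * (h / u) powr (3 / 4)"
      using assms by (subst powr_mult) auto
    finally show ?thesis by (simp add: power_mult_distrib)
  qed
  also have "\<dots> \<le> 36 * (2 powr 1 * (h / u) powr (3 / 4))"
    by (intro mult_left_mono mult_right_mono powr_mono) auto
  finally show ?thesis by simp
qed

lemma dyadic_midpoint_bounds:
  assumes "0 < u" "u < 1"
  shows "\<bar>u - dyadic_midpoint p u\<bar> \<le> 1 / 2 ^ (p + 1)"
    and "1 / 2 ^ (p + 1) \<le> dyadic_midpoint p u"
    and "dyadic_midpoint p u \<le> 1 - 1 / 2 ^ (p + 1)"
proof -
  define k where "k = \<lfloor>2 ^ p * u\<rfloor>"
  have k: "of_int k \<le> 2 ^ p * u" "2 ^ p * u < of_int k + 1"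
    unfolding k_def by linarith+
  have m: "dyadic_midpoint p u = (2 * of_int k + 1) / 2 ^ (p + 1)"
    by (simp add: dyadic_midpoint_def k_def field_simps)
  show "\<bar>u - dyadic_midpoint p u\<bar> \<le> 1 / 2 ^ (p + 1)"
    using k by (simp add: m abs_le_iff field_simps)
  have "0 \<le> k" using assms by (simp add: k_def)
  then show "1 / 2 ^ (p + 1) \<le> dyadic_midpoint p u"
    by (simp add: m divide_right_mono)
  have "of_int k < (2 ^ p :: real)"
    using k(1) assms by (smt (verit) mult_less_cancel_left2 zero_less_power)
  then have "k < 2 ^ p" by (metis of_int_less_numeral_power_cancel_iff)
  then have "k + 1 \<le> 2 ^ p" by simp
  then have "of_int (k + 1) \<le> (of_int (2 ^ p) :: real)" by (simp only: of_int_le_iff)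
  then have "(2 * of_int k + 1) / 2 ^ (p + 1) \<le> (2 * 2 ^ p - 1 :: real) / 2 ^ (p + 1)"
    by (intro divide_right_mono) auto
  also have "\<dots> = 1 - 1 / 2 ^ (p + 1)" by (simp add: diff_divide_distrib)
  finally show "dyadic_midpoint p u \<le> 1 - 1 / 2 ^ (p + 1)" by (simp only: m)
qed

text \<open>With at least one bit no dyadic cell straddles \<open>1 / 2\<close>, so rounding does not move a normal variable
  across zero.\<close>

lemma dyadic_midpoint_half_iff:
  assumes "1 \<le> p" 
  shows "dyadic_midpoint p u < 1 / 2 \<longleftrightarrow> u < 1 / 2"
proof -
  obtain q where p: "p = Suc q" using assms by (cases p) auto
  define k where "k = \<lfloor>2 ^ p * u\<rfloor>"
  have k: "of_int k \<le> 2 ^ p * u" "2 ^ p * u < of_int k + 1"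
    unfolding k_def by linarith+
  have m: "dyadic_midpoint p u = (2 * of_int k + 1) / 2 ^ p / 2"
    by (simp add: dyadic_midpoint_def k_def field_simps)
  have "dyadic_midpoint p u < 1 / 2 \<longleftrightarrow> 2 * of_int k + 1 < (2 ^ p :: real)"
  proof -
    have "x / 2 < 1 / 2 \<longleftrightarrow> x < 1" for x :: real by auto
    then show ?thesis unfolding m by (simp only: divide_less_eq_1) simp
  qed
  also have "\<dots> \<longleftrightarrow> 2 * k + 1 < 2 ^ p"
    by (metis (mono_tags) of_int_1 of_int_add of_int_less_iff of_int_mult of_int_numeral of_int_power)
  also have "\<dots> \<longleftrightarrow> k < 2 ^ q" by (auto simp: p)
  also have "\<dots> \<longleftrightarrow> 2 ^ p * u < 2 ^ q"
    unfolding k_def by (simp add: floor_less_iff)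
  also have "\<dots> \<longleftrightarrow> u < 1 / 2" by (simp add: p field_simps)
  finally show ?thesis .
qed

lemma std_normal_cdf_round_normal:
  "std_normal_cdf (round_normal p y) = dyadic_midpoint p (std_normal_cdf y)"
proof -
  have "1 / 2 ^ (p + 1) > (0 :: real)" by simp
  with dyadic_midpoint_bounds[of "std_normal_cdf y" p, OF std_normal_cdf_gt_0 std_normal_cdf_less_1]
  show ?thesis
    unfolding round_normal_def by (intro std_normal_cdf_inv) linarith+
qed

lemma borel_measurable_round_normal [measurable]: "round_normal p \<in> borel_measurable borel"
  unfolding round_normal_def dyadic_midpoint_def by measurable

text \<open>For negative \<open>y\<close> the logarithm of the distribution function controls the distance; for
  nonnegative \<open>y\<close> the reflection \<open>y \<mapsto> - y\<close> leads back to that case.\<close>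

lemma round_normal_error_le_powr:
  assumes "1 \<le> p"
  shows "(y - round_normal p y)\<^sup>2 \<le> 432 * pi / 2 powr (3 * real p / 4) *
    (std_normal_cdf y powr (- (3 / 4)) + (1 - std_normal_cdf y) powr (- (3 / 4)))"
proof -
  define h :: real where "h = 1 / 2 ^ (p + 1)"
  let ?F = std_normal_cdf
  let ?z = "round_normal p y"
  have h: "0 < h" by (simp add: h_def)
  have h_powr: "h powr (3 / 4) \<le> 3 / 2 powr (3 * real p / 4)"
  proof -
    have "h powr (3 / 4) \<le> (1 / 2 ^ p) powr (3 / 4)"
      by (intro powr_mono2) (auto simp: h_def field_simps)
    also have "\<dots> = 1 / 2 powr (3 * real p / 4)"
      by (simp add: powr_divide powr_realpow[symmetric] powr_powr mult.commute)
    also have "\<dots> \<le> 3 / 2 powr (3 * real p / 4)" by (intro divide_right_mono) auto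
    finally show ?thesis .
  qed
  have core: "(a - b)\<^sup>2 \<le> 144 * pi * h powr (3 / 4) * ?F a powr (- (3 / 4))"
    if "a \<le> 0" "b \<le> 0" "\<bar>?F a - ?F b\<bar> \<le> h" "h \<le> ?F b" for a b
  proof -
    have "(a - b)\<^sup>2 \<le> (sqrt (2 * pi) * \<bar>ln (?F a) - ln (?F b)\<bar>)\<^sup>2"
      using dist_le_ln_std_normal_cdf[OF that(1,2)]
      by (subst abs_le_square_iff[symmetric]) (simp add: abs_mult)
    also have "\<dots> = 2 * pi * (ln (?F a) - ln (?F b))\<^sup>2"
      by (simp add: power_mult_distrib)
    also have "\<dots> \<le> 2 * pi * (72 * (h / ?F a) powr (3 / 4))"
      using ln_diff_squared_le_powr[of "?F a" "?F b" h] that h std_normal_cdf_gt_0[of a]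
      by (intro mult_left_mono) auto
    also have "\<dots> = 144 * pi * h powr (3 / 4) * ?F a powr (- (3 / 4))"
      using h std_normal_cdf_gt_0[of a] by (simp add: powr_divide powr_minus field_simps)
    finally show ?thesis .
  qed
  note bounds = dyadic_midpoint_bounds[of "std_normal_cdf y" p, OF std_normal_cdf_gt_0 std_normal_cdf_less_1,
      folded std_normal_cdf_round_normal h_def]
  have "(y - ?z)\<^sup>2 \<le> 144 * pi * h powr (3 / 4) * (?F y powr (- (3 / 4)) + (1 - ?F y) powr (- (3 / 4)))"
  proof (cases "y < 0")
    case True
    then have "?F y < 1 / 2" using std_normal_cdf_less_iff[of y 0] by (simp add: std_normal_cdf_0)
    then have "?F ?z < ?F 0"
      unfolding std_normal_cdf_round_normal std_normal_cdf_0 dyadic_midpoint_half_iff[OF assms] .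
    then have "(y - ?z)\<^sup>2 \<le> 144 * pi * h powr (3 / 4) * ?F y powr (- (3 / 4))"
      using True bounds by (intro core) auto
    also have "\<dots> \<le> 144 * pi * h powr (3 / 4) * (?F y powr (- (3 / 4)) + (1 - ?F y) powr (- (3 / 4)))"
      by (intro mult_left_mono) auto
    finally show ?thesis .
  next
    case False
    then have "1 / 2 \<le> ?F y" using std_normal_cdf_le_iff[of 0 y] by (simp add: std_normal_cdf_0)
    then have "?F 0 \<le> ?F ?z"
      unfolding std_normal_cdf_round_normal std_normal_cdf_0
      using dyadic_midpoint_half_iff[OF assms, of "?F y"] by linarith
    then have "(- y - (- ?z))\<^sup>2 \<le> 144 * pi * h powr (3 / 4) * ?F (- y) powr (- (3 / 4))"
      using False bounds by (intro core) (auto simp: std_normal_cdf_minus)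
    then have "(y - ?z)\<^sup>2 \<le> 144 * pi * h powr (3 / 4) * (1 - ?F y) powr (- (3 / 4))"
      by (simp add: std_normal_cdf_minus power2_commute)
    also have "\<dots> \<le> 144 * pi * h powr (3 / 4) * (?F y powr (- (3 / 4)) + (1 - ?F y) powr (- (3 / 4)))"
      by (intro mult_left_mono) auto
    finally show ?thesis .
  qed
  also have "\<dots> \<le> 144 * pi * (3 / 2 powr (3 * real p / 4)) * (?F y powr (- (3 / 4)) + (1 - ?F y) powr (- (3 / 4)))"
    using h_powr by (intro mult_right_mono mult_left_mono) auto
  finally show ?thesis by simp
qed

text \<open>The distribution function maps the normal law to the uniform law, so the pointwise bound
  integrates to twice the integral of \<open>u powr (- 3 / 4)\<close> over the unit interval. The true order is
  \<open>1 / (p * 2 ^ p)\<close>; any exponential rate faster than \<open>2 powr (- p / 2)\<close> suffices below, because level \<open>r\<close>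
  of the expansion receives \<open>2 * (l - r)\<close> bits.\<close>

lemma round_normal_error:
  assumes "1 \<le> p"
  shows "(\<integral>\<^sup>+y. ennreal ((y - round_normal p y)\<^sup>2) \<partial>std_normal_distribution)
    \<le> ennreal (3456 * pi / 2 powr (3 * real p / 4))"
proof -
  define c where "c = 432 * pi / 2 powr (3 * real p / 4)"
  have c: "0 \<le> c" by (simp add: c_def)
  have I0: "(\<integral>\<^sup>+u. ennreal (u powr (- (3 / 4))) * indicator {0..1} u \<partial>lborel) = ennreal 4"
  proof -
    have "((\<lambda>u. u powr (- (3 / 4))) has_integral 4) {0..1::real}"
      using has_integral_powr_from_0[of "- (3 / 4)" 1] by simp
    from nn_integral_has_integral_lebesgue[OF _ this]
    have "(\<integral>\<^sup>+u. ennreal (indicator {0..1} u * u powr (- (3 / 4))) \<partial>lborel) = ennreal 4" by simp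
    then show ?thesis
      by (subst (asm) nn_integral_cong[where v = "\<lambda>u. ennreal (u powr (- (3 / 4))) * indicator {0..1} u"])
        (auto split: split_indicator)
  qed
  have I1: "(\<integral>\<^sup>+u. ennreal ((1 - u) powr (- (3 / 4))) * indicator {0..1} u \<partial>lborel) = ennreal 4"
    by (subst nn_integral_real_affine[where c = "- 1" and t = 1])
      (auto simp: I0[symmetric] simp del: ennreal_numeral intro!: nn_integral_cong split: split_indicator)
  have "(\<integral>\<^sup>+y. ennreal ((y - round_normal p y)\<^sup>2) \<partial>std_normal_distribution)
      \<le> (\<integral>\<^sup>+y. ennreal (c * (std_normal_cdf y powr (- (3 / 4)) + (1 - std_normal_cdf y) powr (- (3 / 4))))
          \<partial>std_normal_distribution)"
    unfolding c_def by (intro nn_integral_mono ennreal_leI round_normal_error_le_powr assms)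
  also have "\<dots> = (\<integral>\<^sup>+u. ennreal (c * (u powr (- (3 / 4)) + (1 - u) powr (- (3 / 4)))) * indicator {0..1} u \<partial>lborel)"
    by (rule nn_integral_std_normal_cdf) simp
  also have "\<dots> = (\<integral>\<^sup>+u. ennreal c * (ennreal (u powr (- (3 / 4))) * indicator {0..1} u
      + ennreal ((1 - u) powr (- (3 / 4))) * indicator {0..1} u) \<partial>lborel)"
    by (intro nn_integral_cong) (auto simp: ennreal_mult' c split: split_indicator)
  also have "\<dots> = ennreal c * (ennreal 4 + ennreal 4)"
    by (simp add: nn_integral_cmult nn_integral_add I0 I1 del: ennreal_numeral)
  also have "\<dots> = ennreal (c * 8)"
    by (subst ennreal_plus[symmetric]) (auto simp: ennreal_mult'' c simp del: ennreal_plus)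
  finally show ?thesis by (simp add: c_def)
qed

section \<open>Schauder functions\<close>

lemma dyadic_level_block:
  assumes "i \<in> {2 ^ r..<2 ^ (r + 1)}"
  shows "dyadic_level i = r"
proof -
  have "i - 2 ^ r + 1 \<in> {1..2 ^ r}" using assms by auto
  from dyadic_level_eq[OF this] assms show ?thesis by simp
qed

text \<open>The Schauder function is the integral of a positive step of width \<open>w\<close> starting at \<open>a\<close>, followed
  by a negative one, hence a difference of two ramps.\<close>

lemma schauder_explicit:
  fixes i r :: nat and t :: real
  assumes i: "i \<in> {2 ^ r..<2 ^ (r + 1)}" and t: "0 \<le> t"
  defines "a \<equiv> real (i - 2 ^ r) / 2 ^ r" and "w \<equiv> 1 / 2 ^ (r + 1)"
  shows "schauder i t = 2 powr (real r / 2) *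
    (max 0 (min w (t - a)) - max 0 (min w (t - a - w)))"
proof -
  have r: "dyadic_level i = r" using i by (rule dyadic_level_block)
  have w: "0 \<le> w" "0 \<le> a" by (simp_all add: w_def a_def)
  have haar: "haar_idx i u = 2 powr (real r / 2) * (indicator {a..<a + w} u - indicator {a + w..<a + w + w} u)" for u
  proof -
    have "(real (i - 2 ^ r + 1) - 1) / 2 ^ r = a" "(real (i - 2 ^ r + 1) - 1 / 2) / 2 ^ r = a + w"
      "real (i - 2 ^ r + 1) / 2 ^ r = a + w + w"
      by (simp_all add: a_def w_def field_simps)
    then show ?thesis unfolding haar_idx_def haar_def r by (simp only:)
  qed
  have cap: "(\<lambda>u. indicat_real {0..t} u * indicat_real {b..<b + w} u) = 
    (\<lambda>u. indicat_real ({0..t} \<inter> {b..<b+w}) u)" for b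
    by (auto simp: fun_eq_iff split: split_indicator)
  have int: "integrable lborel (\<lambda>u. indicat_real {0..t} u * indicat_real {b..<b + w} u)"
    "(LINT u|lborel. indicat_real {0..t} u * indicat_real {b..<b + w} u) = max 0 (min w (t - b))" if b: "0 \<le> b" for b
  proof -
    have *: "{b..<min (b + w) t} \<subseteq> {0..t} \<inter> {b..<b+w}" "{0..t} \<inter> {b..<b+w} \<subseteq> {b..min (b + w) t}"
      using b t w by auto
    have "emeasure lborel {b..<min (b + w) t} \<le> emeasure lborel ({0..t} \<inter> {b..<b+w})"
      "emeasure lborel ({0..t} \<inter> {b..<b+w}) \<le> emeasure lborel {b..min (b + w) t}"
      using * by (auto intro!: emeasure_mono)
    moreover have "max 0 (min w (t - b)) = (if b \<le> min (b + w) t then min (b + w) t - b else 0)" 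
      using w by auto
    ultimately have "emeasure lborel ({0..t} \<inter> {b..<b+w}) = ennreal (max 0 (min w (t - b)))"
      using w by (cases "b \<le> min (b + w) t") (auto simp: ennreal_neg)
    note E = this
    show "integrable lborel (\<lambda>u. indicat_real {0..t} u * indicat_real {b..<b + w} u)"
      unfolding cap using E by (intro integrable_real_indicator) (auto simp: ennreal_less_top simp del: ennreal_max_0)
    show "(LINT u|lborel. indicat_real {0..t} u * indicat_real {b..<b + w} u) = max 0 (min w (t - b))"
      unfolding cap by (simp add: measure_def E del: ennreal_max_0)
  qed
  have "schauder i t = (LINT u|lborel. 2 powr (real r / 2) *
      (indicat_real {0..t} u * indicat_real {a..<a + w} u
       - indicat_real {0..t} u * indicat_real {a + w..<a + w + w} u))"
    unfolding schauder_def set_lebesgue_integral_def haar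
    by (intro Bochner_Integration.integral_cong) (auto simp: algebra_simps)
  also have "\<dots> = 2 powr (real r / 2) *
    (max 0 (min w (t - a)) - max 0 (min w (t - (a + w))))"
  proof -
    have "0 \<le> a + w" using w by simp
    then show ?thesis
      by (simp only: integral_mult_right_zero Bochner_Integration.integral_diff int w)
  qed
  finally show ?thesis by (simp add: algebra_simps)
qed

lemma schauder_eq_0:
  assumes i: "i \<in> {2 ^ r..<2 ^ (r + 1)}" and t: "0 \<le> t"
    and "t \<notin> {real (i - 2 ^ r) / 2 ^ r<..<(real (i - 2 ^ r) + 1) / 2 ^ r}"
  shows "schauder i t = 0"
proof -
  define a :: real where "a = real (i - 2 ^ r) / 2 ^ r"
  define w :: real where "w = 1 / 2 ^ (r + 1)"
  have "t \<le> a \<or> a + 2 * w \<le> t" and "0 < w"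
    using assms(3) by (auto simp: a_def w_def field_simps)
  then show ?thesis
    unfolding schauder_explicit[OF i t] a_def[symmetric] w_def[symmetric]
    by (auto simp: min_def max_def)
qed

text \<open>Schauder functions of one level live on disjoint dyadic intervals.\<close>

lemma schauder_mult_eq_0:
  assumes i: "i \<in> {2 ^ r..<2 ^ (r + 1)}" and j: "j \<in> {2 ^ r..<2 ^ (r + 1)}"
    and "i \<noteq> j" "0 \<le> t"
  shows "schauder i t * schauder j t = 0"
proof (rule ccontr)
  assume "schauder i t * schauder j t \<noteq> 0"
  then have "real (i - 2 ^ r) / 2 ^ r < t" "t < (real (i - 2 ^ r) + 1) / 2 ^ r"
    "real (j - 2 ^ r) / 2 ^ r < t" "t < (real (j - 2 ^ r) + 1) / 2 ^ r"
    using schauder_eq_0[OF i \<open>0 \<le> t\<close>] schauder_eq_0[OF j \<open>0 \<le> t\<close>] by auto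
  then have "real (i - 2 ^ r) / 2 ^ r < (real (j - 2 ^ r) + 1) / 2 ^ r" 
    "real (j - 2 ^ r) / 2 ^ r < (real (i - 2 ^ r) + 1) / 2 ^ r" by linarith+
  then have "real (i - 2 ^ r) < real (j - 2 ^ r) + 1" "real (j - 2 ^ r) < real (i - 2 ^ r) + 1"
    by (simp_all add: divide_less_cancel)
  then show False using i j \<open>i \<noteq> j\<close> by auto
qed

lemma orthogonal_schauder_L2:
  assumes "i \<in> {2 ^ r..<2 ^ (r + 1)}" "j \<in> {2 ^ r..<2 ^ (r + 1)}" "i \<noteq> j"
  shows "inner (schauder_L2 i) (schauder_L2 j) = 0"
proof -
  have "inner (schauder_L2 i) (schauder_L2 j) = (LINT t|lborel01. schauder i t * schauder j t)"
    unfolding schauder_L2_def by (intro inner_abs_L2 square_integrable_schauder)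
  also have "\<dots> = (LINT t|lborel01. 0)"
    using schauder_mult_eq_0[OF assms]
    by (intro Bochner_Integration.integral_cong) (auto simp: space_restrict_space)
  finally show ?thesis by simp
qed

text \<open>The hat is at most \<open>2 powr (r / 2) * w\<close> on its support of length \<open>2 * w\<close>, and at least half of that
  on the middle half of the support. Only the order \<open>4 ^ (- r)\<close> matters, so these two rectangles replace
  the exact integral.\<close>

lemma norm_schauder_L2:
  assumes i: "i \<in> {2 ^ r..<2 ^ (r + 1)}"
  shows "(norm (schauder_L2 i))\<^sup>2 \<le> 1 / 4 ^ (r + 1)" "1 / (32 * 4 ^ r) \<le> (norm (schauder_L2 i))\<^sup>2"
proof -
  interpret lborel01: prob_space lborel01 by (rule prob_space_lborel01)
  define a :: real where "a = real (i - 2 ^ r) / 2 ^ r"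
  define w :: real where "w = 1 / 2 ^ (r + 1)"
  have w: "0 < w" by (simp add: w_def)
  have a: "0 \<le> a" by (simp add: a_def)
  have a1: "a + 2 * w \<le> 1"
  proof -
    have "real (i - 2 ^ r) + 1 \<le> real (2 ^ r)" using i by (auto simp del: of_nat_power)
    then have "(real (i - 2 ^ r) + 1) / 2 ^ r \<le> 1" by simp
    then show ?thesis by (simp add: a_def w_def add_divide_distrib)
  qed
  have S: "schauder i t = 2 powr (real r / 2) * (max 0 (min w (t - a)) - max 0 (min w (t - a - w)))"
    if "0 \<le> t" for t
    using schauder_explicit[OF i that] by (simp add: a_def w_def)
  have sq: "(2 powr (real r / 2) :: real)\<^sup>2 = 2 ^ r"
    by (simp add: power2_eq_square powr_add[symmetric] powr_realpow)
  have N: "(norm (schauder_L2 i))\<^sup>2 = (LINT t|lborel01. (schauder i t)\<^sup>2)"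
    unfolding schauder_L2_def by (intro norm_abs_L2 square_integrable_schauder)
  have int: "integrable lborel01 (\<lambda>t. (schauder i t)\<^sup>2)"
    using square_integrable_schauder[of i] by (simp add: square_integrable_def)
  have ind: "integrable lborel01 (indicat_real {b..c})"
    "(LINT t|lborel01. indicat_real {b..c} t) = c - b" if "0 \<le> b" "b \<le> c" "c \<le> 1" for b c
  proof -
    have "{b..c} \<subseteq> {0..1}" using that by auto
    then have "emeasure lborel01 {b..c} = ennreal (c - b)" and m: "{b..c} \<in> sets lborel01"
      using that by (simp_all add: emeasure_restrict_space sets_restrict_space_iff)
    then show "integrable lborel01 (indicat_real {b..c})"
      "(LINT t|lborel01. indicat_real {b..c} t) = c - b"
      using that by (auto simp: measure_def intro!: integrable_real_indicator)
  qed
  have "(norm (schauder_L2 i))\<^sup>2 \<le> (LINT t|lborel01. (2 ^ r * w\<^sup>2) * indicator {a..a + 2 * w} t)"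
    unfolding N
  proof (rule integral_mono[OF int])
    show "integrable lborel01 (\<lambda>t. (2 ^ r * w\<^sup>2) * indicat_real {a..a + 2 * w} t)"
      using ind[of a "a + 2 * w"] a a1 w by (intro integrable_mult_right) auto
    fix t assume "t \<in> space lborel01"
    then have t: "0 \<le> t" by simp
    have "(max 0 (min w (t - a)) - max 0 (min w (t - a - w)))\<^sup>2 \<le> w\<^sup>2 * indicator {a..a + 2 * w} t"
    proof (cases "t \<in> {a..a + 2 * w}")
      case True
      then have "\<bar>max 0 (min w (t - a)) - max 0 (min w (t - a - w))\<bar> \<le> \<bar>w\<bar>" using w by auto
      with True show ?thesis by (simp add: abs_le_square_iff)
    next
      case False
      then have "max 0 (min w (t - a)) - max 0 (min w (t - a - w)) = 0" using w by (auto simp: min_def max_def)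
      with False show ?thesis by simp
    qed
    then show "(schauder i t)\<^sup>2 \<le> (2 ^ r * w\<^sup>2) * indicat_real {a..a + 2 * w} t"
      unfolding S[OF t] power_mult_distrib sq mult.assoc by (intro mult_left_mono) auto
  qed
  also have "\<dots> = 2 ^ r * w\<^sup>2 * (2 * w)"
    using ind[of a "a + 2 * w"] a a1 w by simp
  also have "\<dots> = 1 / 4 ^ (r + 1)"
  proof -
    have "(4 :: real) ^ (r + 1) = 2 ^ (r + 1) * 2 ^ (r + 1)" by (simp flip: power_mult_distrib)
    then show ?thesis by (simp add: w_def power2_eq_square)
  qed
  finally show "(norm (schauder_L2 i))\<^sup>2 \<le> 1 / 4 ^ (r + 1)" .
  have "1 / (32 * 4 ^ r) = 2 ^ r * (w / 2)\<^sup>2 * w"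
  proof -
    have "(4 :: real) ^ r = 2 ^ r * 2 ^ r" by (simp flip: power_mult_distrib)
    then show ?thesis by (simp add: w_def power2_eq_square)
  qed
  also have "\<dots> = (LINT t|lborel01. (2 ^ r * (w / 2)\<^sup>2) * indicator {a + w / 2..a + 3 * w / 2} t)"
    using ind[of "a + w / 2" "a + 3 * w / 2"] a a1 w by simp
  also have "\<dots> \<le> (norm (schauder_L2 i))\<^sup>2"
    unfolding N
  proof (rule integral_mono[OF _ int])
    show "integrable lborel01 (\<lambda>t. (2 ^ r * (w / 2)\<^sup>2) * indicat_real {a + w / 2..a + 3 * w / 2} t)"
      using ind[of "a + w / 2" "a + 3 * w / 2"] a a1 w by (intro integrable_mult_right) auto
    fix t assume "t \<in> space lborel01"
    then have t: "0 \<le> t" by simp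
    have "(w / 2)\<^sup>2 * indicator {a + w / 2..a + 3 * w / 2} t \<le> (max 0 (min w (t - a)) - max 0 (min w (t - a - w)))\<^sup>2"
    proof (cases "t \<in> {a + w / 2..a + 3 * w / 2}")
      case True
      then have "\<bar>w / 2\<bar> \<le> \<bar>max 0 (min w (t - a)) - max 0 (min w (t - a - w))\<bar>"
        using w by (auto simp: min_def max_def)
      with True show ?thesis unfolding abs_le_square_iff by simp
    qed simp
    then show "(2 ^ r * (w / 2)\<^sup>2) * indicat_real {a + w / 2..a + 3 * w / 2} t \<le> (schauder i t)\<^sup>2"
      unfolding S[OF t] power_mult_distrib sq mult.assoc by (intro mult_left_mono) auto
  qed
  finally show "1 / (32 * 4 ^ r) \<le> (norm (schauder_L2 i))\<^sup>2" .
qed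

section \<open>The mean square error of the random bit approximation\<close>

text \<open>
  A weighted Cauchy-Schwarz inequality, with weights \<open>w\<close> to be chosen proportional to the expected size
  of the summands. It replaces the triangle inequality in the space of square-integrable random
  elements.
\<close>

lemma norm_sum_squared_le:
  fixes W :: "'i \<Rightarrow> 'v::real_normed_vector" and w :: "'i \<Rightarrow> real"
  assumes "\<And>r. r \<in> A \<Longrightarrow> 0 < w r"
  shows "(norm (\<Sum>r\<in>A. W r))\<^sup>2 \<le> (\<Sum>r\<in>A. w r) * (\<Sum>r\<in>A. (norm (W r))\<^sup>2 / w r)"
proof -
  have "(norm (\<Sum>r\<in>A. W r))\<^sup>2 \<le> (\<Sum>r\<in>A. sqrt (w r) * (norm (W r) / sqrt (w r)))\<^sup>2"
  proof (rule power_mono)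
    have "norm (\<Sum>r\<in>A. W r) \<le> (\<Sum>r\<in>A. norm (W r))" by (rule norm_sum)
    also have "\<dots> = (\<Sum>r\<in>A. sqrt (w r) * (norm (W r) / sqrt (w r)))"
      using assms by (intro sum.cong) (auto simp: less_imp_neq[THEN not_sym])
    finally show "norm (\<Sum>r\<in>A. W r) \<le> (\<Sum>r\<in>A. sqrt (w r) * (norm (W r) / sqrt (w r)))" .
  qed simp
  also have "\<dots> \<le> (\<Sum>r\<in>A. (sqrt (w r))\<^sup>2) * (\<Sum>r\<in>A. (norm (W r) / sqrt (w r))\<^sup>2)"
    by (rule Cauchy_Schwarz_ineq_sum)
  also have "\<dots> = (\<Sum>r\<in>A. w r) * (\<Sum>r\<in>A. (norm (W r))\<^sup>2 / w r)"
    using assms by (intro arg_cong2[where f = "(*)"] sum.cong) (auto simp: power_divide less_imp_le)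
  finally show ?thesis .
qed

lemma norm_add_squared_le: "(norm (x + y))\<^sup>2 \<le> 2 * (norm x)\<^sup>2 + 2 * (norm y)\<^sup>2"
  for x y :: "'v::real_normed_vector"
proof -
  have "(norm (x + y))\<^sup>2 \<le> (norm x + norm y)\<^sup>2"
    by (intro power_mono norm_triangle_ineq) simp
  also have "\<dots> \<le> 2 * (norm x)\<^sup>2 + 2 * (norm y)\<^sup>2"
    using zero_le_power2[of "norm x - norm y"] unfolding power2_sum power2_diff by linarith
  finally show ?thesis .
qed

text \<open>
  Within one level the Schauder functions are orthogonal because of their disjoint supports, so this
  holds for every choice of the coefficients and can be applied pointwise to random ones.
\<close>

lemma norm_level_sum:
  "(norm (\<Sum>i\<in>{2 ^ r..<2 ^ (r + 1)}. c i *\<^sub>R schauder_L2 i))\<^sup>2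
    \<le> (\<Sum>i\<in>{2 ^ r..<2 ^ (r + 1)}. (c i)\<^sup>2) / 4 ^ (r + 1)"
proof -
  have "(norm (\<Sum>i\<in>{2 ^ r..<2 ^ (r + 1)}. c i *\<^sub>R schauder_L2 i))\<^sup>2
      = (\<Sum>i\<in>{2 ^ r..<2 ^ (r + 1)}. (norm (c i *\<^sub>R schauder_L2 i))\<^sup>2)"
    by (rule norm_sum_Pythagorean) (auto simp: pairwise_def orthogonal_def orthogonal_schauder_L2)
  also have "\<dots> \<le> (\<Sum>i\<in>{2 ^ r..<2 ^ (r + 1)}. (c i)\<^sup>2 * (1 / 4 ^ (r + 1)))"
    unfolding norm_scaleR power_mult_distrib power2_abs
    by (intro sum_mono mult_left_mono norm_schauder_L2(1)) auto
  finally show ?thesis by (simp add: sum_divide_distrib)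
qed

lemma sum_dyadic_levels:
  fixes f :: "nat \<Rightarrow> 'v::comm_monoid_add"
  shows "(\<Sum>i = 1..2 ^ R - 1. f i) = (\<Sum>r<R. \<Sum>i\<in>{2 ^ r..<2 ^ (r + 1)}. f i)"
proof (induction R)
  case (Suc R)
  have "(1::nat) \<le> 2 ^ R" by simp
  then have "{1..2 ^ Suc R - 1 :: nat} = {1..2 ^ R - 1} \<union> {2 ^ R..<2 ^ (R + 1)}"
    "{1..2 ^ R - 1} \<inter> {2 ^ R..<2 ^ (R + 1) :: nat} = {}" by (auto simp: not_le)
  then have "(\<Sum>i = 1..2 ^ Suc R - 1. f i) = (\<Sum>i = 1..2 ^ R - 1. f i) + (\<Sum>i\<in>{2 ^ R..<2 ^ (R + 1)}. f i)"
    by (simp add: sum.union_disjoint)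
  with Suc show ?case by simp
qed simp

text \<open>Level \<open>r\<close> has \<open>2 ^ r\<close> summands, each with squared norm of order \<open>4 ^ (- r)\<close>.\<close>

lemma nn_integral_norm_level_sum:
  assumes "\<And>i. i \<in> {2 ^ r..<2 ^ (r + 1)} \<Longrightarrow> X i \<in> borel_measurable M"
    and "\<And>i. i \<in> {2 ^ r..<2 ^ (r + 1)} \<Longrightarrow> (\<integral>\<^sup>+\<omega>. ennreal ((X i \<omega>)\<^sup>2) \<partial>M) \<le> ennreal e"
    and "0 \<le> e"
  shows "(\<integral>\<^sup>+\<omega>. ennreal ((norm (\<Sum>i\<in>{2 ^ r..<2 ^ (r + 1)}. X i \<omega> *\<^sub>R schauder_L2 i))\<^sup>2) \<partial>M)
    \<le> ennreal (e / 2 ^ r)"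
proof -
  let ?I = "{2 ^ r..<2 ^ (r + 1)} :: nat set"
  have "(\<integral>\<^sup>+\<omega>. ennreal ((norm (\<Sum>i\<in>?I. X i \<omega> *\<^sub>R schauder_L2 i))\<^sup>2) \<partial>M)
      \<le> (\<integral>\<^sup>+\<omega>. ennreal ((\<Sum>i\<in>?I. (X i \<omega>)\<^sup>2) / 4 ^ (r + 1)) \<partial>M)"
    by (intro nn_integral_mono ennreal_leI norm_level_sum)
  also have "\<dots> = (\<integral>\<^sup>+\<omega>. ennreal (1 / 4 ^ (r + 1)) * (\<Sum>i\<in>?I. ennreal ((X i \<omega>)\<^sup>2)) \<partial>M)"
    by (intro nn_integral_cong, subst sum_ennreal) (auto simp flip: ennreal_mult')
  also have "\<dots> = ennreal (1 / 4 ^ (r + 1)) * (\<Sum>i\<in>?I. \<integral>\<^sup>+\<omega>. ennreal ((X i \<omega>)\<^sup>2) \<partial>M)"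
    using assms(1) by (subst nn_integral_cmult, measurable) (subst nn_integral_sum, auto)
  also have "\<dots> \<le> ennreal (1 / 4 ^ (r + 1)) * (\<Sum>i\<in>?I. ennreal e)"
    by (intro mult_left_mono sum_mono assms(2)) auto
  also have "\<dots> = ennreal (2 ^ r * e / 4 ^ (r + 1))"
  proof -
    have "(\<Sum>i\<in>?I. ennreal e) = ennreal (2 ^ r * e)"
      using assms(3) by (subst sum_ennreal) auto
    then show ?thesis
      using assms(3) by (simp only:, subst ennreal_mult[symmetric]) auto
  qed
  also have "\<dots> \<le> ennreal (e / 2 ^ r)"
  proof (rule ennreal_leI)
    have "(4 :: real) ^ r = 2 ^ r * 2 ^ r" by (simp flip: power_mult_distrib)
    then show "2 ^ r * e / 4 ^ (r + 1) \<le> e / 2 ^ r" using assms(3) by (simp add: field_simps)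
  qed
  finally show ?thesis .
qed

lemma sum_geometric_distance_le:
  fixes b :: real
  assumes b: "0 < b" "b < 1"
  shows "(\<Sum>r<R. b ^ (if r < l then l - r else r - l)) \<le> 2 / (1 - b)"
proof -
  have geo: "(\<Sum>j\<in>J. b ^ j) \<le> 1 / (1 - b)" if "finite J" for J :: "nat set"
    using sum_le_suminf[OF summable_geometric, of b J] that b by (simp add: suminf_geometric)
  have "(\<Sum>r<R. b ^ (if r < l then l - r else r - l))
      = (\<Sum>r\<in>{..<R} \<inter> {..<l}. b ^ (l - r)) + (\<Sum>r\<in>{..<R} - {..<l}. b ^ (r - l))"
    by (subst sum.Int_Diff[where B = "{..<l}"]) (auto intro!: arg_cong2[where f = "(+)"] sum.cong)
  also have "(\<Sum>r\<in>{..<R} \<inter> {..<l}. b ^ (l - r)) = (\<Sum>j\<in>(\<lambda>r. l - r) ` ({..<R} \<inter> {..<l}). b ^ j)"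
    by (subst sum.reindex) (auto simp: inj_on_def)
  also have "\<dots> \<le> 1 / (1 - b)" by (rule geo) simp
  also have "(\<Sum>r\<in>{..<R} - {..<l}. b ^ (r - l)) = (\<Sum>j\<in>(\<lambda>r. r - l) ` ({..<R} - {..<l}). b ^ j)"
    by (subst sum.reindex) (auto simp: inj_on_def)
  also have "\<dots> \<le> 1 / (1 - b)" by (rule geo) simp
  finally show ?thesis by simp
qed

lemma nn_integral_iid_std_normal:
  assumes "iid_std_normal M Y" "1 \<le> i" and [measurable]: "g \<in> borel_measurable borel"
    and "Y i \<in> borel_measurable M"
  shows "(\<integral>\<^sup>+\<omega>. g (Y i \<omega>) \<partial>M) = (\<integral>\<^sup>+y. g y \<partial>std_normal_distribution)"
proof -
  have "distr M borel (Y i) = std_normal_distribution"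
    using assms by (simp add: iid_std_normal_def)
  moreover have "(\<integral>\<^sup>+y. g y \<partial>distr M borel (Y i)) = (\<integral>\<^sup>+\<omega>. g (Y i \<omega>) \<partial>M)"
    using assms(3) by (intro nn_integral_distr assms(4)) simp
  ultimately show ?thesis by (simp only:)
qed

lemma nn_integral_std_normal_square:
  "(\<integral>\<^sup>+y. ennreal (y\<^sup>2) \<partial>std_normal_distribution) = ennreal 1"
proof -
  have "(\<integral>\<^sup>+y. ennreal (y\<^sup>2) \<partial>std_normal_distribution) = ennreal (LINT y|std_normal_distribution. y\<^sup>2)"
    using std_normal_distribution_even_moments(2)[of 1] by (intro nn_integral_eq_integral) auto
  then show ?thesis using std_normal_distribution_even_moments(1)[of 1] by simp
qed

text \<open>The contribution of level \<open>r\<close> to the difference between the expansion and its approximation: the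
  coefficients are rounded below level \<open>l\<close> and dropped from level \<open>l\<close> on.\<close>

definition level_error :: "(nat \<Rightarrow> 'a \<Rightarrow> real) \<Rightarrow> nat \<Rightarrow> nat \<Rightarrow> 'a \<Rightarrow> L2" where
  "level_error Y l r \<omega> = (\<Sum>i\<in>{2 ^ r..<2 ^ (r + 1)}.
     (Y i \<omega> - (if r < l then round_normal (bit_numbers l i) (Y i \<omega>) else 0)) *\<^sub>R schauder_L2 i)"

lemma sum_level_error:
  assumes "l \<le> R"
  shows "(\<Sum>r<R. level_error Y l r \<omega>) = (\<Sum>i=1..2 ^ R - 1. Y i \<omega> *\<^sub>R schauder_L2 i) - bridge_approx Y l (bit_numbers l) \<omega>"
proof -
  have "bridge_approx Y l (bit_numbers l) \<omega>
      = (\<Sum>r<l. \<Sum>i\<in>{2 ^ r..<2 ^ (r + 1)}. round_normal (bit_numbers l i) (Y i \<omega>) *\<^sub>R schauder_L2 i)"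
    unfolding bridge_approx_def by (rule sum_dyadic_levels)
  also have "\<dots> = (\<Sum>r<R. \<Sum>i\<in>{2 ^ r..<2 ^ (r + 1)}.
      (if r < l then round_normal (bit_numbers l i) (Y i \<omega>) else 0) *\<^sub>R schauder_L2 i)"
    using assms by (intro sum.mono_neutral_cong_left) auto
  finally show ?thesis
    unfolding level_error_def sum_dyadic_levels by (simp add: scaleR_diff_left sum_subtractf)
qed

text \<open>The total error is concentrated at the levels close to \<open>l\<close>. Below, the number \<open>2 * (l - r)\<close> of bits
  contributes \<open>2 powr (- 3 * (l - r) / 2)\<close> and level \<open>r\<close> itself \<open>2 ^ (- r)\<close>, which together give
  \<open>2 ^ (- l)\<close> times \<open>2 powr (- (l - r) / 2)\<close>. Above, the factor \<open>2 ^ (- r)\<close> alone decays.\<close>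

lemma level_error_bound:
  fixes l r :: nat
  assumes Y: "iid_std_normal M Y" "\<And>i. 1 \<le> i \<Longrightarrow> Y i \<in> borel_measurable M"
  defines "b \<equiv> 2 powr (- 1 / 4)"
  shows "(\<integral>\<^sup>+\<omega>. ennreal ((norm (level_error Y l r \<omega>))\<^sup>2) \<partial>M)
    \<le> ennreal (3456 * pi / 2 ^ l * (b ^ (if r < l then l - r else r - l))\<^sup>2)"
proof -
  have b2: "(b ^ n)\<^sup>2 = 2 powr (- real n / 2)" for n
    by (simp add: b_def power2_eq_square powr_add[symmetric] powr_powr flip: powr_realpow)
  have pi: "1 \<le> 3456 * pi" using pi_ge_two by simp
  define e where "e = (if r < l then 3456 * pi / 2 powr (3 * real (2 * (l - r)) / 4) else 1)"
  have "(\<integral>\<^sup>+\<omega>. ennreal ((norm (level_error Y l r \<omega>))\<^sup>2) \<partial>M) \<le> ennreal (e / 2 ^ r)"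
    unfolding level_error_def
  proof (rule nn_integral_norm_level_sum)
    fix i :: nat assume i: "i \<in> {2 ^ r..<2 ^ (r + 1)}"
    then have i1: "1 \<le> i" by (meson atLeastLessThan_iff le_trans one_le_numeral one_le_power)
    note Yi [measurable] = Y(2)[OF i1]
    show "(\<lambda>\<omega>. Y i \<omega> - (if r < l then round_normal (bit_numbers l i) (Y i \<omega>) else 0)) \<in> borel_measurable M"
      by measurable
    show "(\<integral>\<^sup>+\<omega>. ennreal ((Y i \<omega> - (if r < l then round_normal (bit_numbers l i) (Y i \<omega>) else 0))\<^sup>2) \<partial>M) \<le> ennreal e"
    proof (cases "r < l")
      case True
      have "(\<integral>\<^sup>+\<omega>. ennreal ((Y i \<omega> - round_normal (bit_numbers l i) (Y i \<omega>))\<^sup>2) \<partial>M)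
          = (\<integral>\<^sup>+y. ennreal ((y - round_normal (bit_numbers l i) y)\<^sup>2) \<partial>std_normal_distribution)"
        by (rule nn_integral_iid_std_normal[OF Y(1) i1 _ Yi]) measurable
      also have "\<dots> \<le> ennreal e"
        using round_normal_error[of "bit_numbers l i"] True
        by (simp add: e_def bit_numbers_def dyadic_level_block[OF i])
      finally show ?thesis using True by simp
    next
      case False
      then show ?thesis
        using nn_integral_iid_std_normal[OF Y(1) i1 _ Yi, of "\<lambda>y. ennreal (y\<^sup>2)"]
        by (simp add: e_def nn_integral_std_normal_square)
    qed
  qed (simp add: e_def)
  also have "e / 2 ^ r \<le> 3456 * pi / 2 ^ l * (b ^ (if r < l then l - r else r - l))\<^sup>2"
  proof (cases "r < l")
    case True
    have "1 / (2 powr (3 * real (2 * (l - r)) / 4) * 2 ^ r) = 1 / 2 ^ l * 2 powr (- real (l - r) / 2)"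
    proof -
      have "2 powr (3 * real (2 * (l - r)) / 4) * 2 ^ r = 2 powr (3 * real (2 * (l - r)) / 4 + real r)"
        by (simp add: powr_add powr_realpow)
      also have "3 * real (2 * (l - r)) / 4 + real r = real l - (- real (l - r) / 2)"
        using True by (simp add: of_nat_diff field_simps)
      also have "2 powr (real l - (- real (l - r) / 2)) = 2 ^ l / 2 powr (- real (l - r) / 2)"
        by (simp only: powr_diff powr_realpow zero_less_numeral)
      finally show ?thesis by simp
    qed
    then have "3456 * pi * (1 / (2 powr (3 * real (2 * (l - r)) / 4) * 2 ^ r))
       = 3456 * pi * (1 / 2 ^ l * 2 powr (- real (l - r) / 2))" by (simp only:)
    then show ?thesis using True by (simp add: e_def b2)
  next
    case False
    have "1 / (2 :: real) ^ r = 1 / 2 ^ l * 2 powr (- real (r - l))"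
    proof -
      have "(2 :: real) ^ l * 2 ^ (r - l) = 2 ^ r" using False by (simp flip: power_add)
      then show ?thesis
        by (simp only: powr_minus_divide powr_realpow zero_less_numeral) simp
    qed
    also have "\<dots> \<le> 1 / 2 ^ l * 2 powr (- real (r - l) / 2)"
      by (intro mult_left_mono powr_mono) auto
    also have "\<dots> \<le> 3456 * pi * (1 / 2 ^ l * 2 powr (- real (r - l) / 2))"
      using pi mult_right_mono[OF pi, of "1 / 2 ^ l * 2 powr (- real (r - l) / 2)"] by simp
    finally show ?thesis using False by (simp add: e_def b2)
  qed
  finally show ?thesis by (simp add: ennreal_leI)
qed

lemma borel_measurable_level_error:
  assumes Y: "\<And>i. 1 \<le> i \<Longrightarrow> Y i \<in> borel_measurable M"
  shows "level_error Y l r \<in> borel_measurable M"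
  unfolding level_error_def[abs_def]
proof (rule borel_measurable_sum)
  fix i :: nat assume "i \<in> {2 ^ r..<2 ^ (r + 1)}"
  then have i1: "1 \<le> i" by (meson atLeastLessThan_iff le_trans one_le_numeral one_le_power)
  note Yi [measurable] = Y[OF i1]
  show "(\<lambda>\<omega>. (Y i \<omega> - (if r < l then round_normal (bit_numbers l i) (Y i \<omega>) else 0)) *\<^sub>R schauder_L2 i)
      \<in> borel_measurable M"
    by measurable
qed

lemma borel_measurable_bridge_approx:
  assumes Y: "\<And>i. 1 \<le> i \<Longrightarrow> Y i \<in> borel_measurable M"
  shows "bridge_approx Y l p \<in> borel_measurable M"
  unfolding bridge_approx_def[abs_def]
proof (rule borel_measurable_sum)
  fix i :: nat assume "i \<in> {1..2 ^ l - 1}"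
  then have i1: "1 \<le> i" by simp
  note Yi [measurable] = Y[OF i1]
  show "(\<lambda>\<omega>. round_normal (p i) (Y i \<omega>) *\<^sub>R schauder_L2 i) \<in> borel_measurable M"
    by measurable
qed

text \<open>The weights of the Cauchy-Schwarz inequality are proportional to the square roots of the
  bounds for the levels, which decay geometrically in the distance from level \<open>l\<close>.\<close>

lemma sum_level_error_bound:
  assumes Y: "iid_std_normal M Y" "\<And>i. 1 \<le> i \<Longrightarrow> Y i \<in> borel_measurable M"
  defines "b \<equiv> 2 powr (- 1 / 4)"
  shows "(\<integral>\<^sup>+\<omega>. ennreal ((norm (\<Sum>r<R. level_error Y l r \<omega>))\<^sup>2) \<partial>M)
    \<le> ennreal (3456 * pi * (2 / (1 - b))\<^sup>2 / 2 ^ l)"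
proof -
  note [measurable] = borel_measurable_level_error[OF Y(2)]
  have b: "0 < b" "b < 1"
    using powr_less_cancel_iff[of 2 "- 1 / 4" 0] by (simp_all add: b_def)
  define w where "w r = b ^ (if r < l then l - r else r - l)" for r
  have w: "0 < w r" for r using b by (simp add: w_def)
  define s where "s = (\<Sum>r<R. w r)"
  have s: "0 \<le> s" "s \<le> 2 / (1 - b)"
    using sum_geometric_distance_le[OF b, of l R] w
    by (auto simp: s_def w_def[symmetric] intro: sum_nonneg less_imp_le)
  have "(\<integral>\<^sup>+\<omega>. ennreal ((norm (\<Sum>r<R. level_error Y l r \<omega>))\<^sup>2) \<partial>M)
      \<le> (\<integral>\<^sup>+\<omega>. ennreal (s * (\<Sum>r<R. (norm (level_error Y l r \<omega>))\<^sup>2 / w r)) \<partial>M)"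
    unfolding s_def by (intro nn_integral_mono ennreal_leI norm_sum_squared_le w)
  also have "\<dots> = (\<integral>\<^sup>+\<omega>. ennreal s * (\<Sum>r<R. ennreal (1 / w r) * ennreal ((norm (level_error Y l r \<omega>))\<^sup>2)) \<partial>M)"
  proof (intro nn_integral_cong)
    fix \<omega>
    have "ennreal ((norm (level_error Y l r \<omega>))\<^sup>2 / w r) = ennreal (1 / w r) * ennreal ((norm (level_error Y l r \<omega>))\<^sup>2)" for r
      using w[of r] by (subst ennreal_mult[symmetric]) auto
    then show "ennreal (s * (\<Sum>r<R. (norm (level_error Y l r \<omega>))\<^sup>2 / w r))
        = ennreal s * (\<Sum>r<R. ennreal (1 / w r) * ennreal ((norm (level_error Y l r \<omega>))\<^sup>2))"
      using w s(1) by (subst ennreal_mult'[OF s(1)], subst sum_ennreal[symmetric]) (auto simp: less_imp_le)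
  qed
  also have "\<dots> = ennreal s * (\<Sum>r<R. ennreal (1 / w r) * (\<integral>\<^sup>+\<omega>. ennreal ((norm (level_error Y l r \<omega>))\<^sup>2) \<partial>M))"
    by (subst nn_integral_cmult, measurable, subst nn_integral_sum, measurable)
      (auto simp: nn_integral_cmult)
  also have "\<dots> \<le> ennreal s * (\<Sum>r<R. ennreal (1 / w r) * ennreal (3456 * pi / 2 ^ l * (w r)\<^sup>2))"
    unfolding w_def b_def by (intro mult_left_mono sum_mono level_error_bound Y) auto
  also have "\<dots> = ennreal (s * (\<Sum>r<R. 3456 * pi / 2 ^ l * w r))"
  proof -
    have "ennreal (1 / w r) * ennreal (3456 * pi / 2 ^ l * (w r)\<^sup>2) = ennreal (3456 * pi / 2 ^ l * w r)" for r
      using w[of r] by (subst ennreal_mult[symmetric]) (auto simp: power2_eq_square)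
    then have "(\<Sum>r<R. ennreal (1 / w r) * ennreal (3456 * pi / 2 ^ l * (w r)\<^sup>2))
        = ennreal (\<Sum>r<R. 3456 * pi / 2 ^ l * w r)"
      using w by (subst sum_ennreal[symmetric]) (auto simp: less_imp_le)
    then show ?thesis by (simp only: ennreal_mult'[OF s(1)])
  qed
  also have "\<dots> \<le> ennreal (3456 * pi * (2 / (1 - b))\<^sup>2 / 2 ^ l)"
  proof (rule ennreal_leI)
    have "s * (\<Sum>r<R. 3456 * pi / 2 ^ l * w r) = 3456 * pi / 2 ^ l * s\<^sup>2"
      unfolding s_def sum_distrib_left[symmetric] by (simp add: power2_eq_square)
    also have "\<dots> \<le> 3456 * pi / 2 ^ l * (2 / (1 - b))\<^sup>2"
      using s by (intro mult_left_mono power_mono) auto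
    finally show "s * (\<Sum>r<R. 3456 * pi / 2 ^ l * w r) \<le> 3456 * pi * (2 / (1 - b))\<^sup>2 / 2 ^ l" by simp
  qed
  finally show ?thesis .
qed

text \<open>The constant is uniform in the number of levels of the expansion, so the truncated
  expansion can be replaced by the bridge itself. The case \<open>l = 0\<close>, where the approximation is zero, is
  included; it serves small bit numbers later on.\<close>

lemma bridge_approx_error:
  assumes Y: "iid_std_normal M Y" "\<And>i. 1 \<le> i \<Longrightarrow> Y i \<in> borel_measurable M"
    and LC: "levy_ciesielski M Y B" and B [measurable]: "B \<in> borel_measurable M"
  obtains C where "0 < C"
    "\<And>l. (\<integral>\<^sup>+\<omega>. ennreal ((norm (B \<omega> - bridge_approx Y l (bit_numbers l) \<omega>))\<^sup>2) \<partial>M) \<le> ennreal (C / 2 ^ l)"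
proof -
  note [measurable] = borel_measurable_level_error[OF Y(2)] borel_measurable_bridge_approx[OF Y(2)]
  define K where "K = 3456 * pi * (2 / (1 - 2 powr (- 1 / 4)))\<^sup>2"
  have K: "0 \<le> K" by (simp add: K_def)
  let ?S = "\<lambda>N \<omega>. \<Sum>i=1..N. Y i \<omega> *\<^sub>R schauder_L2 i"
  let ?t = "\<lambda>N. \<integral>\<^sup>+\<omega>. ennreal ((norm (B \<omega> - ?S N \<omega>))\<^sup>2) \<partial>M"
  have S_meas [measurable]: "?S N \<in> borel_measurable M" for N
    using Y(2) by (intro borel_measurable_sum borel_measurable_scaleR) auto
  have "(\<integral>\<^sup>+\<omega>. ennreal ((norm (B \<omega> - bridge_approx Y l (bit_numbers l) \<omega>))\<^sup>2) \<partial>M) \<le> ennreal (2 * K / 2 ^ l)" for l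
  proof (rule ennreal_le_epsilon)
    fix e :: real assume e: "0 < e"
    have "filterlim (\<lambda>R. 2 ^ R - 1 :: nat) sequentially sequentially"
    proof (rule filterlim_at_top_mono[OF filterlim_ident])
      show "\<forall>\<^sub>F R in sequentially. R \<le> (2 ^ R - 1 :: nat)"
        using less_exp by (intro always_eventually allI) (metis Suc_diff_1 Suc_leI less_Suc_eq_le zero_less_numeral zero_less_power)
    qed
    from filterlim_compose[OF LC[unfolded levy_ciesielski_def] this]
    have "\<forall>\<^sub>F R in sequentially. ?t (2 ^ R - 1) < ennreal (e / 2)"
      using e by (intro order_tendstoD(2)) (auto simp: ennreal_zero_less_divide)
    then have "\<forall>\<^sub>F R in sequentially. ?t (2 ^ R - 1) < ennreal (e / 2) \<and> l \<le> R"
      using eventually_ge_at_top[of l] by eventually_elim auto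
    then obtain R where R: "?t (2 ^ R - 1) < ennreal (e / 2)" "l \<le> R"
      using eventually_happens'[OF sequentially_bot] by blast
    have "(\<integral>\<^sup>+\<omega>. ennreal ((norm (B \<omega> - bridge_approx Y l (bit_numbers l) \<omega>))\<^sup>2) \<partial>M)
        \<le> (\<integral>\<^sup>+\<omega>. ennreal 2 * ennreal ((norm (B \<omega> - ?S (2 ^ R - 1) \<omega>))\<^sup>2)
            + ennreal 2 * ennreal ((norm (\<Sum>r<R. level_error Y l r \<omega>))\<^sup>2) \<partial>M)"
    proof (intro nn_integral_mono)
      fix \<omega>
      have "(norm ((B \<omega> - ?S (2 ^ R - 1) \<omega>) + (\<Sum>r<R. level_error Y l r \<omega>)))\<^sup>2
          \<le> 2 * (norm (B \<omega> - ?S (2 ^ R - 1) \<omega>))\<^sup>2 + 2 * (norm (\<Sum>r<R. level_error Y l r \<omega>))\<^sup>2"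
        by (rule norm_add_squared_le)
      moreover have "(B \<omega> - ?S (2 ^ R - 1) \<omega>) + (\<Sum>r<R. level_error Y l r \<omega>)
          = B \<omega> - bridge_approx Y l (bit_numbers l) \<omega>"
        unfolding sum_level_error[OF R(2)] by simp
      ultimately have "(norm (B \<omega> - bridge_approx Y l (bit_numbers l) \<omega>))\<^sup>2
          \<le> 2 * (norm (B \<omega> - ?S (2 ^ R - 1) \<omega>))\<^sup>2 + 2 * (norm (\<Sum>r<R. level_error Y l r \<omega>))\<^sup>2"
        by (simp only:)
      then show "ennreal ((norm (B \<omega> - bridge_approx Y l (bit_numbers l) \<omega>))\<^sup>2)
          \<le> ennreal 2 * ennreal ((norm (B \<omega> - ?S (2 ^ R - 1) \<omega>))\<^sup>2)
            + ennreal 2 * ennreal ((norm (\<Sum>r<R. level_error Y l r \<omega>))\<^sup>2)"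
        by (rule order_trans[OF ennreal_leI]) (simp add: ennreal_mult)
    qed
    also have "\<dots> = ennreal 2 * ?t (2 ^ R - 1)
        + ennreal 2 * (\<integral>\<^sup>+\<omega>. ennreal ((norm (\<Sum>r<R. level_error Y l r \<omega>))\<^sup>2) \<partial>M)"
      by (subst nn_integral_add, measurable, subst (1 2) nn_integral_cmult) measurable
    also have "\<dots> \<le> ennreal 2 * ennreal (e / 2) + ennreal 2 * ennreal (K / 2 ^ l)"
      using sum_level_error_bound[OF Y, of l R] R(1) unfolding K_def
      by (intro add_mono mult_left_mono) auto
    also have "\<dots> = ennreal (2 * K / 2 ^ l) + ennreal e"
      using e K by (simp add: add.commute flip: ennreal_mult del: ennreal_numeral)
    finally show "(\<integral>\<^sup>+\<omega>. ennreal ((norm (B \<omega> - bridge_approx Y l (bit_numbers l) \<omega>))\<^sup>2) \<partial>M)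
        \<le> ennreal (2 * K / 2 ^ l) + ennreal e" .
  qed
  also have "ennreal (2 * K / 2 ^ l) \<le> ennreal ((2 * K + 1) / 2 ^ l)" for l
    by (intro ennreal_leI divide_right_mono) auto
  finally show ?thesis using K by (intro that[of "2 * K + 1"]) auto
qed

section \<open>Random bit approximations and couplings\<close>

lemma wasserstein2_le:
  fixes X X' :: "'a \<Rightarrow> 'v::{banach, second_countable_topology}"
  assumes "prob_space M" and [measurable]: "X \<in> borel_measurable M" "X' \<in> borel_measurable M"
  shows "wasserstein2 (distr M borel X) (distr M borel X')
    \<le> ennreal_sqrt (\<integral>\<^sup>+\<omega>. ennreal ((norm (X \<omega> - X' \<omega>))\<^sup>2) \<partial>M)"
proof -
  interpret prob_space M by fact
  let ?\<pi> = "distr M (borel \<Otimes>\<^sub>M borel) (\<lambda>\<omega>. (X \<omega>, X' \<omega>))"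
  have "?\<pi> \<in> couplings (distr M borel X) (distr M borel X')"
    unfolding couplings_def by (auto simp: distr_distr comp_def intro!: prob_space_distr)
  then have "wasserstein2 (distr M borel X) (distr M borel X')
      \<le> ennreal_sqrt (\<integral>\<^sup>+z. ennreal ((norm (fst z - snd z))\<^sup>2) \<partial>?\<pi>)"
    unfolding wasserstein2_def by (rule INF_lower)
  also have "(\<integral>\<^sup>+z. ennreal ((norm (fst z - snd z))\<^sup>2) \<partial>?\<pi>)
      = (\<integral>\<^sup>+\<omega>. ennreal ((norm (X \<omega> - X' \<omega>))\<^sup>2) \<partial>M)"
    by (subst nn_integral_distr) auto
  finally show ?thesis .
qed

lemma card_bit_lists: "card {bs :: bool list. length bs = p} = 2 ^ p"
  and finite_bit_lists: "finite {bs :: bool list. length bs = p}"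
  using card_lists_length_eq[of "UNIV :: bool set" p] finite_lists_length_eq[of "UNIV :: bool set" p]
  by (simp_all add: card_UNIV_bool)

text \<open>A random variable that is uniform on \<open>2 ^ p\<close> values is, in law, a bijective image of \<open>p\<close>
  random bits.\<close>

lemma uniform_distr_in_random_bit_measures:
  fixes g :: "'b \<Rightarrow> 'v::{banach, second_countable_topology}"
  assumes "finite S" "card S = 2 ^ p"
    and X: "\<And>\<omega>. \<omega> \<in> space M \<Longrightarrow> X \<omega> \<in> S"
    and sets: "\<And>s. s \<in> S \<Longrightarrow> X -` {s} \<inter> space M \<in> sets M"
    and unif: "\<And>s. s \<in> S \<Longrightarrow> emeasure M (X -` {s} \<inter> space M) = ennreal (1 / 2 ^ p)"
  shows "distr M borel (\<lambda>\<omega>. g (X \<omega>)) \<in> random_bit_measures p"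
proof -
  let ?L = "{bs :: bool list. length bs = p}"
  let ?U = "uniform_count_measure ?L"
  obtain h where h: "bij_betw h ?L S"
    using finite_same_card_bij[OF finite_bit_lists assms(1)] assms(2) card_bit_lists by metis
  have preimage: "(\<lambda>\<omega>. g (X \<omega>)) -` A \<inter> space M = (\<Union>s\<in>{s \<in> S. g s \<in> A}. X -` {s} \<inter> space M)" for A
    using X by auto
  have meas [measurable]: "(\<lambda>\<omega>. g (X \<omega>)) \<in> borel_measurable M"
  proof (rule measurableI)
    fix A :: "'v set"
    show "(\<lambda>\<omega>. g (X \<omega>)) -` A \<inter> space M \<in> sets M"
      unfolding preimage using assms(1) sets by (intro sets.finite_UN) auto
  qed simp
  have meas' [measurable]: "(\<lambda>bs. g (h bs)) \<in> borel_measurable ?U"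
    by (auto simp: measurable_def space_uniform_count_measure sets_uniform_count_measure)
  have "distr M borel (\<lambda>\<omega>. g (X \<omega>)) = distr ?U borel (\<lambda>bs. g (h bs))"
  proof (rule measure_eqI)
    fix A assume "A \<in> sets (distr M borel (\<lambda>\<omega>. g (X \<omega>)))"
    then have [measurable]: "A \<in> sets borel" by simp
    let ?T = "{s \<in> S. g s \<in> A}"
    have "emeasure (distr M borel (\<lambda>\<omega>. g (X \<omega>))) A = emeasure M (\<Union>s\<in>?T. X -` {s} \<inter> space M)"
      by (simp add: emeasure_distr preimage)
    also have "\<dots> = (\<Sum>s\<in>?T. emeasure M (X -` {s} \<inter> space M))"
      by (rule sum_emeasure[symmetric]) (use sets assms(1) in \<open>auto simp: disjoint_family_on_def\<close>)
    also have "\<dots> = of_nat (card ?T) * ennreal (1 / 2 ^ p)"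
      using unif by simp
    also have "card ?T = card {bs \<in> ?L. g (h bs) \<in> A}"
    proof (rule bij_betw_same_card[symmetric])
      show "bij_betw h {bs \<in> ?L. g (h bs) \<in> A} ?T"
        using h unfolding bij_betw_def by (auto intro: inj_on_subset)
    qed
    also have "of_nat (card {bs \<in> ?L. g (h bs) \<in> A}) * ennreal (1 / 2 ^ p)
        = emeasure ?U {bs \<in> ?L. g (h bs) \<in> A}"
      by (subst emeasure_uniform_count_measure)
        (auto simp: finite_bit_lists card_bit_lists ennreal_of_nat_eq_real_of_nat divide_inverse
          simp flip: ennreal_mult)
    also have "\<dots> = emeasure (distr ?U borel (\<lambda>bs. g (h bs))) A"
      by (subst emeasure_distr) (auto simp: space_uniform_count_measure intro!: arg_cong[where f = "emeasure ?U"])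
    finally show "emeasure (distr M borel (\<lambda>\<omega>. g (X \<omega>))) A = emeasure (distr ?U borel (\<lambda>bs. g (h bs))) A" .
  qed simp
  then show ?thesis unfolding random_bit_measures_def by auto
qed

lemma emeasure_std_normal_cell:
  fixes k :: int
  assumes "k \<in> {0..<2 ^ p}"
  shows "emeasure std_normal_distribution {y. \<lfloor>2 ^ p * std_normal_cdf y\<rfloor> = k} = ennreal (1 / 2 ^ p)"
proof -
  define a b :: real where "a = of_int k / 2 ^ p" and "b = (of_int k + 1) / 2 ^ p"
  have "of_int (k + 1) \<le> (of_int (2 ^ p) :: real)" using assms by (subst of_int_le_iff) auto
  then have ab: "0 \<le> a" "a \<le> b" "b \<le> 1" using assms by (auto simp: a_def b_def divide_right_mono)
  have cell: "\<lfloor>2 ^ p * u\<rfloor> = k \<longleftrightarrow> a \<le> u \<and> u < b" for u :: real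
    by (auto simp: a_def b_def floor_eq_iff field_simps)
  have "{y. \<lfloor>2 ^ p * std_normal_cdf y\<rfloor> = k} \<in> sets borel" by measurable
  then have "emeasure std_normal_distribution {y. \<lfloor>2 ^ p * std_normal_cdf y\<rfloor> = k}
      = (\<integral>\<^sup>+y. indicator {y. \<lfloor>2 ^ p * std_normal_cdf y\<rfloor> = k} y \<partial>std_normal_distribution)"
    by simp
  also have "\<dots> = (\<integral>\<^sup>+y. indicator {a..<b} (std_normal_cdf y) \<partial>std_normal_distribution)"
    by (intro nn_integral_cong) (auto simp: cell split: split_indicator)
  also have "\<dots> = (\<integral>\<^sup>+u. indicator {a..<b} u * indicator {0..1} u \<partial>lborel)"
    by (rule nn_integral_std_normal_cdf) simp
  also have "\<dots> = (\<integral>\<^sup>+u. indicator {a..<b} u \<partial>lborel)"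
    using ab by (intro nn_integral_cong) (auto split: split_indicator)
  also have "\<dots> = ennreal (1 / 2 ^ p)"
    using ab by (simp add: a_def b_def add_divide_distrib)
  finally show ?thesis .
qed

text \<open>Discarding the last \<open>q - p\<close> of \<open>q\<close> uniform bits leaves \<open>p\<close> uniform bits.\<close>

lemma random_bit_measures_mono:
  assumes "p \<le> q"
  shows "random_bit_measures p \<subseteq> (random_bit_measures q :: 'v::{banach, second_countable_topology} measure set)"
proof
  fix \<nu> :: "'v measure" assume "\<nu> \<in> random_bit_measures p"
  let ?L = "\<lambda>p. {bs :: bool list. length bs = p}"
  obtain f where \<nu>: "\<nu> = distr (uniform_count_measure (?L p)) borel f"
    using \<open>\<nu> \<in> _\<close> by (auto simp: random_bit_measures_def)
  have L: "finite (?L p)" "?L p \<noteq> {}" for p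
    using finite_bit_lists[of p] by (auto intro: exI[of _ "replicate p True"])
  have "uniform_count_measure (?L p) = distr (uniform_count_measure (?L q)) (uniform_count_measure (?L p)) (take p)"
  proof (rule measure_eqI)
    fix A assume "A \<in> sets (uniform_count_measure (?L p))"
    then have A: "A \<subseteq> ?L p" by (simp add: sets_uniform_count_measure)
    have "bij_betw (\<lambda>(x, y). x @ y) (A \<times> ?L (q - p)) (take p -` A \<inter> ?L q)"
      using A assms by (intro bij_betwI[where g = "\<lambda>bs. (take p bs, drop p bs)"]) auto
    then have "card (take p -` A \<inter> ?L q) = card A * 2 ^ (q - p)"
      by (metis bij_betw_same_card card_bit_lists card_cartesian_product)
    moreover have "real (card A) / 2 ^ p = real (card A * 2 ^ (q - p)) / 2 ^ q"
      using assms by (simp add: field_simps flip: power_add)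
    ultimately show "emeasure (uniform_count_measure (?L p)) A
        = emeasure (distr (uniform_count_measure (?L q)) (uniform_count_measure (?L p)) (take p)) A"
      using A assms L
      by (subst emeasure_distr)
        (auto simp: measurable_def space_uniform_count_measure sets_uniform_count_measure
          emeasure_uniform_count_measure card_bit_lists)
  qed simp
  then have "\<nu> = distr (uniform_count_measure (?L q)) borel (\<lambda>bs. f (take p bs))"
    unfolding \<nu> using assms
    by (subst \<open>uniform_count_measure (?L p) = _\<close>, subst distr_distr)
      (auto simp: measurable_def space_uniform_count_measure sets_uniform_count_measure comp_def)
  then show "\<nu> \<in> random_bit_measures q" unfolding random_bit_measures_def by auto
qed

lemma rbit_antimono: "p \<le> q \<Longrightarrow> rbit \<mu> q \<le> rbit \<mu> p"
  unfolding rbit_def by (intro INF_superset_mono random_bit_measures_mono) auto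

lemma measure_support_distr_subset:
  assumes "finite (f ` space M)" "f \<in> borel_measurable M"
  shows "measure_support (distr M borel f :: 'v::t1_space measure) \<subseteq> f ` space M"
proof
  fix x assume "x \<in> measure_support (distr M borel f)"
  moreover have "open (- f ` space M)"
    using finite_imp_closed[OF assms(1)] by (simp add: open_Compl)
  moreover have "emeasure (distr M borel f) (- f ` space M) = 0"
  proof -
    have "f -` (- f ` space M) \<inter> space M = {}" by auto
    then show ?thesis
      using \<open>open _\<close> assms(2) by (subst emeasure_distr) (auto simp: borel_open)
  qed
  ultimately show "x \<in> f ` space M"
    unfolding measure_support_def by force
qed

lemma quant_le_rbit: "quant \<mu> p \<le> rbit \<mu> p"
  unfolding quant_def rbit_def
proof (rule INF_superset_mono)
  show "random_bit_measures p \<subseteq> (finite_support_measures p :: 'a measure set)"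
  proof
    fix \<nu> :: "'a measure" assume \<nu>: "\<nu> \<in> random_bit_measures p"
    let ?L = "{bs :: bool list. length bs = p}"
    let ?U = "uniform_count_measure ?L"
    obtain f where f: "\<nu> = distr ?U borel f"
      using \<nu> by (auto simp: random_bit_measures_def)
    have "measure_support \<nu> \<subseteq> f ` ?L"
      using measure_support_distr_subset[of f ?U] finite_bit_lists
      by (auto simp: f measurable_def space_uniform_count_measure sets_uniform_count_measure)
    moreover have "card (f ` ?L) \<le> 2 ^ p"
      using card_image_le[OF finite_bit_lists, of f p] by (simp add: card_bit_lists)
    ultimately have "finite (measure_support \<nu>)" "card (measure_support \<nu>) \<le> 2 ^ p"
      using card_mono[OF finite_imageI[OF finite_bit_lists, of f p], of "measure_support \<nu>"]
        finite_subset[OF _ finite_imageI[OF finite_bit_lists, of f p], of "measure_support \<nu>"] by auto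
    then show "\<nu> \<in> finite_support_measures p"
      using \<nu> random_bit_measures_subset by (auto simp: finite_support_measures_def)
  qed
qed simp

text \<open>The approximation depends on \<open>Y\<close> only through the indices of the dyadic cells that contain the
  variables \<open>\<Phi> (Y i)\<close>. These indices are independent and uniform, so their vector is uniform on a set with
  \<open>2 ^ (\<Sum>i. p i)\<close> elements.\<close>

lemma bridge_approx_in_random_bit_measures:
  assumes M: "prob_space M" and Y: "iid_std_normal M Y"
  shows "distr M borel (bridge_approx Y l p) \<in> random_bit_measures (total_bits l p)"
proof -
  interpret prob_space M by fact
  define I :: "nat set" where "I = {1..2 ^ l - 1}"
  define X where "X \<omega> = (\<lambda>i\<in>I. \<lfloor>2 ^ p i * std_normal_cdf (Y i \<omega>)\<rfloor>)" for \<omega>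
  define g where "g x = (\<Sum>i\<in>I. inv std_normal_cdf (of_int (x i) / 2 ^ p i + 1 / 2 ^ (p i + 1)) *\<^sub>R schauder_L2 i)"
    for x :: "nat \<Rightarrow> int"
  let ?S = "\<Pi>\<^sub>E i\<in>I. {0..<(2 ^ p i :: int)}"
  have fin: "finite I" by (simp add: I_def)
  have indep: "indep_vars (\<lambda>_. borel) Y {1..}" and law: "\<And>i. i \<in> I \<Longrightarrow> distr M borel (Y i) = std_normal_distribution"
    using Y by (auto simp: iid_std_normal_def I_def)
  have Ym [measurable]: "Y i \<in> borel_measurable M" if "i \<in> I" for i
    using indep that by (auto simp: indep_vars_def I_def)
  have XS: "X \<omega> \<in> ?S" for \<omega>
  proof -
    have "\<lfloor>2 ^ p i * std_normal_cdf (Y i \<omega>)\<rfloor> < 2 ^ p i" "0 \<le> \<lfloor>2 ^ p i * std_normal_cdf (Y i \<omega>)\<rfloor>" for i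
      using std_normal_cdf_less_1[of "Y i \<omega>"] std_normal_cdf_gt_0[of "Y i \<omega>"]
      by (simp_all add: floor_less_iff less_imp_le)
    then show ?thesis by (auto simp: X_def)
  qed
  have X_eq: "X -` {x} \<inter> space M = {\<omega> \<in> space M. \<forall>i\<in>I. Y i \<omega> \<in> {y. \<lfloor>2 ^ p i * std_normal_cdf y\<rfloor> = x i}}"
    if "x \<in> ?S" for x
    using that by (auto simp: X_def PiE_def extensional_def fun_eq_iff restrict_def)
  have prob_cell: "prob (Y i -` {y. \<lfloor>2 ^ p i * std_normal_cdf y\<rfloor> = k} \<inter> space M) = 1 / 2 ^ p i"
    if "i \<in> I" "k \<in> {0..<2 ^ p i}" for i k
  proof -
    have "emeasure M (Y i -` {y. \<lfloor>2 ^ p i * std_normal_cdf y\<rfloor> = k} \<inter> space M)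
        = emeasure (distr M borel (Y i)) {y. \<lfloor>2 ^ p i * std_normal_cdf y\<rfloor> = k}"
      using that by (subst emeasure_distr) auto
    also have "\<dots> = ennreal (1 / 2 ^ p i)"
      unfolding law[OF that(1)] using that(2) by (rule emeasure_std_normal_cell)
    finally show ?thesis by (simp add: measure_def)
  qed
  have "distr M borel (\<lambda>\<omega>. g (X \<omega>)) \<in> random_bit_measures (total_bits l p)"
  proof (rule uniform_distr_in_random_bit_measures[where S = ?S])
    show "finite ?S" using fin by (intro finite_PiE) auto
    show "card ?S = 2 ^ total_bits l p"
      using fin by (simp add: card_PiE total_bits_def I_def power_sum nat_power_eq)
    show "X \<omega> \<in> ?S" for \<omega> by (rule XS)
    fix x assume x: "x \<in> ?S"
    show "X -` {x} \<inter> space M \<in> sets M"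
      unfolding X_eq[OF x] using fin by (intro sets.sets_Collect_finite_All) (auto intro!: measurable_sets_Collect)
    show "emeasure M (X -` {x} \<inter> space M) = ennreal (1 / 2 ^ total_bits l p)"
    proof (cases "I = {}")
      case True
      then have "total_bits l p = 0" by (simp add: total_bits_def I_def)
      with True show ?thesis
        unfolding X_eq[OF x] by (simp add: emeasure_space_1)
    next
      case False
      have "X -` {x} \<inter> space M = (\<Inter>i\<in>I. Y i -` {y. \<lfloor>2 ^ p i * std_normal_cdf y\<rfloor> = x i} \<inter> space M)"
        unfolding X_eq[OF x] using False by auto
      moreover have "prob (\<Inter>i\<in>I. Y i -` {y. \<lfloor>2 ^ p i * std_normal_cdf y\<rfloor> = x i} \<inter> space M)
          = (\<Prod>i\<in>I. prob (Y i -` {y. \<lfloor>2 ^ p i * std_normal_cdf y\<rfloor> = x i} \<inter> space M))"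
        using fin False by (intro indep_varsD[OF indep]) (auto simp: I_def)
      moreover have "\<dots> = (\<Prod>i\<in>I. 1 / 2 ^ p i)"
        using x by (intro prod.cong prob_cell) (auto simp: PiE_def)
      moreover have "\<dots> = 1 / 2 ^ total_bits l p"
        by (simp add: total_bits_def I_def power_sum prod_dividef)
      ultimately show ?thesis by (simp add: emeasure_eq_measure)
    qed
  qed
  moreover have "(\<lambda>\<omega>. g (X \<omega>)) = bridge_approx Y l p"
    by (auto simp: fun_eq_iff bridge_approx_def g_def X_def round_normal_def dyadic_midpoint_def I_def)
  ultimately show ?thesis by simp
qed

section \<open>Small ball probabilities\<close>

text \<open>
  Completing the square turns the integrand, up to the factor \<open>1 / sqrt s\<close> and a factor at most one,
  into a normal density with variance \<open>1 / s\<close>. The bound is independent of the shift \<open>b\<close>: this is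
  what makes small balls around an arbitrary centre as unlikely as those around zero.
\<close>

lemma nn_integral_exp_affine_std_normal:
  fixes c b lam :: real
  assumes "0 \<le> lam"
  shows "(\<integral>\<^sup>+y. ennreal (exp (- lam * (c * y + b)\<^sup>2)) \<partial>std_normal_distribution)
    \<le> ennreal (1 / sqrt (1 + 2 * lam * c\<^sup>2))"
proof -
  define s where "s = 1 + 2 * lam * c\<^sup>2"
  define m where "m = - (2 * lam * c * b) / s"
  have s: "1 \<le> s" using assms by (simp add: s_def)
  have pt: "std_normal_density y * exp (- lam * (c * y + b)\<^sup>2) \<le> 1 / sqrt s * normal_density m (1 / sqrt s) y" for y
  proof -
    have sm: "s * m = - (2 * lam * c * b)" using s by (simp add: m_def)
    have "s * (y - m)\<^sup>2 = s * y\<^sup>2 - 2 * (s * m) * y + (s * m) * m"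
      by (simp add: power2_eq_square algebra_simps)
    also have "\<dots> = s * y\<^sup>2 + 4 * lam * c * b * y - 2 * lam * c * b * m"
      unfolding sm by simp
    finally have e: "s * (y - m)\<^sup>2 = s * y\<^sup>2 + 4 * lam * c * b * y - 2 * lam * c * b * m" .
    have "- y\<^sup>2 / 2 + (- lam * (c * y + b)\<^sup>2) = - (s * (y - m)\<^sup>2) / 2 - (lam * b\<^sup>2 + lam * c * b * m)"
      unfolding e by (simp add: s_def power2_eq_square algebra_simps)
    also have "lam * b\<^sup>2 + lam * c * b * m = lam * b\<^sup>2 / s"
      using s by (simp add: m_def field_simps power2_eq_square) (simp add: s_def power2_eq_square algebra_simps)
    also have "- (s * (y - m)\<^sup>2) / 2 - lam * b\<^sup>2 / s \<le> - (s * (y - m)\<^sup>2) / 2"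
      using s assms by simp
    finally have "exp (- y\<^sup>2 / 2) * exp (- lam * (c * y + b)\<^sup>2) \<le> exp (- (s * (y - m)\<^sup>2) / 2)"
      unfolding exp_add[symmetric] exp_le_cancel_iff .
    then have "1 / sqrt (2 * pi) * (exp (- y\<^sup>2 / 2) * exp (- lam * (c * y + b)\<^sup>2))
        \<le> 1 / sqrt (2 * pi) * exp (- (s * (y - m)\<^sup>2) / 2)"
      by (intro mult_left_mono) auto
    also have "\<dots> = 1 / sqrt s * normal_density m (1 / sqrt s) y"
      using s by (simp add: normal_density_def power_divide real_sqrt_divide field_simps)
    finally show ?thesis by (simp add: std_normal_density_def mult.assoc)
  qed
  have "(\<integral>\<^sup>+y. ennreal (exp (- lam * (c * y + b)\<^sup>2)) \<partial>std_normal_distribution)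
      = (\<integral>\<^sup>+y. ennreal (std_normal_density y * exp (- lam * (c * y + b)\<^sup>2)) \<partial>lborel)"
    by (subst nn_integral_density) (auto simp: ennreal_mult')
  also have "\<dots> \<le> (\<integral>\<^sup>+y. ennreal (1 / sqrt s * normal_density m (1 / sqrt s) y) \<partial>lborel)"
    by (intro nn_integral_mono ennreal_leI pt)
  also have "\<dots> = ennreal (LINT y|lborel. 1 / sqrt s * normal_density m (1 / sqrt s) y)"
    using s by (intro nn_integral_eq_integral) auto
  also have "\<dots> = ennreal (1 / sqrt s)"
    using s by (subst integral_mult_right_zero, subst integral_normal_density) auto
  finally show ?thesis unfolding s_def .
qed

text \<open>
  Bessel's inequality for an orthogonal family.
\<close>

lemma sum_inner_squared_le_norm:
  fixes v :: "'i \<Rightarrow> 'v::real_inner"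
  assumes fin: "finite J" and orth: "\<And>i j. i \<in> J \<Longrightarrow> j \<in> J \<Longrightarrow> i \<noteq> j \<Longrightarrow> inner (v i) (v j) = 0"
    and pos: "\<And>j. j \<in> J \<Longrightarrow> v j \<noteq> 0"
  shows "(\<Sum>j\<in>J. (inner x (v j) / norm (v j))\<^sup>2) \<le> (norm x)\<^sup>2"
proof -
  define z where "z = (\<Sum>j\<in>J. (inner x (v j) / (norm (v j))\<^sup>2) *\<^sub>R v j)"
  let ?S = "\<Sum>j\<in>J. (inner x (v j) / norm (v j))\<^sup>2"
  have xz: "inner x z = ?S"
    by (simp add: z_def inner_sum_right power_divide) (simp add: power2_eq_square)
  have "(norm z)\<^sup>2 = (\<Sum>j\<in>J. (norm ((inner x (v j) / (norm (v j))\<^sup>2) *\<^sub>R v j))\<^sup>2)"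
    unfolding z_def using fin orth
    by (intro norm_sum_Pythagorean) (auto simp: pairwise_def orthogonal_def)
  also have "\<dots> = ?S"
    using pos by (intro sum.cong) (auto simp: power_mult_distrib power_divide power2_eq_square field_simps)
  finally have zz: "(norm z)\<^sup>2 = ?S" .
  have "0 \<le> (norm (x - z))\<^sup>2" by simp
  also have "\<dots> = (norm x)\<^sup>2 - 2 * inner x z + (norm z)\<^sup>2"
    by (simp add: power2_norm_eq_inner inner_diff_left inner_diff_right inner_commute)
  finally show ?thesis by (simp add: xz zz)
qed

text \<open>
  Projecting on the orthogonal vectors with index in \<open>J\<close> only shortens distances. With the remaining
  coefficients held fixed, the projections are independent affine functions of the coefficients in \<open>J\<close>, with
  slope \<open>norm (v j)\<close>; the exponential Markov inequality with parameter \<open>lam\<close> gives a product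
  of one-dimensional integrals. The vectors outside \<open>J\<close> enter only through the shifts,
  on which the one-dimensional bound does not depend.
\<close>

lemma gaussian_sum_small_ball:
  fixes v :: "nat \<Rightarrow> 'v::{real_inner, second_countable_topology}" and a :: 'v and lam c \<delta> :: real
  assumes M: "prob_space M"
    and indep: "prob_space.indep_vars M (\<lambda>_. borel) Y I"
    and law: "\<And>i. i \<in> I \<Longrightarrow> distr M borel (Y i) = std_normal_distribution"
    and fin: "finite I" and J: "J \<subseteq> I"
    and orth: "\<And>i j. i \<in> J \<Longrightarrow> j \<in> J \<Longrightarrow> i \<noteq> j \<Longrightarrow> inner (v i) (v j) = 0"
    and c: "0 < c" "\<And>j. j \<in> J \<Longrightarrow> c \<le> (norm (v j))\<^sup>2"
    and l: "0 \<le> lam"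
  shows "emeasure M {\<omega> \<in> space M. norm ((\<Sum>i\<in>I. Y i \<omega> *\<^sub>R v i) - a) \<le> \<delta>}
    \<le> ennreal (exp (lam * \<delta>\<^sup>2) * (1 / sqrt (1 + 2 * lam * c)) ^ card J)"
proof (cases "I = {}")
  case True
  interpret prob_space M by fact
  have "emeasure M A \<le> ennreal 1" for A using emeasure_le_1 by simp
  also have "ennreal 1 \<le> ennreal (exp (lam * \<delta>\<^sup>2))" using l by (intro ennreal_leI) simp
  finally show ?thesis using True J by simp
next
  case False
  interpret prob_space M by fact
  let ?N = "\<lambda>_::nat. std_normal_distribution"
  interpret P: product_sigma_finite ?N by unfold_locales
  have Ym [measurable]: "Y i \<in> borel_measurable M" if "i \<in> I" for i
    using indep that by (auto simp: indep_vars_def)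
  define K where "K = I - J"
  have I: "I = K \<union> J" "K \<inter> J = {}" "finite K" "finite J"
    using J fin by (auto simp: K_def intro: finite_subset)
  have pos: "v j \<noteq> 0" if "j \<in> J" for j using c(1) c(2)[OF that] by auto
  define S where "S x = (\<Sum>i\<in>I. x i *\<^sub>R v i)" for x :: "nat \<Rightarrow> real"
  define b where "b j x = (\<Sum>i\<in>K. x i * inner (v i) (v j)) / norm (v j) - inner a (v j) / norm (v j)" for j and x :: "nat \<Rightarrow> real"
  have proj: "inner (S x - a) (v j) / norm (v j) = norm (v j) * x j + b j x" if j: "j \<in> J" for j x
  proof -
    have "inner (S x) (v j) = (\<Sum>i\<in>K. x i * inner (v i) (v j)) + (\<Sum>i\<in>J. x i * inner (v i) (v j))"
      unfolding S_def I(1) inner_sum_left using I by (simp add: sum.union_disjoint)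
    also have "(\<Sum>i\<in>J. x i * inner (v i) (v j)) = (\<Sum>i\<in>J. if i = j then x j * inner (v j) (v j) else 0)"
      using orth j by (intro sum.cong) auto
    also have "\<dots> = x j * (norm (v j))\<^sup>2" using I(4) j by (simp add: power2_norm_eq_inner)
    finally show ?thesis using pos[OF j]
      by (simp add: b_def inner_diff_left add_divide_distrib diff_divide_distrib power2_eq_square)
  qed
  have bound: "indicator {\<omega> \<in> space M. norm (S (\<lambda>i. Y i \<omega>) - a) \<le> \<delta>} \<omega>
      \<le> ennreal (exp (lam * \<delta>\<^sup>2)) * (\<Prod>j\<in>J. ennreal (exp (- lam * (norm (v j) * Y j \<omega> + b j (\<lambda>i. Y i \<omega>))\<^sup>2)))" for \<omega>
  proof (cases "norm (S (\<lambda>i. Y i \<omega>) - a) \<le> \<delta>")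
    case True
    have "(\<Sum>j\<in>J. (norm (v j) * Y j \<omega> + b j (\<lambda>i. Y i \<omega>))\<^sup>2) \<le> (norm (S (\<lambda>i. Y i \<omega>) - a))\<^sup>2"
      using sum_inner_squared_le_norm[OF I(4) orth pos, where x = "S (\<lambda>i. Y i \<omega>) - a"] by (simp add: proj)
    also have "\<dots> \<le> \<delta>\<^sup>2" using True by (intro power_mono) auto
    finally have "0 \<le> lam * \<delta>\<^sup>2 + (\<Sum>j\<in>J. - lam * (norm (v j) * Y j \<omega> + b j (\<lambda>i. Y i \<omega>))\<^sup>2)"
      using mult_left_mono[OF _ l] by (simp add: sum_negf sum_distrib_left[symmetric])
    then have "1 \<le> exp (lam * \<delta>\<^sup>2) * (\<Prod>j\<in>J. exp (- lam * (norm (v j) * Y j \<omega> + b j (\<lambda>i. Y i \<omega>))\<^sup>2))"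
      using I(4) by (simp add: exp_sum[symmetric] exp_add[symmetric])
    then have "ennreal 1 \<le> ennreal (exp (lam * \<delta>\<^sup>2) * (\<Prod>j\<in>J. exp (- lam * (norm (v j) * Y j \<omega> + b j (\<lambda>i. Y i \<omega>))\<^sup>2)))"
      by (rule ennreal_leI)
    also have "\<dots> = ennreal (exp (lam * \<delta>\<^sup>2)) * (\<Prod>j\<in>J. ennreal (exp (- lam * (norm (v j) * Y j \<omega> + b j (\<lambda>i. Y i \<omega>))\<^sup>2)))"
      by (subst prod_ennreal) (auto intro!: ennreal_mult' )
    finally show ?thesis by (auto split: split_indicator)
  qed (auto split: split_indicator)
  define F where "F x = (\<Prod>j\<in>J. ennreal (exp (- lam * (norm (v j) * x j + b j x)\<^sup>2)))" for x
  have F_meas [measurable]: "F \<in> borel_measurable (Pi\<^sub>M I ?N)"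
    unfolding F_def[abs_def] b_def using I
    by (intro borel_measurable_prod_ennreal) (auto intro!: measurable_compose[OF _ measurable_ennreal])
  have distr: "distr M (\<Pi>\<^sub>M i\<in>I. borel) (\<lambda>\<omega>. \<lambda>i\<in>I. Y i \<omega>) = Pi\<^sub>M I ?N"
  proof -
    have "distr M (\<Pi>\<^sub>M i\<in>I. borel) (\<lambda>\<omega>. \<lambda>i\<in>I. Y i \<omega>) = (\<Pi>\<^sub>M i\<in>I. distr M borel (Y i))"
      using indep indep_vars_iff_distr_eq_PiM'[OF False, where M' = "\<lambda>_. borel" and X = Y] by auto
    also have "\<dots> = Pi\<^sub>M I ?N" using law by (intro PiM_cong) auto
    finally show ?thesis .
  qed
  have F_restrict: "F (\<lambda>i\<in>I. Y i \<omega>) = F (\<lambda>i. Y i \<omega>)" for \<omega>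
    unfolding F_def b_def using I(1) by (intro prod.cong) (auto intro!: sum.cong)
  have inner_bound: "(\<integral>\<^sup>+y. F (merge K J (x, y)) \<partial>Pi\<^sub>M J ?N) \<le> ennreal ((1 / sqrt (1 + 2 * lam * c)) ^ card J)" for x
  proof -
    have b_merge: "b j (merge K J (x, y)) = b j x" for j y
      unfolding b_def by (auto intro!: sum.cong arg_cong2[where f = "(-)"] arg_cong2[where f = "(/)"] simp: merge_def)
    have "(\<integral>\<^sup>+y. F (merge K J (x, y)) \<partial>Pi\<^sub>M J ?N)
        = (\<integral>\<^sup>+y. (\<Prod>j\<in>J. ennreal (exp (- lam * (norm (v j) * y j + b j x)\<^sup>2))) \<partial>Pi\<^sub>M J ?N)"
      unfolding F_def b_merge using I(2)
      by (intro nn_integral_cong prod.cong) (auto simp: merge_def)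
    also have "\<dots> = (\<Prod>j\<in>J. \<integral>\<^sup>+y. ennreal (exp (- lam * (norm (v j) * y + b j x)\<^sup>2)) \<partial>std_normal_distribution)"
      using I(4) by (intro P.product_nn_integral_prod) auto
    also have "\<dots> \<le> (\<Prod>j\<in>J. ennreal (1 / sqrt (1 + 2 * lam * c)))"
    proof (rule prod_mono_ennreal)
      fix j assume j: "j \<in> J"
      have "(\<integral>\<^sup>+y. ennreal (exp (- lam * (norm (v j) * y + b j x)\<^sup>2)) \<partial>std_normal_distribution)
          \<le> ennreal (1 / sqrt (1 + 2 * lam * (norm (v j))\<^sup>2))"
        by (rule nn_integral_exp_affine_std_normal[OF l])
      also have "\<dots> \<le> ennreal (1 / sqrt (1 + 2 * lam * c))"
      proof (intro ennreal_leI divide_left_mono real_sqrt_le_mono)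
        show "1 + 2 * lam * c \<le> 1 + 2 * lam * (norm (v j))\<^sup>2"
          using mult_left_mono[OF c(2)[OF j] l] by simp
      qed (use c l in \<open>auto intro!: mult_pos_pos add_pos_nonneg\<close>)
      finally show "(\<integral>\<^sup>+y. ennreal (exp (- lam * (norm (v j) * y + b j x)\<^sup>2)) \<partial>std_normal_distribution)
          \<le> ennreal (1 / sqrt (1 + 2 * lam * c))" .
    qed
    also have "\<dots> = ennreal ((1 / sqrt (1 + 2 * lam * c)) ^ card J)"
      using c l by (simp add: ennreal_power)
    finally show ?thesis .
  qed
  have ev: "{\<omega> \<in> space M. norm (S (\<lambda>i. Y i \<omega>) - a) \<le> \<delta>} \<in> sets M"
    unfolding S_def using Ym by measurable
  have "emeasure M {\<omega> \<in> space M. norm (S (\<lambda>i. Y i \<omega>) - a) \<le> \<delta>}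
      = (\<integral>\<^sup>+\<omega>. indicator {\<omega> \<in> space M. norm (S (\<lambda>i. Y i \<omega>) - a) \<le> \<delta>} \<omega> \<partial>M)"
    using ev by simp
  also have "\<dots> \<le> (\<integral>\<^sup>+\<omega>. ennreal (exp (lam * \<delta>\<^sup>2)) * F (\<lambda>i\<in>I. Y i \<omega>) \<partial>M)"
    unfolding F_restrict unfolding F_def by (intro nn_integral_mono bound)
  also have "\<dots> = (\<integral>\<^sup>+x. ennreal (exp (lam * \<delta>\<^sup>2)) * F x \<partial>distr M (\<Pi>\<^sub>M i\<in>I. borel) (\<lambda>\<omega>. \<lambda>i\<in>I. Y i \<omega>))"
  proof (rule nn_integral_distr[symmetric])
    show "(\<lambda>\<omega>. \<lambda>i\<in>I. Y i \<omega>) \<in> M \<rightarrow>\<^sub>M (\<Pi>\<^sub>M i\<in>I. borel)"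
      by (intro measurable_restrict Ym)
  qed (simp add: distr)
  also have "\<dots> = (\<integral>\<^sup>+x. ennreal (exp (lam * \<delta>\<^sup>2)) * F x \<partial>Pi\<^sub>M I ?N)"
    by (simp only: distr)
  also have "\<dots> = ennreal (exp (lam * \<delta>\<^sup>2)) * (\<integral>\<^sup>+x. F x \<partial>Pi\<^sub>M I ?N)"
    by (intro nn_integral_cmult F_meas)
  also have "(\<integral>\<^sup>+x. F x \<partial>Pi\<^sub>M I ?N) = (\<integral>\<^sup>+x. (\<integral>\<^sup>+y. F (merge K J (x, y)) \<partial>Pi\<^sub>M J ?N) \<partial>Pi\<^sub>M K ?N)"
    using F_meas I unfolding I(1) by (intro P.product_nn_integral_fold) auto
  also have "\<dots> \<le> (\<integral>\<^sup>+x. ennreal ((1 / sqrt (1 + 2 * lam * c)) ^ card J) \<partial>Pi\<^sub>M K ?N)"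
    by (intro nn_integral_mono inner_bound)
  also have "\<dots> = ennreal ((1 / sqrt (1 + 2 * lam * c)) ^ card J)"
  proof -
    interpret PK: prob_space "Pi\<^sub>M K ?N" by (intro prob_space_PiM) (rule std_normal.prob_space_axioms)
    show ?thesis by (simp add: PK.emeasure_space_1)
  qed
  finally show ?thesis
    unfolding S_def by (simp add: ennreal_mult' mult_left_mono)
qed

text \<open>One single level of the expansion suffices: level \<open>r\<close> provides \<open>n = 2 ^ r\<close> orthogonal directions
  with variance at least \<open>1 / (32 * n\<^sup>2)\<close>. The exponential parameter \<open>240 * n\<^sup>2\<close> makes each of the \<open>n\<close> factors
  equal to \<open>1 / 4\<close>, and the radius is chosen such that the exponential factor stays below \<open>2 ^ n\<close>.
  The truncated expansion replaces the bridge at the price of doubling the radius, up to an event whose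
  probability tends to zero by Chebyshev's inequality.\<close>

lemma bridge_small_ball:
  assumes M: "prob_space M" and Y: "iid_std_normal M Y" and LC: "levy_ciesielski M Y B"
    and B [measurable]: "B \<in> borel_measurable M"
  shows "emeasure M {\<omega> \<in> space M. norm (B \<omega> - a) \<le> sqrt (1 / (1920 * 2 ^ r))} \<le> ennreal ((1 / 2) ^ (2 ^ r))"
proof (rule ennreal_le_epsilon)
  interpret prob_space M by fact
  define n :: real where "n = 2 ^ r"
  define \<epsilon> where "\<epsilon> = sqrt (1 / (1920 * 2 ^ r))"
  have n: "0 < n" by (simp add: n_def)
  have \<epsilon>: "0 < \<epsilon>" "\<epsilon>\<^sup>2 = 1 / (1920 * n)" by (simp_all add: \<epsilon>_def n_def)
  have indep: "indep_vars (\<lambda>_. borel) Y {1..}" and law: "\<And>i. 1 \<le> i \<Longrightarrow> distr M borel (Y i) = std_normal_distribution"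
    using Y by (auto simp: iid_std_normal_def)
  have Ym: "Y i \<in> borel_measurable M" if "1 \<le> i" for i
    using indep that by (auto simp: indep_vars_def)
  let ?S = "\<lambda>N \<omega>. \<Sum>i=1..N. Y i \<omega> *\<^sub>R schauder_L2 i"
  let ?t = "\<lambda>N. \<integral>\<^sup>+\<omega>. ennreal ((norm (B \<omega> - ?S N \<omega>))\<^sup>2) \<partial>M"
  have S_meas [measurable]: "?S N \<in> borel_measurable M" for N
    using Ym by (intro borel_measurable_sum borel_measurable_scaleR) auto
  fix e :: real assume e: "0 < e"
  have "\<forall>\<^sub>F N in sequentially. ?t N < ennreal (\<epsilon>\<^sup>2 * e)"
    using LC e \<epsilon> n unfolding levy_ciesielski_def
    by (intro order_tendstoD(2)) (auto simp: ennreal_zero_less_mult_iff)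
  then have "\<forall>\<^sub>F N in sequentially. ?t N < ennreal (\<epsilon>\<^sup>2 * e) \<and> 2 ^ (r + 1) \<le> N"
    using eventually_ge_at_top[of "2 ^ (r + 1)"] by eventually_elim auto
  then obtain N where N: "?t N < ennreal (\<epsilon>\<^sup>2 * e)" "2 ^ (r + 1) \<le> N"
    using eventually_happens'[OF sequentially_bot] by blast
  have sub: "{\<omega> \<in> space M. norm (B \<omega> - a) \<le> \<epsilon>}
      \<subseteq> {\<omega> \<in> space M. norm (?S N \<omega> - a) \<le> 2 * \<epsilon>} \<union> {\<omega> \<in> space M. \<epsilon> \<le> norm (B \<omega> - ?S N \<omega>)}"
  proof
    fix \<omega> assume \<omega>: "\<omega> \<in> {\<omega> \<in> space M. norm (B \<omega> - a) \<le> \<epsilon>}"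
    have "norm (?S N \<omega> - a) \<le> norm (B \<omega> - a) + norm (B \<omega> - ?S N \<omega>)"
      using norm_triangle_ineq4[of "B \<omega> - a" "B \<omega> - ?S N \<omega>"] by simp
    with \<omega> show "\<omega> \<in> {\<omega> \<in> space M. norm (?S N \<omega> - a) \<le> 2 * \<epsilon>} \<union> {\<omega> \<in> space M. \<epsilon> \<le> norm (B \<omega> - ?S N \<omega>)}"
      by auto
  qed
  have "emeasure M {\<omega> \<in> space M. norm (B \<omega> - a) \<le> \<epsilon>}
      \<le> emeasure M ({\<omega> \<in> space M. norm (?S N \<omega> - a) \<le> 2 * \<epsilon>} \<union> {\<omega> \<in> space M. \<epsilon> \<le> norm (B \<omega> - ?S N \<omega>)})"
    by (rule emeasure_mono[OF sub]) measurable
  also have "\<dots> \<le> emeasure M {\<omega> \<in> space M. norm (?S N \<omega> - a) \<le> 2 * \<epsilon>} + emeasure M {\<omega> \<in> space M. \<epsilon> \<le> norm (B \<omega> - ?S N \<omega>)}"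
    by (rule emeasure_subadditive) measurable
  also have "\<dots> \<le> ennreal ((1 / 2) ^ (2 ^ r)) + ennreal e"
  proof (rule add_mono)
    have "emeasure M {\<omega> \<in> space M. norm (?S N \<omega> - a) \<le> 2 * \<epsilon>}
        \<le> ennreal (exp (240 * n\<^sup>2 * (2 * \<epsilon>)\<^sup>2) * (1 / sqrt (1 + 2 * (240 * n\<^sup>2) * (1 / (32 * 4 ^ r)))) ^ card {2 ^ r..<2 ^ (r + 1) :: nat})"
    proof (rule gaussian_sum_small_ball[OF M])
      show "indep_vars (\<lambda>_. borel) Y {1..N}" by (rule indep_vars_subset[OF indep]) auto
      show "{2 ^ r..<2 ^ (r + 1)} \<subseteq> {1..N}"
        using N(2) one_le_power[of "2::nat" r] by auto
      show "1 / (32 * 4 ^ r) \<le> (norm (schauder_L2 j))\<^sup>2" if "j \<in> {2 ^ r..<2 ^ (r + 1)}" for j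
        using that by (rule norm_schauder_L2(2))
    qed (auto simp: law orthogonal_schauder_L2)
    also have "exp (240 * n\<^sup>2 * (2 * \<epsilon>)\<^sup>2) * (1 / sqrt (1 + 2 * (240 * n\<^sup>2) * (1 / (32 * 4 ^ r)))) ^ card {2 ^ r..<2 ^ (r + 1) :: nat}
        \<le> (1 / 2) ^ (2 ^ r)"
    proof -
      have "n\<^sup>2 = 4 ^ r" by (simp add: n_def power2_eq_square flip: power_mult_distrib)
      then have "1 + 2 * (240 * n\<^sup>2) * (1 / (32 * 4 ^ r)) = 16" by simp
      then have 1: "1 / sqrt (1 + 2 * (240 * n\<^sup>2) * (1 / (32 * 4 ^ r))) = 1 / 4"
        by simp
      have 2: "card {2 ^ r..<2 ^ (r + 1) :: nat} = 2 ^ r" by simp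
      have "240 * n\<^sup>2 * (2 * \<epsilon>)\<^sup>2 = n / 2"
        unfolding power_mult_distrib \<epsilon>(2) using n by (simp add: power2_eq_square)
      also have "\<dots> = real (2 ^ r) * (1 / 2)" by (simp add: n_def)
      finally have 3: "exp (240 * n\<^sup>2 * (2 * \<epsilon>)\<^sup>2) = exp (1 / 2) ^ (2 ^ r)"
        by (simp only: exp_of_nat_mult)
      have "exp (1 / 2) \<le> (2 :: real)"
      proof (rule power2_le_imp_le)
        show "(exp (1 / 2))\<^sup>2 \<le> (2 :: real)\<^sup>2"
          using exp_le by (simp add: power2_eq_square flip: exp_add)
      qed simp
      then have "exp (1 / 2) ^ (2 ^ r) * (1 / 4) ^ (2 ^ r) \<le> (2 :: real) ^ (2 ^ r) * (1 / 4) ^ (2 ^ r)"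
        by (intro mult_right_mono power_mono) auto
      also have "\<dots> = (1 / 2) ^ (2 ^ r)" by (simp flip: power_mult_distrib)
      finally show ?thesis by (simp only: 1 2 3)
    qed
    finally show "emeasure M {\<omega> \<in> space M. norm (?S N \<omega> - a) \<le> 2 * \<epsilon>} \<le> ennreal ((1 / 2) ^ (2 ^ r))"
      by (simp add: ennreal_leI)
  next
    have "emeasure M {\<omega> \<in> space M. \<epsilon> \<le> norm (B \<omega> - ?S N \<omega>)}
        = (\<integral>\<^sup>+\<omega>. indicator {\<omega> \<in> space M. \<epsilon> \<le> norm (B \<omega> - ?S N \<omega>)} \<omega> \<partial>M)"
      by (rule nn_integral_indicator[symmetric]) measurable
    also have "\<dots> \<le> (\<integral>\<^sup>+\<omega>. ennreal (1 / \<epsilon>\<^sup>2) * ennreal ((norm (B \<omega> - ?S N \<omega>))\<^sup>2) \<partial>M)"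
    proof (intro nn_integral_mono)
      fix \<omega>
      have "ennreal 1 \<le> ennreal (1 / \<epsilon>\<^sup>2 * (norm (B \<omega> - ?S N \<omega>))\<^sup>2)" if "\<epsilon> \<le> norm (B \<omega> - ?S N \<omega>)"
      proof (rule ennreal_leI)
        have "\<epsilon>\<^sup>2 \<le> (norm (B \<omega> - ?S N \<omega>))\<^sup>2" using that \<epsilon>(1) by (intro power_mono) auto
        then show "1 \<le> 1 / \<epsilon>\<^sup>2 * (norm (B \<omega> - ?S N \<omega>))\<^sup>2" using \<epsilon>(1) by (simp add: field_simps)
      qed
      then show "indicator {\<omega> \<in> space M. \<epsilon> \<le> norm (B \<omega> - ?S N \<omega>)} \<omega>
          \<le> ennreal (1 / \<epsilon>\<^sup>2) * ennreal ((norm (B \<omega> - ?S N \<omega>))\<^sup>2)"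
        by (subst ennreal_mult[symmetric]) (auto split: split_indicator)
    qed
    also have "\<dots> = ennreal (1 / \<epsilon>\<^sup>2) * ?t N"
      by (rule nn_integral_cmult) measurable
    also have "\<dots> \<le> ennreal (1 / \<epsilon>\<^sup>2) * ennreal (\<epsilon>\<^sup>2 * e)"
      using N(1) by (intro mult_left_mono) auto
    also have "\<dots> = ennreal e"
      using \<epsilon>(1) e by (subst ennreal_mult[symmetric]) auto
    finally show "emeasure M {\<omega> \<in> space M. \<epsilon> \<le> norm (B \<omega> - ?S N \<omega>)} \<le> ennreal e" .
  qed
  finally show "emeasure M {\<omega> \<in> space M. norm (B \<omega> - a) \<le> sqrt (1 / (1920 * 2 ^ r))} \<le> ennreal ((1 / 2) ^ (2 ^ r)) + ennreal e"
    by (simp add: \<epsilon>_def)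
qed

section \<open>Lower bounds for quantization\<close>

lemma ennreal_sqrt_mono: "x \<le> y \<Longrightarrow> ennreal_sqrt x \<le> ennreal_sqrt y"
  by (auto simp: ennreal_sqrt_def top_unique less_top intro!: ennreal_leI real_sqrt_le_mono enn2real_mono)

lemma ennreal_sqrt_ennreal: "0 \<le> x \<Longrightarrow> ennreal_sqrt (ennreal x) = ennreal (sqrt x)"
  by (simp add: ennreal_sqrt_def)

text \<open>The complement of the support is a union of open null sets, and by the Lindelof property
  countably many of them suffice.\<close>

lemma emeasure_compl_measure_support:
  fixes \<nu> :: "'v::second_countable_topology measure"
  assumes "sets \<nu> = sets borel"
  shows "- measure_support \<nu> \<in> null_sets \<nu>"
proof -
  let ?F = "{U. open U \<and> emeasure \<nu> U = 0}"
  obtain F where F: "F \<subseteq> ?F" "countable F" "\<Union>F = \<Union>?F"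
    using Lindelof[of ?F] by auto
  have "(\<Union>U\<in>F. U) \<in> null_sets \<nu>"
    using F(1,2) assms by (intro null_sets_UN') (auto intro!: null_setsI)
  moreover have "\<Union>?F = - measure_support \<nu>"
    by (auto simp: measure_support_def zero_less_iff_neq_zero)
  ultimately show ?thesis using F(3) by simp
qed

text \<open>If \<open>\<nu>\<close> has at most \<open>2 ^ p\<close> atoms, then under any coupling the first component is within \<open>\<epsilon>\<close> of the
  second one only if it is within \<open>\<epsilon>\<close> of some atom, which has probability at most \<open>1 / 2\<close> by the union bound.
  With probability at least \<open>1 / 2\<close> the distance exceeds \<open>\<epsilon>\<close>.\<close>

lemma quant_lower_bound:
  fixes \<mu> :: "'v::{banach, second_countable_topology} measure"
  assumes \<epsilon>: "0 < \<epsilon>" and small: "\<And>a. emeasure \<mu> {x. norm (x - a) \<le> \<epsilon>} \<le> ennreal ((1 / 2) ^ (p + 1))"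
  shows "ennreal (\<epsilon> / 2) \<le> quant \<mu> p"
  unfolding quant_def wasserstein2_def
proof (intro INF_greatest)
  fix \<nu> and \<pi> :: "('v \<times> 'v) measure"
  assume \<nu>: "\<nu> \<in> finite_support_measures p" and \<pi>: "\<pi> \<in> couplings \<mu> \<nu>"
  define S where "S = measure_support \<nu>"
  have S: "finite S" "card S \<le> 2 ^ p" "sets \<nu> = sets borel"
    using \<nu> by (auto simp: S_def finite_support_measures_def second_moment_measures_def)
  have [measurable_cong, simp]: "sets \<pi> = sets (borel \<Otimes>\<^sub>M borel)"
    and marg: "distr \<pi> borel fst = \<mu>" "distr \<pi> borel snd = \<nu>" and "prob_space \<pi>"
    using \<pi> by (auto simp: couplings_def)
  interpret prob_space \<pi> by fact
  have sp [simp]: "space \<pi> = UNIV"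
    using sets_eq_imp_space_eq[OF \<open>sets \<pi> = _\<close>] by (simp add: space_pair_measure)
  define E where "E = {z :: 'v \<times> 'v. norm (fst z - snd z) \<le> \<epsilon>}"
  have fs [measurable]: "fst \<in> borel_measurable \<pi>" "snd \<in> borel_measurable \<pi>"
    by (auto simp: measurable_cong_sets[OF \<open>sets \<pi> = _\<close> refl])
  have E [measurable]: "E \<in> sets \<pi>"
  proof -
    have "{z \<in> space \<pi>. norm (fst z - snd z) \<le> \<epsilon>} \<in> sets \<pi>" by measurable
    then show ?thesis by (simp add: E_def)
  qed
  have snd_sets: "snd -` (- S) \<in> sets \<pi>"
    using measurable_sets[OF fs(2), of "- S"] S(1) by (auto simp: borel_open open_Compl finite_imp_closed)
  have fst_sets: "fst -` {x. norm (x - a) \<le> \<epsilon>} \<in> sets \<pi>" for a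
    using measurable_sets[OF fs(1), of "{x. norm (x - a) \<le> \<epsilon>}"] by auto
  have "emeasure \<pi> E \<le> emeasure \<pi> (snd -` (- S) \<union> (\<Union>a\<in>S. fst -` {x. norm (x - a) \<le> \<epsilon>}))"
  proof (rule emeasure_mono)
    show "snd -` (- S) \<union> (\<Union>a\<in>S. fst -` {x. norm (x - a) \<le> \<epsilon>}) \<in> sets \<pi>"
      using S(1) snd_sets fst_sets by auto
  qed (auto simp: E_def)
  also have "\<dots> \<le> emeasure \<pi> (snd -` (- S)) + emeasure \<pi> (\<Union>a\<in>S. fst -` {x. norm (x - a) \<le> \<epsilon>})"
  proof (rule emeasure_subadditive)
    show "snd -` (- S) \<in> sets \<pi>" "(\<Union>a\<in>S. fst -` {x. norm (x - a) \<le> \<epsilon>}) \<in> sets \<pi>"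
      using S(1) snd_sets fst_sets by auto
  qed
  also have "\<dots> \<le> 0 + (\<Sum>a\<in>S. ennreal ((1 / 2) ^ (p + 1)))"
  proof (rule add_mono)
    have "emeasure \<nu> (- S) = 0"
      using emeasure_compl_measure_support[OF S(3)] by (auto simp: S_def)
    then show "emeasure \<pi> (snd -` (- S)) \<le> 0"
      using S(1) unfolding marg(2)[symmetric]
      by (subst (asm) emeasure_distr) (auto intro!: borel_open open_Compl finite_imp_closed)
    have "emeasure \<pi> (\<Union>a\<in>S. fst -` {x. norm (x - a) \<le> \<epsilon>}) \<le> (\<Sum>a\<in>S. emeasure \<pi> (fst -` {x. norm (x - a) \<le> \<epsilon>}))"
      by (rule emeasure_subadditive_finite[OF S(1)]) (use fst_sets in auto)
    also have "\<dots> \<le> (\<Sum>a\<in>S. ennreal ((1 / 2) ^ (p + 1)))"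
    proof (rule sum_mono)
      fix a
      have "emeasure \<pi> (fst -` {x. norm (x - a) \<le> \<epsilon>}) = emeasure \<mu> {x. norm (x - a) \<le> \<epsilon>}"
        unfolding marg(1)[symmetric] by (subst emeasure_distr) auto
      then show "emeasure \<pi> (fst -` {x. norm (x - a) \<le> \<epsilon>}) \<le> ennreal ((1 / 2) ^ (p + 1))"
        using small by simp
    qed
    finally show "emeasure \<pi> (\<Union>a\<in>S. fst -` {x. norm (x - a) \<le> \<epsilon>}) \<le> (\<Sum>a\<in>S. ennreal ((1 / 2) ^ (p + 1)))" .
  qed
  also have "\<dots> = ennreal (real (card S) * (1 / 2) ^ (p + 1))"
    unfolding sum_constant ennreal_of_nat_eq_real_of_nat by (subst ennreal_mult) auto
  also have "\<dots> \<le> ennreal (1 / 2)"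
  proof (rule ennreal_leI)
    have "real (card S) \<le> 2 ^ p" using S(2) by (metis of_nat_le_iff of_nat_numeral of_nat_power)
    then have "real (card S) * (1 / 2) ^ (p + 1) \<le> 2 ^ p * (1 / 2) ^ (p + 1)"
      by (intro mult_right_mono) auto
    also have "\<dots> = 1 / 2" by (simp add: power_one_over)
    finally show "real (card S) * (1 / 2) ^ (p + 1) \<le> 1 / 2" .
  qed
  finally have "prob E \<le> 1 / 2"
    unfolding emeasure_eq_measure by (subst (asm) ennreal_le_iff) auto
  then have far: "1 / 2 \<le> prob (- E)"
    using prob_compl[OF E] by (simp add: Compl_eq_Diff_UNIV)
  have "ennreal ((\<epsilon> / 2)\<^sup>2) \<le> ennreal (\<epsilon>\<^sup>2 * prob (- E))"
  proof (rule ennreal_leI)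
    have "(\<epsilon> / 2)\<^sup>2 \<le> \<epsilon>\<^sup>2 * (1 / 2)" by (simp add: power_divide)
    also have "\<dots> \<le> \<epsilon>\<^sup>2 * prob (- E)" using far by (intro mult_left_mono) auto
    finally show "(\<epsilon> / 2)\<^sup>2 \<le> \<epsilon>\<^sup>2 * prob (- E)" .
  qed
  also have "\<dots> = (\<integral>\<^sup>+z. ennreal (\<epsilon>\<^sup>2) * indicator (- E) z \<partial>\<pi>)"
  proof -
    have "- E \<in> sets \<pi>"
      using sets.compl_sets[OF E] by (simp add: Compl_eq_Diff_UNIV)
    then show ?thesis
      by (subst nn_integral_cmult_indicator) (auto simp: emeasure_eq_measure ennreal_mult)
  qed
  also have "\<dots> \<le> (\<integral>\<^sup>+z. ennreal ((norm (fst z - snd z))\<^sup>2) \<partial>\<pi>)"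
    using \<epsilon> by (intro nn_integral_mono) (auto simp: E_def intro!: ennreal_leI power_mono split: split_indicator)
  finally have "ennreal ((\<epsilon> / 2)\<^sup>2) \<le> (\<integral>\<^sup>+z. ennreal ((norm (fst z - snd z))\<^sup>2) \<partial>\<pi>)" .
  from ennreal_sqrt_mono[OF this] show "ennreal (\<epsilon> / 2) \<le> ennreal_sqrt (\<integral>\<^sup>+z. ennreal ((norm (fst z - snd z))\<^sup>2) \<partial>\<pi>)"
    using \<epsilon> by (simp add: ennreal_sqrt_ennreal)
qed

section \<open>Bit numbers and the main result\<close>

lemma total_bits_bit_numbers:
  "real (total_bits l (bit_numbers l)) = 2 ^ (l + 2) - 2 * real l - 4"
proof -
  have T: "total_bits l (bit_numbers l) = (\<Sum>r<l. 2 ^ r * (2 * (l - r)))" for l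
  proof -
    have "total_bits l (bit_numbers l) = (\<Sum>r<l. \<Sum>i\<in>{2 ^ r..<2 ^ (r + 1)}. bit_numbers l i)"
      unfolding total_bits_def by (rule sum_dyadic_levels)
    also have "\<dots> = (\<Sum>r<l. \<Sum>i\<in>{2 ^ r..<2 ^ (r + 1) :: nat}. 2 * (l - r))"
      by (intro sum.cong refl) (simp add: bit_numbers_def dyadic_level_block)
    finally show ?thesis by simp
  qed
  have "real (\<Sum>r<l. 2 ^ r * (2 * (l - r))) = 2 ^ (l + 2) - 2 * real l - 4"
  proof (induction l)
    case (Suc l)
    have "(\<Sum>r<Suc l. 2 ^ r * (2 * (Suc l - r))) = (\<Sum>r<Suc l. 2 ^ r * (2 * (l - r)) + 2 * 2 ^ r)"
      by (intro sum.cong) (auto simp: Suc_diff_le)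
    also have "\<dots> = (\<Sum>r<l. 2 ^ r * (2 * (l - r))) + 2 * (\<Sum>r<Suc l. 2 ^ r)"
      by (simp add: sum.distrib sum_distrib_left)
    also have "real \<dots> = 2 ^ (l + 2) - 2 * real l - 4 + 2 * (2 ^ (Suc l) - 1)"
      using Suc by (simp add: geometric_sum)
    finally show ?case by simp
  qed simp
  then show ?thesis unfolding T .
qed

lemma total_bits_bit_numbers_le: "total_bits l (bit_numbers l) \<le> 4 * 2 ^ l"
proof -
  have "real (total_bits l (bit_numbers l)) \<le> real (4 * 2 ^ l)"
    unfolding total_bits_bit_numbers by simp
  then show ?thesis by (simp only: of_nat_le_iff)
qed

lemma total_bits_bit_numbers_ge:
  assumes "1 \<le> l"
  shows "2 ^ l \<le> total_bits l (bit_numbers l)"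
proof -
  have "2 * real l + 4 \<le> 3 * 2 ^ l"
    using assms by (induction l rule: nat_induct_at_least) auto
  then have "real (2 ^ l) \<le> real (total_bits l (bit_numbers l))"
    unfolding total_bits_bit_numbers by (simp add: power_add)
  then show ?thesis by (simp only: of_nat_le_iff)
qed

lemma weakly_equiv_onI:
  assumes "0 < c" "0 < d"
    and "\<And>m. m \<in> A \<Longrightarrow> f m \<le> ennreal c * g m" "\<And>m. m \<in> A \<Longrightarrow> g m \<le> ennreal d * f m"
  shows "weakly_equiv_on A f g"
  using assms unfolding weakly_equiv_on_def weakly_dominated_on_def by blast

lemma powr_minus_half: "0 \<le> x \<Longrightarrow> x powr (- (1 / 2)) = 1 / sqrt x"
  by (simp add: powr_minus_divide powr_half_sqrt)

text \<open>Level \<open>r + 1\<close> of the expansion has between \<open>p + 1\<close> and \<open>2 * p\<close> members, enough to beat the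
  \<open>2 ^ p\<close> atoms by a factor of two, at a radius of order \<open>p powr (- 1 / 2)\<close>.\<close>

lemma quant_bridge_lower_bound:
  assumes M: "prob_space M" and Y: "iid_std_normal M Y" and LC: "levy_ciesielski M Y B"
    and B [measurable]: "B \<in> borel_measurable M" and p: "1 \<le> p"
  shows "ennreal (1 / 200 * real p powr (- 1 / 2)) \<le> quant (distr M borel B) p"
proof -
  obtain r where r: "2 ^ r \<le> p" "p < 2 ^ (r + 1)"
    using ex_power_ivl1[of 2 p] p by auto
  define \<epsilon> where "\<epsilon> = sqrt (1 / (1920 * 2 ^ (r + 1)))"
  have "ennreal (\<epsilon> / 2) \<le> quant (distr M borel B) p"
  proof (rule quant_lower_bound)
    show "0 < \<epsilon>" by (simp add: \<epsilon>_def)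
    fix a
    have "emeasure (distr M borel B) {x. norm (x - a) \<le> \<epsilon>} = emeasure M {\<omega> \<in> space M. norm (B \<omega> - a) \<le> \<epsilon>}"
      by (subst emeasure_distr) (auto intro!: arg_cong[where f = "emeasure M"])
    also have "\<dots> \<le> ennreal ((1 / 2) ^ (2 ^ (r + 1)))"
      unfolding \<epsilon>_def by (rule bridge_small_ball[OF M Y LC B])
    also have "\<dots> \<le> ennreal ((1 / 2) ^ (p + 1))"
      using r(2) by (intro ennreal_leI power_decreasing) auto
    finally show "emeasure (distr M borel B) {x. norm (x - a) \<le> \<epsilon>} \<le> ennreal ((1 / 2) ^ (p + 1))" .
  qed
  moreover have "1 / 200 * real p powr (- 1 / 2) \<le> \<epsilon> / 2"
  proof -
    have "real (2 ^ r) \<le> real p" using r(1) by (simp only: of_nat_le_iff)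
    then have "1920 * 2 ^ (r + 1) \<le> 10000 * real p"
      unfolding power_add of_nat_power of_nat_numeral power_one_right by linarith
    then have "sqrt (1 / (10000 * real p)) \<le> \<epsilon>"
      unfolding \<epsilon>_def using p by (intro real_sqrt_le_mono divide_left_mono) auto
    moreover have "sqrt (1 / (10000 * real p)) = 1 / 100 * real p powr (- 1 / 2)"
      using real_sqrt_mult[of 10000 "real p"] by (simp add: powr_minus_half real_sqrt_divide real_sqrt_mult)
    ultimately show ?thesis by simp
  qed
  ultimately show ?thesis by (meson ennreal_leI order_trans)
qed

theorem theorem2:
  fixes M :: "'a measure"
    and B :: "'a \<Rightarrow> L2"
    and Y :: "nat \<Rightarrow> 'a \<Rightarrow> real"
    and \<mu> :: "L2 measure"
  assumes "prob_space M"
    and "brownian_bridge M B"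
    and "iid_std_normal M Y"
    and "levy_ciesielski M Y B"
    and "\<mu> = distr M borel B"
  shows "weakly_equiv_on {1..} (rbit \<mu>) (quant \<mu>)
      \<and> weakly_equiv_on {1..} (quant \<mu>) (\<lambda>p. ennreal (real p powr (- 1 / 2)))
      \<and> weakly_equiv_on {1..}
           (\<lambda>l. ennreal_sqrt (\<integral>\<^sup>+\<omega>. ennreal ((norm (B \<omega> - bridge_approx Y l (bit_numbers l) \<omega>))\<^sup>2) \<partial>M))
           (\<lambda>l. rbit \<mu> (total_bits l (bit_numbers l)))
      \<and> (\<forall>l\<ge>1. real (total_bits l (bit_numbers l)) = 2 ^ (l + 2) - 2 * real l - 4)
      \<and> weakly_equiv_on {1..} (\<lambda>l. of_nat (total_bits l (bit_numbers l))) (\<lambda>l. 2 ^ l)"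
proof -
  let ?e = "\<lambda>l. ennreal_sqrt (\<integral>\<^sup>+\<omega>. ennreal ((norm (B \<omega> - bridge_approx Y l (bit_numbers l) \<omega>))\<^sup>2) \<partial>M)"
  let ?b = "\<lambda>l. total_bits l (bit_numbers l)"
  note M = assms(1) and Y = assms(3) and LC = assms(4) and \<mu> = assms(5)
  interpret prob_space M by fact
  have B: "B \<in> borel_measurable M"
    using assms(2) by (simp add: brownian_bridge_def centered_gaussian_element_def)
  have Ym: "Y i \<in> borel_measurable M" if "1 \<le> i" for i
    using Y that by (auto simp: iid_std_normal_def indep_vars_def)
  obtain C where C: "0 < C"
    "\<And>l. (\<integral>\<^sup>+\<omega>. ennreal ((norm (B \<omega> - bridge_approx Y l (bit_numbers l) \<omega>))\<^sup>2) \<partial>M) \<le> ennreal (C / 2 ^ l)"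
    using bridge_approx_error[OF Y Ym LC B] by metis
  have e_le: "?e l \<le> ennreal (sqrt (C / 2 ^ l))" for l
    using ennreal_sqrt_mono[OF C(2)[of l]] C(1) by (simp add: ennreal_sqrt_ennreal)
  have rbit_le_e: "rbit \<mu> (?b l) \<le> ?e l" for l
  proof -
    have "rbit \<mu> (?b l) \<le> wasserstein2 \<mu> (distr M borel (bridge_approx Y l (bit_numbers l)))"
      unfolding rbit_def by (intro INF_lower bridge_approx_in_random_bit_measures M Y)
    also have "\<dots> \<le> ?e l"
      unfolding \<mu> by (intro wasserstein2_le M B borel_measurable_bridge_approx Ym)
    finally show ?thesis .
  qed
  have lower: "ennreal (real p powr (- 1 / 2)) \<le> ennreal 200 * quant \<mu> p" if "1 \<le> p" for p
  proof -
    have "ennreal (real p powr (- 1 / 2)) = ennreal 200 * ennreal (1 / 200 * real p powr (- 1 / 2))"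
      by (subst ennreal_mult[symmetric]) auto
    also have "\<dots> \<le> ennreal 200 * quant \<mu> p"
      unfolding \<mu> by (intro mult_left_mono quant_bridge_lower_bound[OF M Y LC B that]) auto
    finally show ?thesis .
  qed
  have upper: "rbit \<mu> p \<le> ennreal (sqrt (8 * C)) * ennreal (real p powr (- 1 / 2))" if p: "1 \<le> p" for p
  proof -
    obtain k where k: "2 ^ k \<le> p" "p < 2 ^ (k + 1)"
      using ex_power_ivl1[of 2 p] p by auto
    (* The bit vector for l uses at most 2 ^ (l + 2) <= p bits. For k < 2 the truncated subtraction
       gives l = 0, that is, no bits and the zero approximation. *)
    define l where "l = k - 2"
    have "?b l \<le> p"
    proof (cases "2 \<le> k")
      case True
      then obtain j where "k = 2 + j" using le_Suc_ex by blast
      then have "4 * 2 ^ l = (2 :: nat) ^ k" by (simp add: l_def)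
      with total_bits_bit_numbers_le[of l] k(1) show ?thesis by linarith
    next
      case False
      then show ?thesis by (simp add: l_def total_bits_def)
    qed
    then have "rbit \<mu> p \<le> rbit \<mu> (?b l)" by (rule rbit_antimono)
    also have "\<dots> \<le> ?e l" by (rule rbit_le_e)
    also have "\<dots> \<le> ennreal (sqrt (C / 2 ^ l))" by (rule e_le)
    also have "\<dots> \<le> ennreal (sqrt (8 * C / real p))"
    proof (intro ennreal_leI real_sqrt_le_mono)
      have "(2 :: nat) ^ (k + 1) \<le> 2 ^ (l + 3)" by (intro power_increasing) (auto simp: l_def)
      with k(2) have "real p \<le> real (2 ^ (l + 3))" by (simp only: of_nat_le_iff)
      then have "C * real p \<le> C * (8 * 2 ^ l)"
        using C(1) by (intro mult_left_mono) (auto simp: power_add)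
      then show "C / 2 ^ l \<le> 8 * C / real p" using p by (simp add: field_simps)
    qed
    also have "sqrt (8 * C / real p) = sqrt (8 * C) * real p powr (- 1 / 2)"
      by (simp add: powr_minus_half real_sqrt_divide)
    finally show ?thesis using C(1) by (simp add: ennreal_mult)
  qed
  have 1: "weakly_equiv_on {1..} (rbit \<mu>) (quant \<mu>)"
  proof (rule weakly_equiv_onI[where c = "sqrt (8 * C) * 200" and d = 1])
    fix p :: nat assume "p \<in> {1..}"
    then have "rbit \<mu> p \<le> ennreal (sqrt (8 * C)) * (ennreal 200 * quant \<mu> p)"
      by (intro order_trans[OF upper mult_left_mono[OF lower]]) auto
    then show "rbit \<mu> p \<le> ennreal (sqrt (8 * C) * 200) * quant \<mu> p"
      using C(1) by (simp add: ennreal_mult mult.assoc)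
  qed (use C(1) quant_le_rbit in auto)
  have 2: "weakly_equiv_on {1..} (quant \<mu>) (\<lambda>p. ennreal (real p powr (- 1 / 2)))"
  proof (rule weakly_equiv_onI[where c = "sqrt (8 * C)" and d = 200])
    fix p :: nat assume "p \<in> {1..}"
    then show "quant \<mu> p \<le> ennreal (sqrt (8 * C)) * ennreal (real p powr (- 1 / 2))"
      by (intro order_trans[OF quant_le_rbit upper]) simp
  next
    fix p :: nat assume "p \<in> {1..}"
    then show "ennreal (real p powr (- 1 / 2)) \<le> ennreal 200 * quant \<mu> p"
      by (intro lower) simp
  qed (use C(1) in auto)
  have 3: "weakly_equiv_on {1..} ?e (\<lambda>l. rbit \<mu> (?b l))"
  proof (rule weakly_equiv_onI[where c = "sqrt (4 * C) * 200" and d = 1])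
    fix l :: nat assume "l \<in> {1..}"
    then have b: "2 ^ l \<le> ?b l" by (intro total_bits_bit_numbers_ge) simp
    then have b1: "1 \<le> ?b l" using one_le_power[of "2::nat" l] by linarith
    have "sqrt (C / 2 ^ l) \<le> sqrt (4 * C) * real (?b l) powr (- 1 / 2)"
    proof -
      have "real (?b l) \<le> real (4 * 2 ^ l)"
        using total_bits_bit_numbers_le[of l] by (simp only: of_nat_le_iff)
      then have "C * real (?b l) \<le> C * (4 * 2 ^ l)" using C(1) by (intro mult_left_mono) auto
      then have "sqrt (C / 2 ^ l) \<le> sqrt (4 * C / real (?b l))"
        using b1 by (intro real_sqrt_le_mono) (simp add: field_simps)
      then show ?thesis by (simp add: powr_minus_half real_sqrt_divide)
    qed
    then have "?e l \<le> ennreal (sqrt (4 * C) * real (?b l) powr (- 1 / 2))"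
      using e_le[of l] by (meson ennreal_leI order_trans)
    also have "\<dots> = ennreal (sqrt (4 * C)) * ennreal (real (?b l) powr (- 1 / 2))"
      using C(1) by (intro ennreal_mult) auto
    also have "\<dots> \<le> ennreal (sqrt (4 * C)) * (ennreal 200 * rbit \<mu> (?b l))"
      using order_trans[OF lower[OF b1] mult_left_mono[OF quant_le_rbit]]
      by (intro mult_left_mono) auto
    also have "\<dots> = ennreal (sqrt (4 * C) * 200) * rbit \<mu> (?b l)"
      using C(1) by (subst ennreal_mult) (auto simp: mult.assoc)
    finally show "?e l \<le> ennreal (sqrt (4 * C) * 200) * rbit \<mu> (?b l)" .
  qed (use C(1) rbit_le_e in auto)
  have 4: "weakly_equiv_on {1..} (\<lambda>l. of_nat (?b l)) (\<lambda>l. 2 ^ l)"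
  proof (rule weakly_equiv_onI[where c = 4 and d = 1])
    fix l :: nat assume "l \<in> {1..}"
    have "of_nat (?b l) \<le> (of_nat (4 * 2 ^ l) :: ennreal)"
      using total_bits_bit_numbers_le[of l] by (simp only: of_nat_le_iff)
    then show "of_nat (?b l) \<le> ennreal 4 * 2 ^ l" by simp
  next
    fix l :: nat assume "l \<in> {1..}"
    have "of_nat (2 ^ l) \<le> (of_nat (?b l) :: ennreal)"
      using total_bits_bit_numbers_ge[of l] \<open>l \<in> {1..}\<close> by (simp only: of_nat_le_iff atLeast_iff)
    then show "2 ^ l \<le> ennreal 1 * of_nat (?b l)" by simp
  qed auto
  from 1 2 3 4 show ?thesis by (simp add: total_bits_bit_numbers)
qed

end
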